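(* Let $0<\alpha<0.3$. Then for every $f\in\mathcal F$ and every $\varepsilon>0$, $$a_1\,\omega_z(\varepsilon;f)\le R_z(\varepsilon;f)\le A_1\,\omega_z(\varepsilon;f),$$ $$a_1\,\omega_m(\varepsilon;f)\le R_m(\varepsilon;f)\le A_1\,\omega_m(\varepsilon;f),$$ $$b_\alpha\,\omega_z(\varepsilon/3;f)\le L_{z,\alpha}(\varepsilon;f)\le B_\alpha\,\omega_z(\varepsilon;f),$$ $$b_\alpha\,\omega_m(\varepsilon/3;f)\le L_{m,\alpha}(\varepsilon;f)\le B_\alpha\,\omega_m(\varepsilon;f),$$ where the constants can be taken as $a_1=\Phi(-0.5)$, $A_1=1.5$, $b_\alpha=0.6-2\alpha$ and $B_\alpha=3(1-2\alpha)z_\alpha$.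
   Context: $\Phi$ is the standard normal cdf and $z_\alpha=\Phi^{-1}(1-\alpha)$. $\mathcal F$ is the collection of convex functions $f:[0,1]\to\mathbb R$ with a unique minimizer $Z(f)=\arg\min_{0\le t\le1}f(t)$; $M(f)=f(Z(f))$ is the minimum value. $\|\cdot\|_2$ is the $L_2[0,1]$ norm. White noise model: one observes $dY(t)=f(t)\,dt+\varepsilon\,dW(t)$, $0\le t\le 1$, with $W$ a standard Brownian motion and $\varepsilon>0$ the noise level; $\mathbb E_f$ denotes expectation when the drift is $f$. Estimation benchmarks: $$R_z(\varepsilon;f)=\sup_{g\in\mathcal F}\inf_{\hat Z}\max_{h\in\{f,g\}}\mathbb E_h|\hat Z-Z(h)|,\qquad R_m(\varepsilon;f)=\sup_{g\in\mathcal F}\inf_{\hat M}\max_{h\in\{f,g\}}\mathbb E_h|\hat M-M(h)|,$$ the infima being over all estimators based on $Y$. Inference benchmarks: for $\mathcal G\subseteq\mathcal F$ let $\mathcal I_{z,\alpha}(\mathcal G)$ (resp. $\mathcal I_{m,\alpha}(\mathcal G)$) be the collection of confidence intervals based on $Y$ that contain $Z(h)$ (resp. $M(h)$) with probability at least $1-\alpha$ under drift $h$, for every $h\in\mathcal G$. With $L(CI)$ the length of $CI$, $$L_{z,\alpha}(\varepsilon;f)=\sup_{g\in\mathcal F}\inf_{CI\in\mathcal I_{z,\alpha}(\{f,g\})}\mathbb E_fL(CI),\qquad L_{m,\alpha}(\varepsilon;f)=\sup_{g\in\mathcal F}\inf_{CI\in\mathcal I_{m,\alpha}(\{f,g\})}\mathbb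 E_fL(CI).$$ Local moduli of continuity: $$\omega_z(\varepsilon;f)=\sup\{|Z(f)-Z(g)|:\|f-g\|_2\le\varepsilon,\ g\in\mathcal F\},\qquad \omega_m(\varepsilon;f)=\sup\{|M(f)-M(g)|:\|f-g\|_2\le\varepsilon,\ g\in\mathcal F\}.$$ *)

theory Defs
  imports "HOL-Probability.Probability"
begin

definition std_normal_cdf :: "real \<Rightarrow> real" where
  "std_normal_cdf = cdf std_normal_distribution"

definition normal_quantile :: "real \<Rightarrow> real" where
  "normal_quantile \<alpha> = inv std_normal_cdf (1 - \<alpha>)"

text \<open>
  A function on $[0,1]$ is represented by a total function on the reals; everything below depends
  only on its values on $[0,1]$. No continuity is assumed at the endpoints.
\<close>

definition convex_class :: "(real \<Rightarrow> real) set" where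
  "convex_class =
     {f. convex_on {0..1} f \<and> (\<exists>!z. is_arg_min f (\<lambda>t. t \<in> {0..1}) z)}"

definition minimizer :: "(real \<Rightarrow> real) \<Rightarrow> real" where
  "minimizer f = arg_min_on f {0..1}"

definition min_value :: "(real \<Rightarrow> real) \<Rightarrow> real" where
  "min_value f = f (minimizer f)"

text \<open>
  The members of the convex class are bounded and measurable on $[0,1]$, so the Bochner integral
  is the genuine squared norm of their differences.
\<close>

definition L2_norm01 :: "(real \<Rightarrow> real) \<Rightarrow> real" where
  "L2_norm01 f = sqrt (LBINT t:{0..1}. (f t)\<^sup>2)"

locale brownian_motion01 = prob_space M
  for M :: "'a measure" and W :: "real \<Rightarrow> 'a \<Rightarrow> real" +
  assumes measurable_W: "t \<in> {0..1} \<Longrightarrow> W t \<in> borel_measurable M"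
    and start_zero: "AE \<omega> in M. W 0 \<omega> = 0"
    and normal_increments: "0 \<le> s \<Longrightarrow> s < t \<Longrightarrow> t \<le> 1 \<Longrightarrow>
      distributed M lborel (\<lambda>\<omega>. W t \<omega> - W s \<omega>) (normal_density 0 (sqrt (t - s)))"
    and indep_increments: "0 \<le> \<tau> 0 \<Longrightarrow> (\<And>i. i < n \<Longrightarrow> \<tau> i \<le> \<tau> (Suc i)) \<Longrightarrow> \<tau> n \<le> 1 \<Longrightarrow>
      indep_vars (\<lambda>_. borel) (\<lambda>(i::nat) \<omega>. W (\<tau> (Suc i)) \<omega> - W (\<tau> i) \<omega>) {..<n}"
    and continuous_paths: "AE \<omega> in M. continuous_on {0..1} (\<lambda>t. W t \<omega>)"

text \<open>
  The observation is the whole path $(Y(t))_{0 \le t \le 1}$ with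
  $Y(t) = \int_0^t f(s)\,ds + \varepsilon W(t)$, a random element of the product space below.
  The statistics based on $Y$, that is, the random variables measurable with respect to the
  sigma-algebra generated by all $Y(t)$, are the measurable functions on this space composed
  with the path.
\<close>

abbreviation path_space :: "(real \<Rightarrow> real) measure" where
  "path_space \<equiv> Pi\<^sub>M {0..1} (\<lambda>_. borel)"

definition observed_path ::
  "(real \<Rightarrow> 'a \<Rightarrow> real) \<Rightarrow> real \<Rightarrow> (real \<Rightarrow> real) \<Rightarrow> 'a \<Rightarrow> real \<Rightarrow> real" where
  "observed_path W \<epsilon> f \<omega> = (\<lambda>t\<in>{0..1}. (LBINT s:{0..t}. f s) + \<epsilon> * W t \<omega>)"

definition observation_law ::
  "'a measure \<Rightarrow> (real \<Rightarrow> 'a \<Rightarrow> real) \<Rightarrow> real \<Rightarrow> (real \<Rightarrow> real) \<Rightarrow> (real \<Rightarrow> real) measure" where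
  "observation_law M W \<epsilon> f = distr M path_space (observed_path W \<epsilon> f)"

text \<open>
  In what follows \<open>T\<close> is the functional to be estimated, either \<^const>\<open>minimizer\<close> or
  \<^const>\<open>min_value\<close>. Risks, expected lengths and moduli take values in $[0,\infty]$, so that
  no suprema, infima or expectations are assumed to be finite.
\<close>

definition estimation_risk ::
  "'a measure \<Rightarrow> (real \<Rightarrow> 'a \<Rightarrow> real) \<Rightarrow> ((real \<Rightarrow> real) \<Rightarrow> real) \<Rightarrow> real \<Rightarrow>
   ((real \<Rightarrow> real) \<Rightarrow> real) \<Rightarrow> (real \<Rightarrow> real) \<Rightarrow> ennreal" where
  "estimation_risk M W T \<epsilon> T_hat h =
     (\<integral>\<^sup>+ y. ennreal \<bar>T_hat y - T h\<bar> \<partial>observation_law M W \<epsilon> h)"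

definition estimation_benchmark ::
  "'a measure \<Rightarrow> (real \<Rightarrow> 'a \<Rightarrow> real) \<Rightarrow> ((real \<Rightarrow> real) \<Rightarrow> real) \<Rightarrow> real \<Rightarrow>
   (real \<Rightarrow> real) \<Rightarrow> ennreal" where
  "estimation_benchmark M W T \<epsilon> f =
     (SUP g\<in>convex_class. INF T_hat\<in>borel_measurable path_space.
        max (estimation_risk M W T \<epsilon> T_hat f) (estimation_risk M W T \<epsilon> T_hat g))"

text \<open>
  A confidence interval is the pair of its endpoints \<open>(l, u)\<close>, standing for
  the interval \<open>{l y..u y}\<close> when the path \<open>y\<close> is observed.
\<close>

definition confidence_intervals ::
  "'a measure \<Rightarrow> (real \<Rightarrow> 'a \<Rightarrow> real) \<Rightarrow> ((real \<Rightarrow> real) \<Rightarrow> real) \<Rightarrow> real \<Rightarrow> real \<Rightarrow>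
   (real \<Rightarrow> real) set \<Rightarrow> (((real \<Rightarrow> real) \<Rightarrow> real) \<times> ((real \<Rightarrow> real) \<Rightarrow> real)) set" where
  "confidence_intervals M W T \<alpha> \<epsilon> G =
     {(l, u). l \<in> borel_measurable path_space \<and> u \<in> borel_measurable path_space \<and>
        (\<forall>y\<in>space path_space. l y \<le> u y) \<and>
        (\<forall>h\<in>G. measure (observation_law M W \<epsilon> h)
                  {y \<in> space path_space. T h \<in> {l y..u y}} \<ge> 1 - \<alpha>)}"

definition inference_benchmark ::
  "'a measure \<Rightarrow> (real \<Rightarrow> 'a \<Rightarrow> real) \<Rightarrow> ((real \<Rightarrow> real) \<Rightarrow> real) \<Rightarrow> real \<Rightarrow> real \<Rightarrow>
   (real \<Rightarrow> real) \<Rightarrow> ennreal" where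
  "inference_benchmark M W T \<alpha> \<epsilon> f =
     (SUP g\<in>convex_class. INF (l, u)\<in>confidence_intervals M W T \<alpha> \<epsilon> {f, g}.
        \<integral>\<^sup>+ y. ennreal (u y - l y) \<partial>observation_law M W \<epsilon> f)"

definition local_modulus ::
  "((real \<Rightarrow> real) \<Rightarrow> real) \<Rightarrow> real \<Rightarrow> (real \<Rightarrow> real) \<Rightarrow> ennreal" where
  "local_modulus T \<epsilon> f =
     (SUP g\<in>{g \<in> convex_class. L2_norm01 (\<lambda>t. f t - g t) \<le> \<epsilon>}. ennreal \<bar>T f - T g\<bar>)"

end

theory Submission
  imports Defs
begin

text \<open>
  Fix $f$ and a competitor $g$, with $\Delta$ the $L_2$ distance between them, $d$ the distance
  between the two parameters and $\delta = \Delta/\varepsilon$. The two-point problem is a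
  normal shift experiment $N(0,1)$ versus $N(\delta,1)$.

  Lower bounds: every test has error sum at least $2\Phi(-\delta/2)$. This follows from the
  Neyman--Pearson lemma for finitely many increments of the path, since the Cauchy--Schwarz
  inequality bounds their separation by $\delta$, and passes to all events by approximation.

  Upper bounds: a weighted sum of increments with weights $(g-f)(i/n)$ is asymptotically an optimal
  test statistic; it yields an estimator of risk at most $d/(2\delta)$ and an interval of
  expected length at most $d z_\alpha (1-2\alpha)/\delta$. It remains to see that $d$ is at
  most $3\delta$ times the modulus at $\varepsilon$ when $\delta \ge 1$. Raising $f$ to a
  water level $\max(f,u)$ costs $\|(u-f)^+\|_2$, which grows at most linearly in the level, and
  the level that moves the parameter by $d/3$ costs at most $\Delta$.
\<close>

section \<open>Moduli of continuity\<close>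

text \<open>No stochastic integral and no Girsanov density is formed: likelihood ratios appear only
  for finitely many increments, where they are ratios of Gaussian densities. The upper constants are
  a two-point constant times the factor 3 of the modulus: 1.5 is 1/2 times 3, and B_\<alpha> is (1 -
  2 \<alpha>) z_\<alpha> times 3. For competitors within \<epsilon>, \<alpha> < 0.3 gives z_\<alpha>
  \<ge> 1/3, so that B_\<alpha> also covers the length (1 - 2 \<alpha>) d. In the lower bounds
  \<delta> is 1 for estimation, whence \<Phi>(-1/2), and 1/3 for inference, where 2 \<Phi>(-1/6)
  \<ge> 5/6 leaves slack over 0.6. The obstacle in the upper bounds is to trade a far competitor g
  for one within \<epsilon>. The segment from f to g does not do, since the minimizer may stay fixed
  along a long initial piece of it; the new competitors are therefore built from f alone. Flattening
  f destroys uniqueness of the minimizer; an arbitrarily small tilt restores it, so the factor 3 is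
  reached in a limit.\<close>

definition bounded_measurable01 :: "(real \<Rightarrow> real) \<Rightarrow> bool" where
  "bounded_measurable01 h \<longleftrightarrow>
     (\<exists>B. \<forall>x\<in>{0..1}. \<bar>h x\<bar> \<le> B) \<and> set_borel_measurable lborel {0..1} h"

lemma bounded_measurable01_const [simp]: "bounded_measurable01 (\<lambda>_. c)"
  by (auto simp: bounded_measurable01_def set_borel_measurable_def)

text \<open>A continuous function is bounded on the compact rectangle containing all values of the
  pair; sums, products and maxima are instances.\<close>

lemma bounded_measurable01_compose2:
  assumes h: "bounded_measurable01 h1" "bounded_measurable01 h2"
    and F: "continuous_on UNIV (\<lambda>p::real \<times> real. F (fst p) (snd p))"
  shows "bounded_measurable01 (\<lambda>x. F (h1 x) (h2 x))"
proof -
  obtain B1 B2 where B: "\<forall>x\<in>{0..1}. \<bar>h1 x\<bar> \<le> B1" "\<forall>x\<in>{0..1}. \<bar>h2 x\<bar> \<le> B2"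
    using h unfolding bounded_measurable01_def by auto
  have "compact ({-B1..B1} \<times> {-B2..B2})"
    by (intro compact_Times compact_Icc)
  then have "compact ((\<lambda>p. F (fst p) (snd p)) ` ({-B1..B1} \<times> {-B2..B2}))"
    by (rule compact_continuous_image[rotated]) (rule continuous_on_subset[OF F], simp)
  then have "bounded ((\<lambda>p. F (fst p) (snd p)) ` ({-B1..B1} \<times> {-B2..B2}))"
    by (rule compact_imp_bounded)
  then obtain C where C: "\<forall>y\<in>(\<lambda>p. F (fst p) (snd p)) ` ({-B1..B1} \<times> {-B2..B2}). \<bar>y\<bar> \<le> C"
    unfolding bounded_iff real_norm_def by blast
  have "\<bar>F (h1 x) (h2 x)\<bar> \<le> C" if "x \<in> {0..1}" for x
  proof -
    have "(h1 x, h2 x) \<in> {-B1..B1} \<times> {-B2..B2}"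
      using bspec[OF B(1) that] bspec[OF B(2) that] by (simp add: abs_le_iff)
    then show ?thesis using C by force
  qed
  moreover have "set_borel_measurable lborel {0..1} (\<lambda>x. F (h1 x) (h2 x))"
  proof -
    have m: "(\<lambda>p. F (fst p) (snd p)) \<in> borel_measurable borel"
      by (rule borel_measurable_continuous_onI[OF F])
    have i: "(\<lambda>x. indicat_real {0..1} x *\<^sub>R h1 x) \<in> borel_measurable lborel"
      "(\<lambda>x. indicat_real {0..1} x *\<^sub>R h2 x) \<in> borel_measurable lborel"
      using h unfolding bounded_measurable01_def set_borel_measurable_def by auto
    \<comment> \<open>\<open>F\<close> need not vanish at the origin, so the outer indicator is what
      makes both sides agree outside the interval.\<close>
    have "(\<lambda>x. indicat_real {0..1} x *\<^sub>R
        (\<lambda>p. F (fst p) (snd p)) (indicat_real {0..1} x *\<^sub>R h1 x, indicat_real {0..1} x *\<^sub>R h2 x))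
        \<in> borel_measurable lborel"
      by (intro borel_measurable_scaleR measurable_compose[OF _ m] borel_measurable_Pair i)
        measurable
    also have "?this \<longleftrightarrow> (\<lambda>x. indicat_real {0..1} x *\<^sub>R F (h1 x) (h2 x)) \<in> borel_measurable lborel"
      by (intro measurable_cong) (auto simp: indicator_def)
    finally show ?thesis unfolding set_borel_measurable_def .
  qed
  ultimately show ?thesis unfolding bounded_measurable01_def by blast
qed

lemma bounded_measurable01_intros:
  assumes "bounded_measurable01 h1" "bounded_measurable01 h2"
  shows "bounded_measurable01 (\<lambda>x. h1 x + h2 x)" "bounded_measurable01 (\<lambda>x. h1 x - h2 x)"
    "bounded_measurable01 (\<lambda>x. h1 x * h2 x)" "bounded_measurable01 (\<lambda>x. max (h1 x) (h2 x))"
  by (rule bounded_measurable01_compose2[OF assms]; intro continuous_intros)+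

lemma bounded_measurable01_power2:
  "bounded_measurable01 h \<Longrightarrow> bounded_measurable01 (\<lambda>x. (h x)\<^sup>2)"
  by (simp add: power2_eq_square bounded_measurable01_intros)

lemma bounded_measurable01_integrable:
  assumes "bounded_measurable01 h" "A \<in> sets borel" "A \<subseteq> {0..1}"
  shows "set_integrable lborel A h"
proof -
  obtain B where B: "\<forall>x\<in>{0..1}. \<bar>h x\<bar> \<le> B" "set_borel_measurable lborel {0..1} h"
    using assms unfolding bounded_measurable01_def by auto
  have "set_integrable lborel {0..1} h"
    unfolding set_integrable_def
  proof (rule Bochner_Integration.integrable_bound)
    show "integrable lborel (\<lambda>x. indicat_real {0..1::real} x *\<^sub>R B)"
      by simp
    show "(\<lambda>x. indicat_real {0..1} x *\<^sub>R h x) \<in> borel_measurable lborel"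
      using B(2) by (simp add: set_borel_measurable_def)
    show "AE x in lborel. norm (indicat_real {0..1} x *\<^sub>R h x) \<le> norm (indicat_real {0..1} x *\<^sub>R B)"
      by (intro AE_I2) (use B(1) in \<open>force simp: indicator_def\<close>)
  qed
  then show ?thesis
    using assms by (rule_tac set_integrable_subset) auto
qed

section \<open>Convex functions on the unit interval\<close>

lemma convex_segment:
  fixes f :: "real \<Rightarrow> real"
  assumes "convex_on {0..1} f" "x \<in> {0..1}" "y \<in> {0..1}" "0 \<le> t" "t \<le> 1"
  shows "f (x + t * (y - x)) \<le> f x + t * (f y - f x)"
  using convex_onD[OF assms(1) assms(4,5,2,3)] by (simp add: algebra_simps)

lemma convex_between:
  fixes f :: "real \<Rightarrow> real"
  assumes f: "convex_on {0..1} f" and xy: "x \<in> {0..1}" "y \<in> {0..1}"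
    and "x \<le> m \<and> m \<le> y \<or> y \<le> m \<and> m \<le> x"
  shows "f m \<le> max (f x) (f y)"
proof (cases "y = x")
  case True then show ?thesis using assms by auto
next
  case False
  define t where "t = (m - x) / (y - x)"
  have t: "0 \<le> t" "t \<le> 1"
    using assms False unfolding t_def by (auto simp: divide_simps)
  have m: "m = x + t * (y - x)" using False by (simp add: t_def)
  have "f m \<le> f x + t * (f y - f x)"
    unfolding m by (rule convex_segment) (use assms t in auto)
  also have "\<dots> \<le> max (f x) (f y)"
  proof (cases "f y \<ge> f x")
    case True then show ?thesis using mult_right_mono[of t 1 "f y - f x"] t by simp
  next
    case False then show ?thesis using mult_nonneg_nonpos[of t "f y - f x"] t by simp
  qed
  finally show ?thesis .
qed

lemma minimizer_is_arg_min:
  assumes "f \<in> convex_class"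
  shows "is_arg_min f (\<lambda>t. t \<in> {0..1}) (minimizer f)"
proof -
  obtain z where z: "is_arg_min f (\<lambda>t. t \<in> {0..1}) z"
    using assms unfolding convex_class_def by auto
  show ?thesis
    unfolding minimizer_def arg_min_on_def arg_min_def using z by (rule someI)
qed

lemma minimizer_eqI:
  assumes "f \<in> convex_class" "is_arg_min f (\<lambda>t. t \<in> {0..1}) z"
  shows "minimizer f = z"
  using assms minimizer_is_arg_min[OF assms(1)] unfolding convex_class_def by blast

lemma minimizer_in: "f \<in> convex_class \<Longrightarrow> minimizer f \<in> {0..1}"
  using minimizer_is_arg_min by (auto simp: is_arg_min_def)

lemma min_value_le: "f \<in> convex_class \<Longrightarrow> x \<in> {0..1} \<Longrightarrow> min_value f \<le> f x"
  using minimizer_is_arg_min by (force simp: is_arg_min_linorder min_value_def)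

lemma convex_class_convex: "f \<in> convex_class \<Longrightarrow> convex_on {0..1} f"
  by (simp add: convex_class_def)

text \<open>The endpoint values bound a convex function from above, the attained minimum from below.
  Convexity gives continuity only on the open interval, so the two endpoint values, where jumps are
  allowed, are added separately.\<close>

lemma convex_class_bounded_measurable:
  assumes f: "f \<in> convex_class"
  shows "bounded_measurable01 f"
  unfolding bounded_measurable01_def
proof (intro conjI exI ballI)
  fix x :: real assume x: "x \<in> {0..1}"
  have "f x \<le> max (f 0) (f 1)"
    by (rule convex_between[OF convex_class_convex[OF f]]) (use x in auto)
  moreover have "min_value f \<le> f x" by (rule min_value_le[OF f x])
  ultimately show "\<bar>f x\<bar> \<le> \<bar>max (f 0) (f 1)\<bar> + \<bar>min_value f\<bar>" by linarith
next
  have "convex_on {0<..<1} f"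
    using convex_class_convex[OF f] by (rule convex_on_subset) auto
  then have "continuous_on {0<..<1} f"
    by (intro convex_on_continuous) auto
  then have "set_borel_measurable borel {0<..<1} f"
    by (intro set_measurable_continuous_on) auto
  then have "(\<lambda>x. indicat_real {0<..<1} x *\<^sub>R f x + indicat_real {0} x *\<^sub>R f 0 + indicat_real {1} x *\<^sub>R f 1)
      \<in> borel_measurable lborel"
    unfolding set_borel_measurable_def by measurable
  also have "(\<lambda>x. indicat_real {0<..<1} x *\<^sub>R f x + indicat_real {0} x *\<^sub>R f 0 + indicat_real {1} x *\<^sub>R f 1)
      = (\<lambda>x. indicat_real {0..1} x *\<^sub>R f x)"
    by (auto simp: indicator_def fun_eq_iff)
  finally show "set_borel_measurable lborel {0..1} f"
    by (simp add: set_borel_measurable_def)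
qed

lemma L2_norm01_nonneg [simp]: "0 \<le> L2_norm01 h"
  by (simp add: L2_norm01_def set_lebesgue_integral_def)

lemma L2_norm01_power2: "(L2_norm01 h)\<^sup>2 = (LBINT t:{0..1}. (h t)\<^sup>2)"
  by (simp add: L2_norm01_def set_lebesgue_integral_def)

section \<open>Filling a convex function up to a level\<close>

text \<open>If g has the larger minimum, it stays above the level and the comparison is pointwise.
  Otherwise the gap is \<open>3 * e\<close> and the level is \<open>e\<close> above the minimum of
  f. Contracting the set where g is below the level by a factor t towards the minimizer of g gives f
  - g \<ge> (3 - 4 t) e on a set of t times the measure. This makes up for the loss once t (3 - 4
  t)^2 \<ge> 1; the left side is maximal at t = 1/4, with value exactly 1, which explains both the
  contraction and the fraction 1/3.\<close>

lemma water_level_min_value: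
  assumes f: "f \<in> convex_class" and g: "g \<in> convex_class"
  shows "(LBINT x:{0..1}. (max 0 (min_value f + \<bar>min_value f - min_value g\<bar> / 3 - f x))\<^sup>2)
      \<le> (L2_norm01 (\<lambda>x. f x - g x))\<^sup>2"
proof -
  define e where "e = \<bar>min_value f - min_value g\<bar> / 3"
  define m where "m = min_value f"
  define z where "z = minimizer g"
  let ?w = "\<lambda>x. (max 0 (m + e - f x))\<^sup>2"
  have e0: "e \<ge> 0" by (simp add: e_def)
  have fm: "m \<le> f x" if "x \<in> {0..1}" for x using min_value_le[OF f that] by (simp add: m_def)
  have bf: "bounded_measurable01 f" and bg: "bounded_measurable01 g"
    using f g by (simp_all add: convex_class_bounded_measurable)
  have bw: "bounded_measurable01 ?w"
    by (intro bounded_measurable01_power2 bounded_measurable01_intros bf) auto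
  have bd: "bounded_measurable01 (\<lambda>x. (f x - g x)\<^sup>2)"
    by (intro bounded_measurable01_power2 bounded_measurable01_intros bf bg)
  have above: "?w x \<le> (f x - g x)\<^sup>2" if "m + e \<le> g x" for x
  proof (cases "f x \<le> m + e")
    case True
    then have "max 0 (m + e - f x) \<le> \<bar>f x - g x\<bar>" using that by auto
    then have "(max 0 (m + e - f x))\<^sup>2 \<le> \<bar>f x - g x\<bar>\<^sup>2" by (intro power_mono) auto
    then show ?thesis by simp
  qed simp
  have "(LBINT x:{0..1}. ?w x) \<le> (LBINT x:{0..1}. (f x - g x)\<^sup>2)"
  proof (cases "min_value g \<ge> min_value f")
    case True
    have "?w x \<le> (f x - g x)\<^sup>2" if "x \<in> {0..1}" for x
    proof (rule above)
      have "min_value g \<le> g x" by (rule min_value_le[OF g that])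
      then show "m + e \<le> g x" using True unfolding m_def e_def by (auto simp: abs_if field_simps)
    qed
    then show ?thesis
      by (intro set_integral_mono bounded_measurable01_integrable bw bd) auto
  next
    case False
    then have mg: "min_value g = m - 3 * e" by (simp add: m_def e_def abs_if field_simps)
    have z: "z \<in> {0..1}" "g z = m - 3 * e"
      using minimizer_in[OF g] mg by (auto simp: z_def min_value_def)
    define A where "A = {x \<in> {0..1}. g x \<le> m + e}"
    have A01: "A \<subseteq> {0..1}" by (auto simp: A_def)
    have gm: "(\<lambda>x. indicat_real {0..1} x *\<^sub>R g x) \<in> borel_measurable borel"
      using bg by (simp add: bounded_measurable01_def set_borel_measurable_def)
    have "A = {0..1} \<inter> {x \<in> space borel. indicat_real {0..1} x *\<^sub>R g x \<le> m + e}"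
      by (auto simp: A_def indicator_def)
    also have "\<dots> \<in> sets borel"
      by (intro sets.Int borel_measurable_le gm) auto
    finally have A: "A \<in> sets borel" .
    \<comment> \<open>Contract \<open>A\<close> by the factor 1/4 towards the minimizer of \<open>g\<close>: by convexity \<open>g \<le> m - 2 e\<close> on
      the image, so there \<open>(f - g)\<^sup>2 \<ge> 4 e\<^sup>2\<close>, which makes up for the loss of at most \<open>e\<^sup>2\<close> on \<open>A\<close>.\<close>
    define \<phi> where "\<phi> = (\<lambda>x::real. -3 * z + 4 * x)"
    have key: "x \<in> A \<and> 2 * e \<le> f x - g x" if "\<phi> x \<in> A" for x
    proof -
      have x: "x = z + (1/4) * (\<phi> x - z)" by (simp add: \<phi>_def algebra_simps)
      have p: "\<phi> x \<in> {0..1}" "g (\<phi> x) \<le> m + e" using that by (auto simp: A_def)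
      have "g (z + (1/4) * (\<phi> x - z)) \<le> g z + (1/4) * (g (\<phi> x) - g z)"
        by (rule convex_segment[OF convex_class_convex[OF g]]) (use p z in auto)
      then have gx: "g x \<le> m - 2 * e" unfolding x[symmetric] using p z by (simp add: field_simps)
      have "x \<in> {0..1}" using p(1) z(1) by (auto simp: \<phi>_def)
      then show ?thesis using gx fm[of x] e0 by (auto simp: A_def)
    qed
    have iA: "integrable lborel (indicat_real A)"
    proof -
      have "emeasure lborel A \<le> emeasure lborel {0..1::real}" using A01 by (intro emeasure_mono) auto
      then show ?thesis using A by (simp add: integrable_indicator_iff le_less_trans)
    qed
    have iA4: "integrable lborel (\<lambda>x. indicat_real A (\<phi> x))"
      unfolding \<phi>_def using lborel_integrable_real_affine[OF iA, of 4 "-3 * z"] by simp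
    have i4: "(LBINT x. indicat_real A x) = 4 * (LBINT x. indicat_real A (\<phi> x))"
      unfolding \<phi>_def using lborel_integral_real_affine[of 4 "indicat_real A" "-3 * z"] by simp
    have ib: "set_integrable lborel ({0..1} - A) ?w" "set_integrable lborel A ?w"
      "set_integrable lborel {0..1} (\<lambda>x. (f x - g x)\<^sup>2)"
      by (intro bounded_measurable01_integrable bw bd; use A A01 in auto)+
    have "(LBINT x:{0..1}. ?w x) = (LBINT x:({0..1} - A) \<union> A. ?w x)"
      using A01 by (intro arg_cong[where f="\<lambda>S. LBINT x:S. ?w x"]) auto
    also have "\<dots> = (LBINT x:{0..1} - A. ?w x) + (LBINT x:A. ?w x)"
      by (intro set_integral_Un ib) auto
    also have "(LBINT x:A. ?w x) \<le> (LBINT x. e\<^sup>2 * indicat_real A x)"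
      unfolding set_lebesgue_integral_def
    proof (intro integral_mono)
      show "integrable lborel (\<lambda>x. indicat_real A x *\<^sub>R ?w x)"
        using ib(2) by (simp add: set_integrable_def)
      show "integrable lborel (\<lambda>x. e\<^sup>2 * indicat_real A x)" using iA by simp
      fix x
      show "indicat_real A x *\<^sub>R ?w x \<le> e\<^sup>2 * indicat_real A x"
      proof (cases "x \<in> A")
        case True
        then have "max 0 (m + e - f x) \<le> e" using fm[of x] A01 e0 by auto
        then have "?w x \<le> e\<^sup>2" by (intro power_mono) auto
        then show ?thesis using True by simp
      qed simp
    qed
    also have "(LBINT x. e\<^sup>2 * indicat_real A x) = (LBINT x. 4 * e\<^sup>2 * indicat_real A (\<phi> x))"
      using i4 by simp
    also have "(LBINT x:{0..1} - A. ?w x) + (LBINT x. 4 * e\<^sup>2 * indicat_real A (\<phi> x)) =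
        (LBINT x. indicat_real ({0..1} - A) x *\<^sub>R ?w x + 4 * e\<^sup>2 * indicat_real A (\<phi> x))"
      unfolding set_lebesgue_integral_def
      by (intro Bochner_Integration.integral_add[symmetric])
        (use ib(1) iA4 in \<open>auto simp: set_integrable_def\<close>)
    also have "\<dots> \<le> (LBINT x:{0..1}. (f x - g x)\<^sup>2)"
      unfolding set_lebesgue_integral_def
    proof (intro integral_mono)
      show "integrable lborel (\<lambda>x. indicat_real ({0..1} - A) x *\<^sub>R ?w x + 4 * e\<^sup>2 * indicat_real A (\<phi> x))"
        using ib(1) iA4 by (auto simp: set_integrable_def)
      show "integrable lborel (\<lambda>x. indicat_real {0..1} x *\<^sub>R (f x - g x)\<^sup>2)"
        using ib(3) by (simp add: set_integrable_def)
      fix x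
      \<comment> \<open>The two summands never act together: \<open>\<phi> x \<in> A\<close> puts x
        itself into \<open>A\<close>.\<close>
      show "indicat_real ({0..1} - A) x *\<^sub>R ?w x + 4 * e\<^sup>2 * indicat_real A (\<phi> x)
         \<le> indicat_real {0..1} x *\<^sub>R (f x - g x)\<^sup>2"
      proof (cases "\<phi> x \<in> A")
        case True
        then have x: "x \<in> A" "2 * e \<le> f x - g x" using key by auto
        then have "(2 * e)\<^sup>2 \<le> (f x - g x)\<^sup>2" using e0 by (intro power_mono) auto
        then show ?thesis using x True A01 by auto
      next
        case False
        then show ?thesis using above[of x] by (auto simp: indicator_def A_def)
      qed
    qed
    finally show ?thesis by simp
  qed
  then show ?thesis unfolding L2_norm01_power2 by (simp add: m_def e_def)
qed

text \<open>The level is the height of f at distance D/3 from its minimizer, on the lower of the two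
  sides, so the part of f below it lies within D/3. If g at \<open>x1\<close> is not below this
  level, then \<open>x1\<close> separates that part from the minimizer of g, hence g is above the
  level there and the comparison is pointwise. Otherwise g is below the level all the way from
  \<open>x1\<close> to its minimizer, a stretch of length 2D/3, while f keeps rising.\<close>

lemma water_level_minimizer:
  assumes f: "f \<in> convex_class" and g: "g \<in> convex_class"
    and ne: "minimizer f \<noteq> minimizer g"
  obtains p where "p \<in> {0..1}" "\<bar>p - minimizer f\<bar> = \<bar>minimizer f - minimizer g\<bar> / 3"
    "(LBINT x:{0..1}. (max 0 (f p - f x))\<^sup>2) \<le> (L2_norm01 (\<lambda>x. f x - g x))\<^sup>2"
proof -
  define z where "z = minimizer f"
  define z' where "z' = minimizer g"
  define D where "D = \<bar>z' - z\<bar>"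
  define x1 where "x1 = z + (z' - z) / 3"
  define x2 where "x2 = z - (z' - z) / 3"
  \<comment> \<open>\<open>x1\<close> lies between the two minimizers, but its mirror image
    \<open>x2\<close> may leave the interval. Taking the lower value keeps f at or above the level
    beyond D/3 on both sides of z, as \<open>outside\<close> records.\<close>
  define p where "p = (if x2 \<in> {0..1} \<and> f x2 < f x1 then x2 else x1)"
  note fc = convex_class_convex[OF f] and gc = convex_class_convex[OF g]
  have D: "D > 0" using ne by (simp add: D_def z_def z'_def)
  have z: "z \<in> {0..1}" "z' \<in> {0..1}" using minimizer_in f g by (auto simp: z_def z'_def)
  have x1: "x1 \<in> {0..1}" using z by (auto simp: x1_def field_simps)
  have p01: "p \<in> {0..1}" using x1 by (simp add: p_def)
  have pD: "\<bar>p - z\<bar> = D / 3" by (auto simp: p_def x1_def x2_def D_def)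
  have fz: "f z \<le> f x" if "x \<in> {0..1}" for x
    using min_value_le[OF f that] by (simp add: z_def min_value_def)
  have gz: "g z' \<le> g x" if "x \<in> {0..1}" for x
    using min_value_le[OF g that] by (simp add: z'_def min_value_def)
  define u where "u = f p - f z"
  have u0: "u \<ge> 0" using fz[OF p01] by (simp add: u_def)
  have px1: "f p \<le> f x1" by (simp add: p_def)
  have px2: "f p \<le> f x2" if "x2 \<in> {0..1}" using that by (simp add: p_def)
  have outside: "f p \<le> f y" if y: "y \<in> {0..1}" "D / 3 \<le> \<bar>y - z\<bar>" for y
  proof (cases "z \<le> x1 \<and> x1 \<le> y \<or> y \<le> x1 \<and> x1 \<le> z")
    case True
    then have "f x1 \<le> max (f z) (f y)"
      by (rule convex_between[OF fc z(1) y(1)])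
    then show ?thesis using px1 fz[OF y(1)] by simp
  next
    case False
    then have x2: "z \<le> x2 \<and> x2 \<le> y \<or> y \<le> x2 \<and> x2 \<le> z"
      using y by (auto simp: x1_def x2_def D_def abs_if field_simps split: if_splits)
    then have "x2 \<in> {0..1}" using z y by auto
    moreover have "f x2 \<le> max (f z) (f y)"
      using x2 by (rule convex_between[OF fc z(1) y(1)])
    ultimately show ?thesis using px2 fz[OF y(1)] by simp
  qed
  let ?w = "\<lambda>x. (max 0 (f p - f x))\<^sup>2"
  have bf: "bounded_measurable01 f" and bg: "bounded_measurable01 g"
    using f g by (simp_all add: convex_class_bounded_measurable)
  have bw: "bounded_measurable01 ?w"
    by (intro bounded_measurable01_power2 bounded_measurable01_intros bf) auto
  have bd: "bounded_measurable01 (\<lambda>x. (f x - g x)\<^sup>2)"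
    by (intro bounded_measurable01_power2 bounded_measurable01_intros bf bg)
  have "(LBINT x:{0..1}. ?w x) \<le> (LBINT x:{0..1}. (f x - g x)\<^sup>2)"
  proof (cases "f p \<le> g x1")
    case True
    have "?w x \<le> (f x - g x)\<^sup>2" if x: "x \<in> {0..1}" for x
    proof (cases "f p \<le> f x")
      case False
      then have "\<bar>x - z\<bar> < D / 3" using outside[OF x] by force
      then have "g x1 \<le> max (g z') (g x)"
        by (intro convex_between[OF gc z(2) x])
          (auto simp: x1_def D_def abs_if field_simps split: if_splits)
      then have "g x1 \<le> g x" using gz[OF x] by simp
      then have "max 0 (f p - f x) \<le> \<bar>f x - g x\<bar>" using True by simp
      then have "?w x \<le> \<bar>f x - g x\<bar>\<^sup>2" by (intro power_mono) auto
      then show ?thesis by simp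
    qed simp
    then show ?thesis
      by (intro set_integral_mono bounded_measurable01_integrable bw bd) auto
  next
    case False
    \<comment> \<open>From \<open>x1\<close> to \<open>z'\<close> the difference \<open>f - g\<close> grows at least linearly from 0 to \<open>2 u\<close>; its square has
      integral at least \<open>8/9 u\<^sup>2 D\<close>, and filling up to level \<open>f p\<close> costs at most \<open>2/3 u\<^sup>2 D\<close>.\<close>
    define I where "I = {min x1 z'..max x1 z'}"
    have I01: "I \<subseteq> {0..1}" using z x1 by (auto simp: I_def)
    have len: "\<bar>z' - x1\<bar> = 2 * D / 3" by (simp add: x1_def D_def abs_if field_simps)
    have low: "u * (3 / D) * \<bar>y - x1\<bar> \<le> f y - g y" if "y \<in> I" for y
    proof -
      have y: "y \<in> {0..1}" using that I01 by auto
      \<comment> \<open>The distance of y from z in units of D/3: \<open>x1\<close> sits at the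
        fraction 1 / r of the way from z to y, so convexity makes f rise by at least
        \<open>r * u\<close> up to y.\<close>
      define r where "r = 3 * \<bar>y - z\<bar> / D"
      have order: "z < x1 \<and> x1 \<le> y \<and> y \<le> z' \<and> D = 3 * (x1 - z)
          \<or> x1 < z \<and> y \<le> x1 \<and> z' \<le> y \<and> D = 3 * (z - x1)"
        using that D by (auto simp: I_def x1_def D_def abs_if min_def max_def field_simps split: if_splits)
      then have "\<bar>y - z\<bar> = D / 3 + \<bar>y - x1\<bar>" by (auto simp: field_simps)
      then have r': "r - 1 = 3 / D * \<bar>y - x1\<bar>"
        using D by (simp add: r_def field_simps)
      have "3 / D * \<bar>y - x1\<bar> \<ge> 0" using D by simp
      then have r: "r \<ge> 1" using r' by linarith
      have "D * (y - z) = 3 * \<bar>y - z\<bar> * (x1 - z)"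
        using order
      proof
        assume "z < x1 \<and> x1 \<le> y \<and> y \<le> z' \<and> D = 3 * (x1 - z)"
        then have "\<bar>y - z\<bar> = y - z" "D = 3 * (x1 - z)" by auto
        then show ?thesis by algebra
      next
        assume "x1 < z \<and> y \<le> x1 \<and> z' \<le> y \<and> D = 3 * (z - x1)"
        then have "\<bar>y - z\<bar> = z - y" "D = 3 * (z - x1)" by auto
        then show ?thesis by algebra
      qed
      then have "y - z = r * (x1 - z)" using D by (simp add: r_def field_simps)
      then have x1y: "x1 = z + (1 / r) * (y - z)" using r by (simp add: field_simps)
      have "f x1 \<le> f z + (1 / r) * (f y - f z)"
        unfolding x1y by (rule convex_segment[OF fc z(1) y]) (use r in auto)
      then have "u \<le> (1 / r) * (f y - f z)" using px1 by (simp add: u_def)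
      then have "r * u \<le> f y - f z" using r by (simp add: field_simps)
      moreover have "g y \<le> max (g z') (g x1)"
        by (rule convex_between[OF gc z(2) x1])
          (use order in auto)
      then have "g y \<le> f p" using False gz[OF x1] by simp
      ultimately have "(r - 1) * u \<le> f y - g y" by (simp add: u_def algebra_simps)
      then show ?thesis unfolding r' by (simp add: mult_ac)
    qed
    have "(LBINT x:{0..1}. ?w x) \<le> (LBINT x. indicat_real {z - D/3..z + D/3} x *\<^sub>R u\<^sup>2)"
      unfolding set_lebesgue_integral_def
    proof (rule integral_mono)
      show "integrable lborel (\<lambda>x. indicat_real {0..1} x *\<^sub>R ?w x)"
        using bounded_measurable01_integrable[OF bw, of "{0..1}"] by (simp add: set_integrable_def)
      show "integrable lborel (\<lambda>x. indicat_real {z - D/3..z + D/3} x *\<^sub>R u\<^sup>2)"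
        by (simp add: integrable_indicator_iff emeasure_lborel_Icc_eq)
      fix x
      show "indicat_real {0..1} x *\<^sub>R ?w x \<le> indicat_real {z - D/3..z + D/3} x *\<^sub>R u\<^sup>2"
      proof (cases "x \<in> {0..1} \<and> f x < f p")
        case True
        then have "\<bar>x - z\<bar> < D / 3" using outside[of x] by force
        moreover have "max 0 (f p - f x) \<le> u" using True fz[of x] by (auto simp: u_def)
        then have "?w x \<le> u\<^sup>2" by (intro power_mono) auto
        ultimately show ?thesis using True by (auto simp: indicator_def abs_if split: if_splits)
      qed (auto simp: indicator_def)
    qed
    also have "\<dots> = 2 / 3 * D * u\<^sup>2" using D by simp
    also have "\<dots> \<le> 8 / 9 * D * u\<^sup>2" using D by (intro mult_right_mono) auto
    also have "\<dots> = (u * (3 / D))\<^sup>2 * (\<bar>z' - x1\<bar> ^ 3 / 3)"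
      unfolding len using D by (simp add: power2_eq_square power3_eq_cube field_simps)
    also have "\<bar>z' - x1\<bar> ^ 3 / 3 = (LBINT x. (x - x1)\<^sup>2 * indicat_real I x)"
    proof -
      have "(LBINT x. (x - x1)\<^sup>2 * indicat_real {min x1 z'..max x1 z'} x)
          = (max x1 z' - x1) ^ 3 / 3 - (min x1 z' - x1) ^ 3 / 3"
        by (rule integral_FTC_Icc_real)
          (auto intro!: derivative_eq_intros simp: power2_eq_square)
      also have "\<dots> = \<bar>z' - x1\<bar> ^ 3 / 3"
        by (cases "x1 \<le> z'") (simp_all add: abs_if min_def max_def power3_eq_cube field_simps)
      finally show ?thesis by (simp add: I_def)
    qed
    also have "(u * (3 / D))\<^sup>2 * (LBINT x. (x - x1)\<^sup>2 * indicat_real I x)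
        = (LBINT x:I. (u * (3 / D) * \<bar>x - x1\<bar>)\<^sup>2)"
      unfolding set_lebesgue_integral_def integral_mult_right_zero[symmetric]
      by (intro Bochner_Integration.integral_cong)
        (simp_all only: power_mult_distrib power2_abs real_scaleR_def mult_ac)
    also have "\<dots> \<le> (LBINT x:I. (f x - g x)\<^sup>2)"
    proof (rule set_integral_mono)
      show "set_integrable lborel I (\<lambda>x. (u * (3 / D) * \<bar>x - x1\<bar>)\<^sup>2)"
        unfolding I_def by (intro borel_integrable_atLeastAtMost' continuous_intros)
      show "set_integrable lborel I (\<lambda>x. (f x - g x)\<^sup>2)"
        by (rule bounded_measurable01_integrable[OF bd _ I01]) (simp add: I_def)
      show "(u * (3 / D) * \<bar>x - x1\<bar>)\<^sup>2 \<le> (f x - g x)\<^sup>2" if "x \<in> I" for x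
        by (rule power_mono[OF low[OF that]]) (use u0 D in simp)
    qed
    also have "\<dots> \<le> (LBINT x:{0..1}. (f x - g x)\<^sup>2)"
    proof -
      have "set_integrable lborel I (\<lambda>x. (f x - g x)\<^sup>2)" "set_integrable lborel {0..1} (\<lambda>x. (f x - g x)\<^sup>2)"
        by (rule bounded_measurable01_integrable[OF bd]; use I01 in \<open>simp add: I_def\<close>)+
      then show ?thesis
        unfolding set_lebesgue_integral_def set_integrable_def
        by (intro integral_mono) (use I01 in \<open>auto simp: indicator_def\<close>)
    qed
    finally show ?thesis .
  qed
  then show thesis
    by (intro that[OF p01]) (use pD in \<open>simp_all add: L2_norm01_power2 D_def z_def z'_def abs_minus_commute\<close>)
qed

text \<open>u is a level whose cost is known, and \<kappa> the fraction of it to be spent. As f is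
  at least its minimum, v - f \<le> \<kappa> (min f + u - f), so the fill up to v has norm at most
  \<kappa> \<Delta>; the strict gap to \<epsilon> pays for a tilt around p. Leaving p free serves
  both functionals: p stays at the minimizer of f when the minimum is to move, and leaves it when
  the minimizer is to move.\<close>

lemma convex_class_water_filling:
  assumes f: "f \<in> convex_class" and p: "p \<in> {0..1}" and v: "f p \<le> v" "v \<le> min_value f + \<kappa> * u"
    and \<kappa>: "0 \<le> \<kappa>" "\<kappa> \<le> 1" and u: "0 \<le> u"
    and W: "(LBINT x:{0..1}. (max 0 (min_value f + u - f x))\<^sup>2) \<le> \<Delta>\<^sup>2"
    and \<Delta>: "0 \<le> \<Delta>" "\<kappa> * \<Delta> < \<epsilon>"
  obtains h where "h \<in> convex_class" "minimizer h = p" "min_value h = v"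
    "L2_norm01 (\<lambda>x. f x - h x) \<le> \<epsilon>"
proof -
  \<comment> \<open>For a fill a \<le> \<kappa> u and a tilt b \<le> \<eta> \<le> 1, (a + b)^2 \<le>
    a^2 + 2 \<kappa> u \<eta> + \<eta>^2 \<le> a^2 + \<eta> c; the choice of \<eta> fits the last
    term into the spare part of \<epsilon>^2.\<close>
  define c where "c = 2 * \<kappa> * u + 1"
  define \<eta> where "\<eta> = min 1 ((\<epsilon>\<^sup>2 - (\<kappa> * \<Delta>)\<^sup>2) / c)"
  have c: "c > 0" using \<kappa> u by (simp add: c_def add_nonneg_pos)
  have "0 \<le> \<kappa> * \<Delta>" using \<kappa> \<Delta> by simp
  then have "(\<kappa> * \<Delta>)\<^sup>2 < \<epsilon>\<^sup>2" using \<Delta>(2) by (intro power_strict_mono) auto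
  then have \<eta>: "0 < \<eta>" "\<eta> \<le> 1" "\<eta> * c \<le> \<epsilon>\<^sup>2 - (\<kappa> * \<Delta>)\<^sup>2"
    using c by (auto simp: \<eta>_def min_def field_simps)
  \<comment> \<open>The tilt makes the minimizer of the flattened function unique.\<close>
  define h where "h x = max (f x) v + \<eta> * \<bar>x - p\<bar>" for x
  have hp: "h p = v" using v by (simp add: h_def)
  have hv: "v < h x" if "x \<noteq> p" for x
  proof -
    have "\<eta> * \<bar>x - p\<bar> > 0" using that \<eta> by simp
    then show ?thesis by (simp add: h_def)
  qed
  have am: "is_arg_min h (\<lambda>t. t \<in> {0..1}) p"
    using hp hv p by (auto simp: is_arg_min_linorder) (metis less_eq_real_def)
  have "convex_on {0..1} h"
  proof (rule convex_onI)
    fix t x y :: real assume t: "0 < t" "t < 1" and xy: "x \<in> {0..1}" "y \<in> {0..1}"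
    have "f ((1 - t) *\<^sub>R x + t *\<^sub>R y) \<le> (1 - t) * f x + t * f y"
      by (rule convex_onD[OF convex_class_convex[OF f]]) (use t xy in auto)
    also have "\<dots> \<le> (1 - t) * max (f x) v + t * max (f y) v"
      using t by (intro add_mono mult_left_mono) auto
    finally have 1: "f ((1 - t) *\<^sub>R x + t *\<^sub>R y) \<le> (1 - t) * max (f x) v + t * max (f y) v" .
    have "v = (1 - t) * v + t * v" by (simp add: algebra_simps)
    also have "\<dots> \<le> (1 - t) * max (f x) v + t * max (f y) v"
      using t by (intro add_mono mult_left_mono) auto
    finally have 2: "v \<le> (1 - t) * max (f x) v + t * max (f y) v" .
    have "\<bar>(1 - t) *\<^sub>R x + t *\<^sub>R y - p\<bar> = \<bar>(1 - t) * (x - p) + t * (y - p)\<bar>"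
      by (simp add: algebra_simps)
    also have "\<dots> \<le> \<bar>(1 - t) * (x - p)\<bar> + \<bar>t * (y - p)\<bar>" by (rule abs_triangle_ineq)
    also have "\<dots> = (1 - t) * \<bar>x - p\<bar> + t * \<bar>y - p\<bar>" using t by (simp add: abs_mult)
    finally have "\<eta> * \<bar>(1 - t) *\<^sub>R x + t *\<^sub>R y - p\<bar> \<le> \<eta> * ((1 - t) * \<bar>x - p\<bar> + t * \<bar>y - p\<bar>)"
      using \<eta> by (intro mult_left_mono) auto
    then have "h ((1 - t) *\<^sub>R x + t *\<^sub>R y) \<le>
        ((1 - t) * max (f x) v + t * max (f y) v) + \<eta> * ((1 - t) * \<bar>x - p\<bar> + t * \<bar>y - p\<bar>)"
      unfolding h_def by (intro add_mono max.boundedI 1 2)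
    also have "\<dots> = (1 - t) * h x + t * h y" by (simp add: h_def algebra_simps)
    finally show "h ((1 - t) *\<^sub>R x + t *\<^sub>R y) \<le> (1 - t) * h x + t * h y" .
  qed simp
  moreover have "z = p" if "is_arg_min h (\<lambda>t. t \<in> {0..1}) z" for z
    using that hp hv[of z] p by (force simp: is_arg_min_linorder)
  ultimately have h: "h \<in> convex_class" using am by (auto simp: convex_class_def)
  have Zh: "minimizer h = p" by (rule minimizer_eqI[OF h am])
  have Mh: "min_value h = v" by (simp add: min_value_def Zh hp)
  have bf: "bounded_measurable01 f" and bh: "bounded_measurable01 h"
    using f h by (simp_all add: convex_class_bounded_measurable)
  let ?w = "\<lambda>x. (max 0 (min_value f + u - f x))\<^sup>2"
  have bw: "bounded_measurable01 ?w"
    by (intro bounded_measurable01_power2 bounded_measurable01_intros bf) auto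
  have bd: "bounded_measurable01 (\<lambda>x. (f x - h x)\<^sup>2)"
    by (intro bounded_measurable01_power2 bounded_measurable01_intros bf bh)
  have pt: "(f x - h x)\<^sup>2 \<le> \<kappa>\<^sup>2 * ?w x + \<eta> * c" if x: "x \<in> {0..1}" for x
  proof -
    define a where "a = max 0 (v - f x)"
    define b where "b = \<eta> * \<bar>x - p\<bar>"
    have fx: "min_value f \<le> f x" by (rule min_value_le[OF f x])
    have "\<bar>x - p\<bar> \<le> 1" using x p by auto
    then have b: "0 \<le> b" "b \<le> \<eta>" using \<eta> mult_left_mono[of "\<bar>x - p\<bar>" 1 \<eta>] by (auto simp: b_def)
    have "(1 - \<kappa>) * min_value f \<le> (1 - \<kappa>) * f x" using fx \<kappa> by (intro mult_left_mono) auto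
    then have "v - f x \<le> \<kappa> * (min_value f + u - f x)" using v by (simp add: algebra_simps)
    also have "\<dots> \<le> \<kappa> * max 0 (min_value f + u - f x)" using \<kappa> by (intro mult_left_mono) auto
    finally have a1: "a \<le> \<kappa> * max 0 (min_value f + u - f x)" using \<kappa> by (simp add: a_def)
    have a2: "a \<le> \<kappa> * u" using v fx \<kappa> u by (auto simp: a_def)
    have a0: "a \<ge> 0" by (simp add: a_def)
    have "a\<^sup>2 \<le> (\<kappa> * max 0 (min_value f + u - f x))\<^sup>2" by (rule power_mono[OF a1 a0])
    then have A: "a\<^sup>2 \<le> \<kappa>\<^sup>2 * ?w x" by (simp add: power_mult_distrib)
    have "a * b \<le> (\<kappa> * u) * \<eta>" using a2 a0 b \<kappa> u by (intro mult_mono) auto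
    moreover have "b * b \<le> \<eta> * 1" using b \<eta> by (intro mult_mono) auto
    moreover have "(f x - h x)\<^sup>2 = (a + b)\<^sup>2"
    proof -
      have "h x - f x = a + b" by (simp add: h_def a_def b_def max_def)
      then show ?thesis by (metis power2_commute)
    qed
    ultimately show ?thesis using A by (simp add: c_def power2_eq_square algebra_simps)
  qed
  have "(L2_norm01 (\<lambda>x. f x - h x))\<^sup>2 \<le> (LBINT x:{0..1}. \<kappa>\<^sup>2 * ?w x + \<eta> * c)"
    unfolding L2_norm01_power2
    by (intro set_integral_mono pt bounded_measurable01_integrable bd bounded_measurable01_intros
        bounded_measurable01_const bw) auto
  also have "\<dots> = \<kappa>\<^sup>2 * (LBINT x:{0..1}. ?w x) + (LBINT x:{0..1::real}. \<eta> * c)"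
    by (subst set_integral_add)
      (auto intro!: bounded_measurable01_integrable bounded_measurable01_intros bw)
  also have "(LBINT x:{0..1::real}. \<eta> * c) = \<eta> * c"
    by (simp add: set_lebesgue_integral_def)
  also have "\<kappa>\<^sup>2 * (LBINT x:{0..1}. ?w x) + \<eta> * c \<le> \<kappa>\<^sup>2 * \<Delta>\<^sup>2 + (\<epsilon>\<^sup>2 - (\<kappa> * \<Delta>)\<^sup>2)"
    using W \<eta> by (intro add_mono mult_left_mono) auto
  also have "\<dots> = \<epsilon>\<^sup>2" by (simp add: power_mult_distrib)
  finally have "L2_norm01 (\<lambda>x. f x - h x) \<le> \<epsilon>"
    by (rule power2_le_imp_le) (use \<Delta> \<open>0 \<le> \<kappa> * \<Delta>\<close> in linarith)
  then show thesis using that h Zh Mh by blast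
qed

section \<open>Growth of the local modulus\<close>

lemma local_modulus_ge:
  assumes "g \<in> convex_class" "L2_norm01 (\<lambda>x. f x - g x) \<le> \<epsilon>"
  shows "ennreal \<bar>T f - T g\<bar> \<le> local_modulus T \<epsilon> f"
  unfolding local_modulus_def using assms by (intro SUP_upper) auto

text \<open>A competitor at distance \<Delta> \<ge> \<epsilon> is replaced by a water-filled f
  within \<epsilon> that keeps nearly the fraction \<epsilon> / (3 \<Delta>) of the displacement.
  The fill needs \<kappa> \<Delta> strictly below \<epsilon>, so the exact fraction comes only as
  \<kappa> tends to \<epsilon> / \<Delta> from the left.\<close>

lemma local_modulus_scaling:
  assumes f: "f \<in> convex_class" and g: "g \<in> convex_class" and T: "T = minimizer \<or> T = min_value"
    and \<epsilon>: "0 < \<epsilon>" "\<epsilon> \<le> L2_norm01 (\<lambda>x. f x - g x)"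
  shows "ennreal (\<bar>T f - T g\<bar> * \<epsilon> / (3 * L2_norm01 (\<lambda>x. f x - g x))) \<le> local_modulus T \<epsilon> f"
proof -
  define \<Delta> where "\<Delta> = L2_norm01 (\<lambda>x. f x - g x)"
  define d where "d = \<bar>T f - T g\<bar>"
  have \<Delta>: "\<Delta> > 0" "\<epsilon> \<le> \<Delta>" using \<epsilon> by (simp_all add: \<Delta>_def)
  have main: "ennreal (\<kappa> * d / 3) \<le> local_modulus T \<epsilon> f" if \<kappa>: "0 \<le> \<kappa>" "\<kappa> < \<epsilon> / \<Delta>" for \<kappa>
  proof -
    have "\<epsilon> / \<Delta> \<le> 1" using \<Delta> by simp
    then have \<kappa>': "\<kappa> \<le> 1" "\<kappa> * \<Delta> < \<epsilon>" using \<kappa> \<Delta> by (linarith, simp add: pos_less_divide_eq)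
    obtain h where h: "h \<in> convex_class" "L2_norm01 (\<lambda>x. f x - h x) \<le> \<epsilon>" "\<bar>T f - T h\<bar> = \<kappa> * d / 3"
    proof (cases "T = min_value")
      case True
      let ?v = "min_value f + \<kappa> * (d / 3)"
      have "f (minimizer f) \<le> ?v" using \<kappa> by (simp add: min_value_def d_def)
      then obtain h where "h \<in> convex_class" "min_value h = ?v" "L2_norm01 (\<lambda>x. f x - h x) \<le> \<epsilon>"
        using convex_class_water_filling[OF f minimizer_in[OF f], of ?v \<kappa> "d / 3" \<Delta> \<epsilon>]
          water_level_min_value[OF f g] \<kappa> \<kappa>' \<Delta> True by (auto simp: d_def \<Delta>_def)
      then show thesis using that[of h] True \<kappa> by (simp add: d_def)
    next
      case False
      then have TZ: "T = minimizer" using T by simp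
      show thesis
      proof (cases "minimizer f = minimizer g")
        case True
        have "L2_norm01 (\<lambda>x. f x - f x) \<le> \<epsilon>" using \<epsilon> by (simp add: L2_norm01_def)
        then show thesis using that[OF f] True TZ by (simp add: d_def)
      next
        case False
        obtain p where p: "p \<in> {0..1}" "\<bar>p - minimizer f\<bar> = d / 3"
          "(LBINT x:{0..1}. (max 0 (f p - f x))\<^sup>2) \<le> \<Delta>\<^sup>2"
          by (rule water_level_minimizer[OF f g False]) (simp add: d_def \<Delta>_def TZ)
        \<comment> \<open>Convexity bounds the rise of f up to q by \<kappa> times its rise up to p,
          so a \<kappa>-fraction of the move is covered by a \<kappa>-fraction of the fill.\<close>
        define q where "q = minimizer f + \<kappa> * (p - minimizer f)"
        have q: "q \<in> {0..1}"
        proof -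
          have "q = (1 - \<kappa>) *\<^sub>R minimizer f + \<kappa> *\<^sub>R p" by (simp add: q_def algebra_simps)
          then show ?thesis
            using convexD_alt[of "{0..1::real}"] minimizer_in[OF f] p \<kappa> \<kappa>' by simp
        qed
        have "f q \<le> f (minimizer f) + \<kappa> * (f p - f (minimizer f))"
          unfolding q_def by (rule convex_segment[OF convex_class_convex[OF f]])
            (use minimizer_in[OF f] p \<kappa> \<kappa>' in auto)
        then obtain h where "h \<in> convex_class" "minimizer h = q" "L2_norm01 (\<lambda>x. f x - h x) \<le> \<epsilon>"
          using convex_class_water_filling[OF f q order_refl, of \<kappa> "f p - min_value f" \<Delta> \<epsilon>]
            p(3) min_value_le[OF f p(1)] \<kappa> \<kappa>' \<Delta> by (auto simp: min_value_def)
        moreover have "\<bar>minimizer f - q\<bar> = \<kappa> * d / 3"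
          using p(2) \<kappa> by (simp add: q_def abs_mult)
        ultimately show thesis using that TZ by simp
      qed
    qed
    then show ?thesis using local_modulus_ge[OF h(1,2), of T] by (simp only: h(3))
  qed
  have "((\<lambda>\<kappa>. ennreal (\<kappa> * d / 3)) \<longlongrightarrow> ennreal (\<epsilon> / \<Delta> * d / 3)) (at_left (\<epsilon> / \<Delta>))"
    by (intro tendsto_intros tendsto_ennrealI) auto
  moreover have "eventually (\<lambda>\<kappa>. ennreal (\<kappa> * d / 3) \<le> local_modulus T \<epsilon> f) (at_left (\<epsilon> / \<Delta>))"
    using eventually_at_left_real[of 0 "\<epsilon> / \<Delta>"] \<epsilon> \<Delta>
    by (auto elim!: eventually_mono intro!: main)
  ultimately have "ennreal (\<epsilon> / \<Delta> * d / 3) \<le> local_modulus T \<epsilon> f"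
    by (rule tendsto_upperbound) simp
  then show ?thesis by (simp add: d_def \<Delta>_def mult_ac)
qed

section \<open>The standard normal distribution\<close>

interpretation std_normal: real_distribution std_normal_distribution
  by (rule real_dist_normal_dist)

lemma std_normal_density_le: "std_normal_density x \<le> 1 / 2"
proof -
  have "1 / sqrt (2 * pi) \<le> 1 / sqrt (2 * 2)"
    using pi_ge_two by (intro divide_left_mono real_sqrt_le_mono) auto
  moreover have "exp (- x\<^sup>2 / 2) \<le> 1" by simp
  ultimately have "1 / sqrt (2 * pi) * exp (- x\<^sup>2 / 2) \<le> 1 / 2 * 1"
    by (intro mult_mono) auto
  then show ?thesis by (simp add: std_normal_density_def)
qed

lemma emeasure_std_normal:
  "A \<in> sets borel \<Longrightarrow>
    emeasure std_normal_distribution A = (\<integral>\<^sup>+x. ennreal (std_normal_density x) * indicator A x \<partial>lborel)"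
  by (simp add: emeasure_density)

lemma std_normal_singleton [simp]: "measure std_normal_distribution {x} = 0"
proof -
  have "emeasure std_normal_distribution {x} = (\<integral>\<^sup>+y. 0 \<partial>(lborel :: real measure))"
    unfolding emeasure_std_normal[OF borel_singleton[OF sets.empty_sets]]
    by (intro nn_integral_cong_AE) (use AE_lborel_singleton[of x] in \<open>auto elim!: eventually_mono\<close>)
  then show ?thesis by (simp add: measure_def)
qed

lemma isCont_std_normal_cdf: "isCont std_normal_cdf x"
  by (simp add: std_normal_cdf_def std_normal.isCont_cdf)

lemma std_normal_cdf_mono: "x \<le> y \<Longrightarrow> std_normal_cdf x \<le> std_normal_cdf y"
  by (simp add: std_normal_cdf_def std_normal.cdf_nondecreasing)

lemma std_normal_cdf_le_1: "std_normal_cdf x \<le> 1"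
  by (simp add: std_normal_cdf_def std_normal.cdf_bounded_prob)

lemma std_normal_cdf_nonneg: "0 \<le> std_normal_cdf x"
  by (simp add: std_normal_cdf_def std_normal.cdf_nonneg)

lemma measure_std_normal_atMost: "measure std_normal_distribution {..x} = std_normal_cdf x"
  by (simp add: std_normal_cdf_def cdf_def)

lemma measure_std_normal_lessThan: "measure std_normal_distribution {..<x} = std_normal_cdf x"
proof -
  have "measure std_normal_distribution ({..<x} \<union> {x}) = measure std_normal_distribution {..<x}"
    by (subst std_normal.finite_measure_Union) auto
  moreover have "{..<x} \<union> {x} = {..x}" by auto
  ultimately show ?thesis by (simp add: measure_std_normal_atMost)
qed

lemma measure_std_normal_greaterThan: "measure std_normal_distribution {x<..} = 1 - std_normal_cdf x"
  using std_normal.prob_compl[of "{..x}"]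
  by (simp add: measure_std_normal_atMost flip: Compl_eq_Diff_UNIV)

lemma measure_std_normal_atLeast: "measure std_normal_distribution {x..} = 1 - std_normal_cdf x"
  using std_normal.prob_compl[of "{..<x}"]
  by (simp add: measure_std_normal_lessThan flip: Compl_eq_Diff_UNIV)

lemma std_normal_cdf_minus: "std_normal_cdf (- x) = 1 - std_normal_cdf x"
proof -
  have "emeasure std_normal_distribution {..- x}
      = (\<integral>\<^sup>+y. ennreal (std_normal_density (- y)) * indicator {..- x} (- y) \<partial>lborel)"
    by (subst emeasure_std_normal) (simp, subst nn_integral_real_affine[where c = "-1" and t = 0], auto)
  also have "\<dots> = emeasure std_normal_distribution {x..}"
    by (subst emeasure_std_normal)
      (auto intro!: nn_integral_cong simp: std_normal_density_def indicator_def)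
  finally have "measure std_normal_distribution {..- x} = measure std_normal_distribution {x..}"
    by (simp add: measure_def)
  then show ?thesis by (simp add: measure_std_normal_atMost measure_std_normal_atLeast)
qed

lemma std_normal_cdf_0: "std_normal_cdf 0 = 1 / 2"
  using std_normal_cdf_minus[of 0] by simp

lemma std_normal_cdf_diff:
  assumes "a \<le> b"
  shows "std_normal_cdf b - std_normal_cdf a = measure std_normal_distribution {a<..b}"
  using assms std_normal.cdf_diff_eq[of a b] by (cases "a = b") (auto simp: std_normal_cdf_def)

text \<open>The Lipschitz constant 1/2 is crude but settles both numerical facts used later:
  \<Phi>(1/3) \<le> 2/3 and 2 \<Phi>(-1/6) \<ge> 5/6.\<close>

lemma std_normal_cdf_diff_le:
  assumes "a \<le> b"
  shows "std_normal_cdf b - std_normal_cdf a \<le> (b - a) / 2"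
proof -
  define c :: real where "c = 1 / 2"
  have c: "0 \<le> c" "std_normal_density x \<le> c" for x
    using std_normal_density_le by (simp_all add: c_def)
  have "emeasure std_normal_distribution {a<..b} \<le> (\<integral>\<^sup>+x. ennreal c * indicator {a<..b} x \<partial>lborel)"
    unfolding emeasure_std_normal[OF greaterThanAtMost_borel]
    by (intro nn_integral_mono mult_right_mono ennreal_leI c) auto
  also have "\<dots> = ennreal (c * (b - a))"
    using assms c(1) by (subst nn_integral_cmult) (auto simp: ennreal_mult'[symmetric])
  finally show ?thesis
    using assms c(1) by (simp add: std_normal_cdf_diff std_normal.emeasure_eq_measure) (simp add: c_def)
qed

text \<open>The density decreases on the positive axis, so its value at x is its least on (0,
  x].\<close>

lemma std_normal_cdf_diff_ge:
  assumes "0 \<le> x"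
  shows "x * std_normal_density x \<le> std_normal_cdf x - 1 / 2"
proof -
  have "ennreal (x * std_normal_density x) = (\<integral>\<^sup>+y. ennreal (std_normal_density x) * indicator {0<..x} y \<partial>lborel)"
    using assms by (subst nn_integral_cmult) (auto simp: ennreal_mult'[symmetric] mult.commute)
  also have "\<dots> \<le> emeasure std_normal_distribution {0<..x}"
    unfolding emeasure_std_normal[OF greaterThanAtMost_borel]
  proof (intro nn_integral_mono)
    fix y
    have "std_normal_density x \<le> std_normal_density y" if "0 < y" "y \<le> x"
      using that by (auto simp: std_normal_density_def divide_right_mono intro!: mult_left_mono power_mono)
    then show "ennreal (std_normal_density x) * indicator {0<..x} y
        \<le> ennreal (std_normal_density y) * indicator {0<..x} y"
      by (auto simp: indicator_def intro!: ennreal_leI)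
  qed
  finally show ?thesis
    using std_normal_cdf_diff[OF assms]
    by (simp add: std_normal_cdf_0 std_normal.emeasure_eq_measure)
qed

text \<open>On the tail the factor x may be enlarged to the integration variable y, and y times the
  density has the negative density as a primitive.\<close>

lemma std_normal_mills_ratio:
  assumes "0 \<le> x"
  shows "x * std_normal_cdf (- x) \<le> std_normal_density x"
proof -
  have lim: "((\<lambda>y. - std_normal_density y) \<longlongrightarrow> 0) at_top"
  proof -
    have "filterlim (\<lambda>y::real. y\<^sup>2) at_top at_top"
      by (rule filterlim_pow_at_top) (auto simp: filterlim_ident)
    then have "filterlim (\<lambda>y::real. y\<^sup>2 / 2) at_top at_top"
      using filterlim_at_top_mult_tendsto_pos[of "\<lambda>_. 1/2" "1/2" at_top "\<lambda>y::real. y\<^sup>2"] by simp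
    then have "filterlim (\<lambda>y::real. - (y\<^sup>2 / 2)) at_bot at_top"
      by (simp add: filterlim_uminus_at_top)
    then have "((\<lambda>y::real. exp (- (y\<^sup>2 / 2))) \<longlongrightarrow> 0) at_top"
      by (rule filterlim_compose[OF exp_at_bot])
    then have "((\<lambda>y. - (1 / sqrt (2 * pi) * exp (- (y\<^sup>2 / 2)))) \<longlongrightarrow> - (1 / sqrt (2 * pi) * 0)) at_top"
      by (intro tendsto_intros)
    then show ?thesis by (simp add: std_normal_density_def)
  qed
  have "ennreal (x * std_normal_cdf (- x)) = ennreal x * emeasure std_normal_distribution {x..}"
    using assms
    by (simp add: std_normal.emeasure_eq_measure measure_std_normal_atLeast std_normal_cdf_minus
        std_normal_cdf_le_1 ennreal_mult'[symmetric])
  also have "\<dots> = (\<integral>\<^sup>+y. ennreal x * (ennreal (std_normal_density y) * indicator {x..} y) \<partial>lborel)"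
    by (subst emeasure_std_normal) (auto simp: nn_integral_cmult)
  also have "\<dots> \<le> (\<integral>\<^sup>+y. ennreal (y * std_normal_density y) * indicator {x..} y \<partial>lborel)"
    using assms
    by (intro nn_integral_mono)
      (auto simp: indicator_def ennreal_mult'[symmetric] intro!: ennreal_leI mult_right_mono)
  also have "\<dots> = ennreal (0 - (- std_normal_density x))"
    using assms
    by (intro nn_integral_FTC_atLeast lim)
      (auto intro!: derivative_eq_intros simp: std_normal_density_def field_simps)
  finally show ?thesis by simp
qed

text \<open>With $A = \Phi(-x)$, the bounds $x A \le \varphi(x)$ and $x \varphi(x) \le 1/2 - A$ give
  $(1 + x^2) A \le 1/2$.\<close>

lemma std_normal_tail_le:
  assumes "0 \<le> x"
  shows "x * std_normal_cdf (- x) \<le> 1 / 4"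
proof -
  let ?A = "std_normal_cdf (- x)"
  have "x * (x * ?A) \<le> x * std_normal_density x"
    by (intro mult_left_mono std_normal_mills_ratio assms)
  also have "\<dots> \<le> 1 / 2 - ?A"
    using std_normal_cdf_diff_ge[OF assms] by (simp add: std_normal_cdf_minus)
  finally have "(1 + x\<^sup>2) * ?A \<le> 1 / 2" by (simp add: power2_eq_square algebra_simps)
  moreover have "(2 * x) * ?A \<le> (1 + x\<^sup>2) * ?A"
    using sum_squares_bound[of 1 x] by (intro mult_right_mono std_normal_cdf_nonneg) simp
  ultimately show ?thesis by simp
qed

text \<open>\<open>inv\<close> picks some preimage, so it is enough that the value 1 - \<alpha> is
  attained, which the intermediate value theorem gives.\<close>

lemma std_normal_cdf_quantile:
  assumes "0 < \<alpha>" "\<alpha> < 1"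
  shows "std_normal_cdf (normal_quantile \<alpha>) = 1 - \<alpha>"
proof -
  have "eventually (\<lambda>x. std_normal_cdf x < 1 - \<alpha>) at_bot"
    using std_normal.cdf_lim_at_bot assms unfolding std_normal_cdf_def by (intro order_tendstoD) auto
  then obtain a where a: "std_normal_cdf a < 1 - \<alpha>"
    using eventually_happens[of _ "at_bot :: real filter"] by auto
  have "eventually (\<lambda>x. 1 - \<alpha> < std_normal_cdf x) at_top"
    using std_normal.cdf_lim_at_top_prob assms unfolding std_normal_cdf_def by (intro order_tendstoD) auto
  then obtain b where b: "1 - \<alpha> < std_normal_cdf b"
    using eventually_happens[of _ "at_top :: real filter"] by auto
  have "a \<le> b" using a b std_normal_cdf_mono[of b a] by linarith
  then have "\<exists>x. a \<le> x \<and> x \<le> b \<and> std_normal_cdf x = 1 - \<alpha>"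
    using a b by (intro IVT) (auto simp: isCont_std_normal_cdf)
  then show ?thesis
    unfolding normal_quantile_def by (metis f_inv_into_f rangeI)
qed

text \<open>This is what makes B_\<alpha> at least 1 - 2 \<alpha>: \<Phi>(1/3) \<le> 1/2 + 1/6 is
  below 0.7, hence below 1 - \<alpha>.\<close>

lemma normal_quantile_ge:
  assumes "0 < \<alpha>" "\<alpha> < 0.3"
  shows "1 / 3 \<le> normal_quantile \<alpha>"
proof (rule ccontr)
  assume "\<not> ?thesis"
  then have "1 - \<alpha> \<le> std_normal_cdf (1 / 3)"
    using std_normal_cdf_quantile[of \<alpha>] std_normal_cdf_mono[of "normal_quantile \<alpha>" "1/3"] assms by simp
  then show False
    using std_normal_cdf_diff_le[of 0 "1/3"] assms by (simp add: std_normal_cdf_0)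
qed

section \<open>Linear statistics and upper bounds\<close>

text \<open>Unit variance is built in: every statistic is standardised before use, so a drift shows
  only in the shift.\<close>

definition has_normal_law :: "'b measure \<Rightarrow> ('b \<Rightarrow> real) \<Rightarrow> real \<Rightarrow> bool" where
  "has_normal_law P S \<mu> \<longleftrightarrow> S \<in> borel_measurable P \<and>
     distr P borel S = distr std_normal_distribution borel (\<lambda>x. x + \<mu>)"

lemma has_normal_law_measure:
  assumes S: "has_normal_law P S \<mu>" and A: "A \<in> sets borel"
  shows "measure P {y \<in> space P. S y \<in> A} = measure std_normal_distribution {x. x + \<mu> \<in> A}"
proof -
  have "measure P {y \<in> space P. S y \<in> A} = measure (distr P borel S) A"
    using S A by (subst measure_distr) (auto simp: has_normal_law_def vimage_def Int_def conj_commute)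
  also have "\<dots> = measure std_normal_distribution {x. x + \<mu> \<in> A}"
    using S A by (simp add: has_normal_law_def measure_distr vimage_def)
  finally show ?thesis .
qed

lemma has_normal_law_tails:
  assumes S: "has_normal_law P S \<mu>"
  shows "measure P {y \<in> space P. S y \<le> x} = std_normal_cdf (x - \<mu>)"
    and "measure P {y \<in> space P. S y < x} = std_normal_cdf (x - \<mu>)"
    and "measure P {y \<in> space P. x < S y} = std_normal_cdf (\<mu> - x)"
    and "measure P {y \<in> space P. x \<le> S y} = std_normal_cdf (\<mu> - x)"
proof -
  have eq: "{y. y + \<mu> \<in> {..x}} = {..x - \<mu>}" "{y. y + \<mu> \<in> {..<x}} = {..<x - \<mu>}"
    "{y. y + \<mu> \<in> {x<..}} = {x - \<mu><..}" "{y. y + \<mu> \<in> {x..}} = {x - \<mu>..}"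
    by auto
  show "measure P {y \<in> space P. S y \<le> x} = std_normal_cdf (x - \<mu>)"
    using has_normal_law_measure[OF S, of "{..x}"] unfolding eq by (simp add: measure_std_normal_atMost)
  show "measure P {y \<in> space P. S y < x} = std_normal_cdf (x - \<mu>)"
    using has_normal_law_measure[OF S, of "{..<x}"] unfolding eq by (simp add: measure_std_normal_lessThan)
  have m: "std_normal_cdf (\<mu> - x) = 1 - std_normal_cdf (x - \<mu>)"
    using std_normal_cdf_minus[of "x - \<mu>"] by simp
  show "measure P {y \<in> space P. x < S y} = std_normal_cdf (\<mu> - x)"
    using has_normal_law_measure[OF S, of "{x<..}"] unfolding eq m by (simp add: measure_std_normal_greaterThan)
  show "measure P {y \<in> space P. x \<le> S y} = std_normal_cdf (\<mu> - x)"
    using has_normal_law_measure[OF S, of "{x..}"] unfolding eq m by (simp add: measure_std_normal_atLeast)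
qed

section \<open>Weighted sums of increments\<close>

lemma steps_mono:
  fixes \<tau> :: "nat \<Rightarrow> real"
  assumes "\<And>i. i < n \<Longrightarrow> \<tau> i \<le> \<tau> (Suc i)" "i \<le> j" "j \<le> n"
  shows "\<tau> i \<le> \<tau> j"
  using assms(2,3)
proof (induction j rule: dec_induct)
  case (step k)
  then show ?case using assms(1)[of k] by force
qed simp

lemma partition_in_unit_interval:
  fixes \<tau> :: "nat \<Rightarrow> real"
  assumes "0 \<le> \<tau> 0" "\<And>i. i < n \<Longrightarrow> \<tau> i \<le> \<tau> (Suc i)" "\<tau> n \<le> 1" "i \<le> n"
  shows "\<tau> i \<in> {0..1}"
  using steps_mono[of n \<tau> 0 i] steps_mono[of n \<tau> i n] assms by auto

lemma set_integral_interval_diff: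
  assumes h: "bounded_measurable01 h" and st: "0 \<le> s" "s \<le> t" "t \<le> 1"
  shows "(LBINT x:{0..t}. h x) - (LBINT x:{0..s}. h x) = (LBINT x:{s..t}. h x)"
proof -
  have "{0..t} = {0..s} \<union> {s..t}" using st by auto
  moreover have "(LBINT x:{0..s} \<union> {s..t}. h x) = (LBINT x:{0..s}. h x) + (LBINT x:{s..t}. h x)"
    using st AE_lborel_singleton[of s]
    by (intro set_integral_Un_AE bounded_measurable01_integrable[OF h]) auto
  ultimately show ?thesis by simp
qed

lemma set_integral_interval_sum:
  assumes h: "bounded_measurable01 h" and \<tau>: "0 \<le> \<tau> 0" "\<And>i. i < n \<Longrightarrow> \<tau> i \<le> \<tau> (Suc i)" "\<tau> n \<le> 1"
  shows "(\<Sum>i<n. LBINT x:{\<tau> i..\<tau> (Suc i)}. h x) = (LBINT x:{\<tau> 0..\<tau> n}. h x)"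
proof -
  have range: "\<tau> i \<in> {0..1}" if "i \<le> n" for i
    using partition_in_unit_interval[of \<tau> n i] that \<tau> by simp
  have "(\<Sum>i<n. LBINT x:{\<tau> i..\<tau> (Suc i)}. h x)
      = (\<Sum>i<n. (LBINT x:{0..\<tau> (Suc i)}. h x) - (LBINT x:{0..\<tau> i}. h x))"
    using range \<tau> by (intro sum.cong set_integral_interval_diff[OF h, symmetric]) (auto simp: Suc_leI)
  also have "\<dots> = (LBINT x:{0..\<tau> n}. h x) - (LBINT x:{0..\<tau> 0}. h x)"
    by (rule sum_lessThan_telescope)
  also have "\<dots> = (LBINT x:{\<tau> 0..\<tau> n}. h x)"
    using range[of 0] range[of n] steps_mono[of n \<tau> 0 n] \<tau> by (intro set_integral_interval_diff[OF h]) auto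
  finally show ?thesis .
qed

lemma (in brownian_motion01) observed_path_measurable [measurable]: "observed_path W \<epsilon> h \<in> measurable M path_space"
  unfolding observed_path_def
  by (intro measurable_restrict borel_measurable_add borel_measurable_times borel_measurable_const
      measurable_W)

lemma (in brownian_motion01) prob_space_observation_law: "prob_space (observation_law M W \<epsilon> h)"
  unfolding observation_law_def by (intro prob_space_distr) simp

lemma (in brownian_motion01) space_observation_law [simp]: "space (observation_law M W \<epsilon> h) = space path_space"
  and sets_observation_law [simp, measurable_cong]: "sets (observation_law M W \<epsilon> h) = sets path_space"
  by (simp_all add: observation_law_def)

lemma (in brownian_motion01) distributed_weighted_increments:
  assumes \<tau>: "0 \<le> \<tau> 0" "\<And>i. i < n \<Longrightarrow> \<tau> i < \<tau> (Suc i)" "\<tau> n \<le> 1"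
    and V: "V = (\<Sum>i<n. (w i)\<^sup>2 * (\<tau> (Suc i) - \<tau> i))" "V > 0"
  shows "distributed M lborel (\<lambda>\<omega>. (\<Sum>i<n. w i * (W (\<tau> (Suc i)) \<omega> - W (\<tau> i) \<omega>)) / sqrt V)
    std_normal_density"
proof -
  have range: "\<tau> i \<in> {0..1}" if "i \<le> n" for i
    using partition_in_unit_interval[of \<tau> n i] that \<tau> by (simp add: less_imp_le)
  \<comment> \<open>A zero weight would contribute a degenerate summand without density, so such
    indices are removed before the normal laws are added.\<close>
  define I where "I = {i. i < n \<and> w i \<noteq> 0}"
  have VI: "V = (\<Sum>i\<in>I. (w i)\<^sup>2 * (\<tau> (Suc i) - \<tau> i))"
    unfolding V(1) I_def by (intro sum.mono_neutral_right) auto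
  have sumI: "(\<Sum>i<n. w i * (W (\<tau> (Suc i)) \<omega> - W (\<tau> i) \<omega>))
      = (\<Sum>i\<in>I. w i * (W (\<tau> (Suc i)) \<omega> - W (\<tau> i) \<omega>))" for \<omega>
    unfolding I_def by (intro sum.mono_neutral_right) auto
  have ne: "I \<noteq> {}" using V(2) VI by auto
  have "indep_vars (\<lambda>_. borel) (\<lambda>i \<omega>. W (\<tau> (Suc i)) \<omega> - W (\<tau> i) \<omega>) {..<n}"
    by (rule indep_increments) (use \<tau> less_imp_le in auto)
  then have "indep_vars (\<lambda>_. borel) (\<lambda>i \<omega>. W (\<tau> (Suc i)) \<omega> - W (\<tau> i) \<omega>) I"
    by (rule indep_vars_subset) (auto simp: I_def)
  then have ind: "indep_vars (\<lambda>_. borel) (\<lambda>i \<omega>. w i * (W (\<tau> (Suc i)) \<omega> - W (\<tau> i) \<omega>)) I"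
    by (rule indep_vars_compose2) measurable
  have "distributed M lborel (\<lambda>\<omega>. w i * (W (\<tau> (Suc i)) \<omega> - W (\<tau> i) \<omega>))
      (normal_density 0 (\<bar>w i\<bar> * sqrt (\<tau> (Suc i) - \<tau> i)))" if "i \<in> I" for i
  proof -
    have "distributed M lborel (\<lambda>\<omega>. W (\<tau> (Suc i)) \<omega> - W (\<tau> i) \<omega>)
        (normal_density 0 (sqrt (\<tau> (Suc i) - \<tau> i)))"
      using that \<tau> range by (intro normal_increments) (auto simp: I_def)
    from normal_density_affine[OF this, of "w i" 0] that \<tau> show ?thesis by (simp add: I_def)
  qed
  then have "distributed M lborel (\<lambda>\<omega>. \<Sum>i\<in>I. w i * (W (\<tau> (Suc i)) \<omega> - W (\<tau> i) \<omega>))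
      (normal_density (\<Sum>i\<in>I. 0) (sqrt (\<Sum>i\<in>I. (\<bar>w i\<bar> * sqrt (\<tau> (Suc i) - \<tau> i))\<^sup>2)))"
    using \<tau> by (intro sum_indep_normal ne ind) (auto simp: I_def)
  moreover have "(\<Sum>i\<in>I. (\<bar>w i\<bar> * sqrt (\<tau> (Suc i) - \<tau> i))\<^sup>2) = V"
    unfolding VI using \<tau> by (intro sum.cong) (auto simp: power_mult_distrib I_def less_imp_le)
  ultimately have "distributed M lborel (\<lambda>\<omega>. \<Sum>i\<in>I. w i * (W (\<tau> (Suc i)) \<omega> - W (\<tau> i) \<omega>))
      (normal_density 0 (sqrt V))"
    by simp
  then show ?thesis
    using V(2) unfolding sumI by (subst (asm) normal_standard_normal_convert) auto
qed

text \<open>A discrete stand-in for the Wiener integral of the weights. The noise part is \<epsilon>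
  sqrt V times a standard normal variable whatever the drift; the drift enters through the mean
  alone, and c is a free centring constant.\<close>

lemma (in brownian_motion01) has_normal_law_weighted_increments:
  assumes h: "bounded_measurable01 h" and \<epsilon>: "\<epsilon> > 0"
    and \<tau>: "0 \<le> \<tau> 0" "\<And>i. i < n \<Longrightarrow> \<tau> i < \<tau> (Suc i)" "\<tau> n \<le> 1"
    and V: "V = (\<Sum>i<n. (w i)\<^sup>2 * (\<tau> (Suc i) - \<tau> i))" "V > 0"
  shows "has_normal_law (observation_law M W \<epsilon> h)
    (\<lambda>y. ((\<Sum>i<n. w i * (y (\<tau> (Suc i)) - y (\<tau> i))) - c) / (\<epsilon> * sqrt V))
    (((\<Sum>i<n. w i * (LBINT x:{\<tau> i..\<tau> (Suc i)}. h x)) - c) / (\<epsilon> * sqrt V))"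
    (is "has_normal_law _ ?S ?\<mu>")
proof -
  have range: "\<tau> i \<in> {0..1}" if "i \<le> n" for i
    using partition_in_unit_interval[of \<tau> n i] that \<tau> by (simp add: less_imp_le)
  let ?N = "\<lambda>\<omega>. (\<Sum>i<n. w i * (W (\<tau> (Suc i)) \<omega> - W (\<tau> i) \<omega>)) / sqrt V"
  have N: "distributed M lborel ?N std_normal_density"
    by (rule distributed_weighted_increments[OF \<tau> V])
  have S: "?S \<in> borel_measurable path_space"
    using range by (intro borel_measurable_divide borel_measurable_diff borel_measurable_sum
        borel_measurable_times borel_measurable_const measurable_component_singleton) auto
  have path: "?S (observed_path W \<epsilon> h \<omega>) = ?N \<omega> + ?\<mu>" for \<omega>
  proof -
    have "w i * (observed_path W \<epsilon> h \<omega> (\<tau> (Suc i)) - observed_path W \<epsilon> h \<omega> (\<tau> i))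
        = w i * (LBINT x:{\<tau> i..\<tau> (Suc i)}. h x) + \<epsilon> * (w i * (W (\<tau> (Suc i)) \<omega> - W (\<tau> i) \<omega>))"
      if "i < n" for i
      using range[of i] range[of "Suc i"] \<tau>(2)[OF that] that
        set_integral_interval_diff[OF h, of "\<tau> i" "\<tau> (Suc i)"]
      by (simp add: observed_path_def algebra_simps flip: distrib_left)
    then have "(\<Sum>i<n. w i * (observed_path W \<epsilon> h \<omega> (\<tau> (Suc i)) - observed_path W \<epsilon> h \<omega> (\<tau> i)))
        = (\<Sum>i<n. w i * (LBINT x:{\<tau> i..\<tau> (Suc i)}. h x)) + \<epsilon> * (\<Sum>i<n. w i * (W (\<tau> (Suc i)) \<omega> - W (\<tau> i) \<omega>))"
      by (simp add: sum.distrib sum_distrib_left)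
    then have "?S (observed_path W \<epsilon> h \<omega>) =
        ((\<Sum>i<n. w i * (LBINT x:{\<tau> i..\<tau> (Suc i)}. h x)) + \<epsilon> * (\<Sum>i<n. w i * (W (\<tau> (Suc i)) \<omega> - W (\<tau> i) \<omega>)) - c)
          / (\<epsilon> * sqrt V)"
      by (simp only:)
    also have "(A + \<epsilon> * B - c) / (\<epsilon> * sqrt V) = B / sqrt V + (A - c) / (\<epsilon> * sqrt V)" for A B
      using \<epsilon> V(2) by (simp add: add_divide_distrib diff_divide_distrib)
    finally show ?thesis .
  qed
  have "distr (observation_law M W \<epsilon> h) borel ?S = distr M borel (\<lambda>\<omega>. ?S (observed_path W \<epsilon> h \<omega>))"
    unfolding observation_law_def using S by (subst distr_distr) (auto simp: comp_def)
  also have "\<dots> = distr M borel (\<lambda>\<omega>. ?N \<omega> + ?\<mu>)" by (simp only: path)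
  also have "\<dots> = distr (distr M lborel ?N) borel (\<lambda>x. x + ?\<mu>)"
    using distributed_measurable[OF N] by (subst distr_distr) (auto simp: comp_def)
  also have "distr M lborel ?N = std_normal_distribution"
    by (rule distributed_distr_eq_density[OF N])
  finally show ?thesis using S unfolding has_normal_law_def by simp
qed

text \<open>For competitors within \<epsilon> some statistic with a shift of known sign suffices,
  and f and g may even agree almost everywhere. The single increment over the whole interval, with
  the sign of the difference of the integrals, always provides one.\<close>

lemma (in brownian_motion01) ex_normal_statistic:
  assumes f: "bounded_measurable01 f" and g: "bounded_measurable01 g" and \<epsilon>: "\<epsilon> > 0"
  obtains S \<delta> where "\<delta> \<ge> 0" "has_normal_law (observation_law M W \<epsilon> f) S 0"
    "has_normal_law (observation_law M W \<epsilon> g) S \<delta>"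
proof -
  define a where "a = (LBINT x:{0..1}. f x)"
  define b where "b = (LBINT x:{0..1}. g x)"
  define s :: real where "s = (if a \<le> b then 1 else - 1)"
  let ?S = "\<lambda>y. ((\<Sum>i<1::nat. s * (y (real (Suc i)) - y (real i))) - s * a) / (\<epsilon> * sqrt 1)"
  have *: "has_normal_law (observation_law M W \<epsilon> h) ?S ((s * (LBINT x:{0..1}. h x) - s * a) / \<epsilon>)"
    if "bounded_measurable01 h" for h
    using has_normal_law_weighted_increments[OF that \<epsilon>, of real 1 1 "\<lambda>_. s" "s * a"]
    by (simp add: s_def)
  show thesis
    by (rule that[of "(s * b - s * a) / \<epsilon>" ?S])
      (use *[OF f] *[OF g] \<epsilon> in \<open>auto simp: a_def b_def s_def\<close>)
qed

section \<open>Two-point upper bounds\<close>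

text \<open>The estimator chooses between the two parameters by the symmetric test with threshold
  \<delta>/2. Both risks then equal d \<Phi>(-\<delta>/2), and the tail bound at \<delta>/2 turns
  this into d / (2 \<delta>).\<close>

lemma (in brownian_motion01) estimation_benchmark_pair_le:
  fixes T :: "(real \<Rightarrow> real) \<Rightarrow> real"
  assumes Sf: "has_normal_law (observation_law M W \<epsilon> f) S 0"
    and Sg: "has_normal_law (observation_law M W \<epsilon> g) S \<delta>" and \<delta>: "\<delta> > 0"
  shows "(INF T_hat\<in>borel_measurable path_space.
      max (estimation_risk M W T \<epsilon> T_hat f) (estimation_risk M W T \<epsilon> T_hat g))
      \<le> ennreal (\<bar>T f - T g\<bar> / (2 * \<delta>))"
proof -
  define d where "d = \<bar>T f - T g\<bar>"
  define T_hat where "T_hat y = (if S y \<le> \<delta> / 2 then T f else T g)" for y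
  have S: "S \<in> borel_measurable path_space"
    using Sf by (simp add: has_normal_law_def cong: measurable_cong_sets)
  have [measurable]: "T_hat \<in> borel_measurable path_space"
    unfolding T_hat_def using S by measurable
  have \<Phi>: "d * std_normal_cdf (- (\<delta> / 2)) \<le> d / (2 * \<delta>)"
  proof -
    have "d * (\<delta> / 2 * std_normal_cdf (- (\<delta> / 2))) \<le> d * (1 / 4)"
      using \<delta> by (intro mult_left_mono std_normal_tail_le) (auto simp: d_def)
    then show ?thesis using \<delta> by (simp add: field_simps)
  qed
  have sets1: "{y \<in> space path_space. \<delta> / 2 < S y} \<in> sets path_space"
    "{y \<in> space path_space. S y \<le> \<delta> / 2} \<in> sets path_space"
    using S by measurable
  interpret F: prob_space "observation_law M W \<epsilon> f" by (rule prob_space_observation_law)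
  interpret G: prob_space "observation_law M W \<epsilon> g" by (rule prob_space_observation_law)
  have "estimation_risk M W T \<epsilon> T_hat f
      = (\<integral>\<^sup>+y. ennreal d * indicator {y \<in> space path_space. \<delta> / 2 < S y} y \<partial>observation_law M W \<epsilon> f)"
    unfolding estimation_risk_def
    by (intro nn_integral_cong) (auto simp: T_hat_def d_def indicator_def abs_minus_commute)
  also have "\<dots> = ennreal (d * std_normal_cdf (- (\<delta> / 2)))"
    using has_normal_law_tails(3)[OF Sf, of "\<delta> / 2"] sets1
    by (subst nn_integral_cmult_indicator)
      (auto simp: F.emeasure_eq_measure d_def ennreal_mult'[symmetric])
  finally have 1: "estimation_risk M W T \<epsilon> T_hat f \<le> ennreal (d / (2 * \<delta>))"
    using \<Phi> by (simp add: ennreal_leI)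
  have "estimation_risk M W T \<epsilon> T_hat g
      = (\<integral>\<^sup>+y. ennreal d * indicator {y \<in> space path_space. S y \<le> \<delta> / 2} y \<partial>observation_law M W \<epsilon> g)"
    unfolding estimation_risk_def
    by (intro nn_integral_cong) (auto simp: T_hat_def d_def indicator_def)
  also have "\<dots> = ennreal (d * std_normal_cdf (- (\<delta> / 2)))"
    using has_normal_law_tails(1)[OF Sg, of "\<delta> / 2"] sets1
    by (subst nn_integral_cmult_indicator)
      (auto simp: G.emeasure_eq_measure d_def ennreal_mult'[symmetric])
  finally have 2: "estimation_risk M W T \<epsilon> T_hat g \<le> ennreal (d / (2 * \<delta>))"
    using \<Phi> by (simp add: ennreal_leI)
  show ?thesis
    using 1 2 by (intro INF_lower2[of T_hat]) (auto simp: d_def)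
qed

text \<open>The interval contains both parameters only where neither of the one-sided tests of
  level $\alpha$ rejects; when $\delta > 2 z_\alpha$ this never happens.\<close>

lemma (in brownian_motion01) inference_benchmark_pair_le:
  fixes T :: "(real \<Rightarrow> real) \<Rightarrow> real"
  assumes Sf: "has_normal_law (observation_law M W \<epsilon> f) S 0"
    and Sg: "has_normal_law (observation_law M W \<epsilon> g) S \<delta>" and \<delta>: "\<delta> \<ge> 0"
    and \<alpha>: "0 < \<alpha>" "\<alpha> < 0.3"
  shows "(INF (l, u)\<in>confidence_intervals M W T \<alpha> \<epsilon> {f, g}.
      \<integral>\<^sup>+ y. ennreal (u y - l y) \<partial>observation_law M W \<epsilon> f)
      \<le> ennreal (\<bar>T f - T g\<bar> * (1 - 2 * \<alpha>))" (is "?I \<le> _")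
    and "\<delta> > 0 \<Longrightarrow> (INF (l, u)\<in>confidence_intervals M W T \<alpha> \<epsilon> {f, g}.
      \<integral>\<^sup>+ y. ennreal (u y - l y) \<partial>observation_law M W \<epsilon> f)
      \<le> ennreal (\<bar>T f - T g\<bar> * (normal_quantile \<alpha> * (1 - 2 * \<alpha>) / \<delta>))"
proof -
  define d where "d = \<bar>T f - T g\<bar>"
  define z where "z = normal_quantile \<alpha>"
  have z: "z \<ge> 1 / 3" "std_normal_cdf z = 1 - \<alpha>"
    using normal_quantile_ge[OF \<alpha>] std_normal_cdf_quantile[of \<alpha>] \<alpha> by (auto simp: z_def)
  have S [measurable]: "S \<in> borel_measurable path_space"
    using Sf by (simp add: has_normal_law_def cong: measurable_cong_sets)
  interpret F: prob_space "observation_law M W \<epsilon> f" by (rule prob_space_observation_law)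
  interpret G: prob_space "observation_law M W \<epsilon> g" by (rule prob_space_observation_law)
  \<comment> \<open>Above \<open>a\<close> the value T f is dropped, below \<open>b\<close> the
    value T g. For \<delta> \<le> 2 z these are the level-\<alpha> thresholds z and \<delta> - z;
    for larger \<delta> both are moved to \<delta>/2, which keeps b \<le> a and only increases
    coverage.\<close>
  define a where "a = max z (\<delta> / 2)"
  define b where "b = min (\<delta> - z) (\<delta> / 2)"
  define l where "l y = (if S y < b then T f else if S y \<le> a then min (T f) (T g) else T g)" for y
  define u where "u y = (if S y < b then T f else if S y \<le> a then max (T f) (T g) else T g)" for y
  have ab: "b \<le> a" using z by (simp add: a_def b_def)
  have meas: "l \<in> borel_measurable path_space" "u \<in> borel_measurable path_space"
    unfolding l_def u_def by measurable
  have sets1: "{y \<in> space path_space. S y \<le> a} \<in> sets path_space"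
    "{y \<in> space path_space. b \<le> S y} \<in> sets path_space"
    "{y \<in> space path_space. S y < b} \<in> sets path_space"
    by measurable
  have "{y \<in> space path_space. c \<in> {l y..u y}}
      = {y \<in> space path_space. l y \<le> c} \<inter> {y \<in> space path_space. c \<le> u y}" for c
    by auto
  then have sets2: "{y \<in> space path_space. c \<in> {l y..u y}} \<in> sets path_space" for c
    using meas by (auto intro!: borel_measurable_le)
  have covf: "1 - \<alpha> \<le> measure (observation_law M W \<epsilon> f) {y \<in> space path_space. T f \<in> {l y..u y}}"
  proof -
    have "1 - \<alpha> \<le> std_normal_cdf a"
      using z std_normal_cdf_mono[of z a] by (simp add: a_def)
    also have "\<dots> = measure (observation_law M W \<epsilon> f) {y \<in> space path_space. S y \<le> a}"
      using has_normal_law_tails(1)[OF Sf, of a] by simp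
    also have "\<dots> \<le> measure (observation_law M W \<epsilon> f) {y \<in> space path_space. T f \<in> {l y..u y}}"
      using ab sets2 by (intro F.finite_measure_mono) (auto simp: l_def u_def)
    finally show ?thesis .
  qed
  have covg: "1 - \<alpha> \<le> measure (observation_law M W \<epsilon> g) {y \<in> space path_space. T g \<in> {l y..u y}}"
  proof -
    have "1 - \<alpha> \<le> std_normal_cdf (\<delta> - b)"
      using z std_normal_cdf_mono[of z "\<delta> - b"] by (simp add: b_def)
    also have "\<dots> = measure (observation_law M W \<epsilon> g) {y \<in> space path_space. b \<le> S y}"
      using has_normal_law_tails(4)[OF Sg, of b] by simp
    also have "\<dots> \<le> measure (observation_law M W \<epsilon> g) {y \<in> space path_space. T g \<in> {l y..u y}}"
      using ab sets2 by (intro G.finite_measure_mono) (auto simp: l_def u_def)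
    finally show ?thesis .
  qed
  have CI: "(l, u) \<in> confidence_intervals M W T \<alpha> \<epsilon> {f, g}"
    using covf covg meas by (auto simp: confidence_intervals_def l_def u_def)
  have diff: "measure (observation_law M W \<epsilon> f)
      ({y \<in> space path_space. S y \<le> a} - {y \<in> space path_space. S y < b})
      = std_normal_cdf a - std_normal_cdf b"
    using has_normal_law_tails(1)[OF Sf, of a] has_normal_law_tails(2)[OF Sf, of b] ab sets1
    by (subst F.finite_measure_Diff) auto
  have "(\<integral>\<^sup>+ y. ennreal (u y - l y) \<partial>observation_law M W \<epsilon> f)
      = (\<integral>\<^sup>+y. ennreal d * indicator
          ({y \<in> space path_space. S y \<le> a} - {y \<in> space path_space. S y < b}) y \<partial>observation_law M W \<epsilon> f)"
    by (intro nn_integral_cong) (auto simp: l_def u_def d_def indicator_def)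
  also have "\<dots> = ennreal (d * (std_normal_cdf a - std_normal_cdf b))"
    using sets1 diff std_normal_cdf_mono[OF ab]
    by (subst nn_integral_cmult_indicator)
      (auto simp: F.emeasure_eq_measure d_def ennreal_mult'[symmetric])
  finally have len: "?I \<le> ennreal (d * (std_normal_cdf a - std_normal_cdf b))"
    using CI by (intro INF_lower2[of "(l, u)"]) auto
  have mz: "std_normal_cdf (- z) = \<alpha>" using std_normal_cdf_minus[of z] z by simp
  have case1: "std_normal_cdf a - std_normal_cdf b \<le> 1 - 2 * \<alpha>"
  proof (cases "\<delta> \<le> 2 * z")
    case True
    then have "a = z" "b = \<delta> - z" by (auto simp: a_def b_def)
    then show ?thesis using z(2) mz std_normal_cdf_mono[of "- z" "\<delta> - z"] \<delta> by simp
  next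
    case False
    then have "a = b" by (auto simp: a_def b_def)
    then show ?thesis using \<alpha> by simp
  qed
  show "?I \<le> ennreal (\<bar>T f - T g\<bar> * (1 - 2 * \<alpha>))"
    using case1 by (intro order_trans[OF len] ennreal_leI) (auto simp: d_def intro!: mult_left_mono)
  show "?I \<le> ennreal (\<bar>T f - T g\<bar> * (normal_quantile \<alpha> * (1 - 2 * \<alpha>) / \<delta>))" if \<delta>0: "\<delta> > 0"
  proof -
    \<comment> \<open>Up to z the uniform bound 1 - 2 \<alpha> suffices. Between z and 2 z the lower
      threshold is nonnegative, so the probability halves to 1/2 - \<alpha> while \<delta> at most
      doubles to 2 z. Beyond 2 z it is 0.\<close>
    have "\<delta> * (std_normal_cdf a - std_normal_cdf b) \<le> z * (1 - 2 * \<alpha>)"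
    proof (cases "\<delta> \<le> z")
      case True
      have "\<delta> * (std_normal_cdf a - std_normal_cdf b) \<le> z * (1 - 2 * \<alpha>)"
        using True \<delta>0 case1 std_normal_cdf_mono[OF ab] \<alpha> by (intro mult_mono) auto
      then show ?thesis .
    next
      case False
      show ?thesis
      proof (cases "\<delta> \<le> 2 * z")
        case True
        then have "a = z" "b = \<delta> - z" by (auto simp: a_def b_def)
        then have "std_normal_cdf a - std_normal_cdf b \<le> 1 / 2 - \<alpha>"
          using z std_normal_cdf_mono[of 0 "\<delta> - z"] False by (simp add: std_normal_cdf_0)
        then have "\<delta> * (std_normal_cdf a - std_normal_cdf b) \<le> (2 * z) * (1 / 2 - \<alpha>)"
          using True \<delta>0 std_normal_cdf_mono[OF ab] \<alpha> z by (intro mult_mono) auto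
        then show ?thesis by (simp add: algebra_simps)
      next
        case False
        then have "a = b" by (auto simp: a_def b_def)
        then show ?thesis using \<alpha> z by simp
      qed
    qed
    then have "std_normal_cdf a - std_normal_cdf b \<le> z * (1 - 2 * \<alpha>) / \<delta>"
      using \<delta>0 by (simp add: field_simps)
    then show ?thesis
      unfolding d_def[symmetric] z_def[symmetric]
      by (intro order_trans[OF len] ennreal_leI mult_left_mono) (auto simp: d_def)
  qed
qed

section \<open>Step-function approximation of the optimal weights\<close>

lemma set_integral_Icc_eq_Ico:
  fixes h :: "real \<Rightarrow> real"
  shows "(LBINT x:{a..b}. h x) = (LBINT x:{a..<b}. h x)"
  by (rule set_integral_discrete_difference[where X = "{b}"]) auto

text \<open>The left-endpoint step function on the grid i/n. The floor makes it a formula in x,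
  convenient for pointwise limits; at n = 0 division by zero gives the harmless constant
  \<open>k 0\<close>.\<close>

definition grid_step :: "(real \<Rightarrow> real) \<Rightarrow> nat \<Rightarrow> real \<Rightarrow> real" where
  "grid_step k n x = k (real_of_int \<lfloor>real n * x\<rfloor> / real n)"

lemma grid_step_eq:
  assumes "n > 0" "x \<in> {real i / real n..<real (Suc i) / real n}"
  shows "grid_step k n x = k (real i / real n)"
proof -
  have "\<lfloor>real n * x\<rfloor> = int i"
    using assms by (intro floor_unique) (auto simp: field_simps)
  then show ?thesis by (simp add: grid_step_def)
qed

lemma grid_point_range:
  assumes "x \<in> {0..1}"
  shows "real_of_int \<lfloor>real n * x\<rfloor> / real n \<in> {0..1}"
proof (cases "n = 0")
  case False
  have "real_of_int \<lfloor>real n * x\<rfloor> \<le> real n * x" by simp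
  also have "\<dots> \<le> real n * 1" using assms by (intro mult_left_mono) auto
  finally show ?thesis using assms False by (auto simp: field_simps)
qed simp

text \<open>The floor takes values in a countable space, so any function of it is measurable; the
  bound of k holds at every point of the interval and so at the grid points.\<close>

lemma bounded_measurable01_grid_step:
  assumes k: "bounded_measurable01 k"
  shows "bounded_measurable01 (grid_step k n)"
proof -
  have "(\<lambda>x. (\<lambda>j::int. k (real_of_int j / real n)) \<lfloor>real n * x\<rfloor>) \<in> borel_measurable borel"
    by measurable
  then have "grid_step k n \<in> borel_measurable borel"
    unfolding grid_step_def[abs_def] by simp
  then have "set_borel_measurable lborel {0..1} (grid_step k n)"
    unfolding set_borel_measurable_def by measurable
  moreover have "\<bar>grid_step k n x\<bar> \<le> B" if "\<forall>x\<in>{0..1}. \<bar>k x\<bar> \<le> B" "x \<in> {0..1}" for x B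
    using that grid_point_range unfolding grid_step_def by blast
  ultimately show ?thesis
    using k unfolding bounded_measurable01_def by blast
qed

lemma grid_step_tendsto:
  assumes k: "isCont k x"
  shows "(\<lambda>n. grid_step k n x) \<longlonglongrightarrow> k x"
proof -
  have "(\<lambda>n. real_of_int \<lfloor>real n * x\<rfloor> / real n - x) \<longlonglongrightarrow> 0"
  proof (rule tendsto_rabs_zero_cancel, rule tendsto_sandwich)
    show "eventually (\<lambda>n. \<bar>real_of_int \<lfloor>real n * x\<rfloor> / real n - x\<bar> \<le> inverse (real n)) sequentially"
      using eventually_gt_at_top[of 0]
    proof eventually_elim
      case (elim n)
      have "\<bar>real_of_int \<lfloor>real n * x\<rfloor> - real n * x\<bar> \<le> 1" by linarith
      then have "\<bar>real_of_int \<lfloor>real n * x\<rfloor> - real n * x\<bar> / real n \<le> 1 / real n"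
        by (intro divide_right_mono) auto
      moreover have "real_of_int \<lfloor>real n * x\<rfloor> / real n - x = (real_of_int \<lfloor>real n * x\<rfloor> - real n * x) / real n"
        using elim by (simp add: field_simps)
      ultimately show ?case by (simp add: inverse_eq_divide)
    qed
  qed (auto simp: lim_inverse_n)
  then have "(\<lambda>n. real_of_int \<lfloor>real n * x\<rfloor> / real n) \<longlonglongrightarrow> x"
    by (simp add: LIM_zero_iff)
  then show ?thesis
    unfolding grid_step_def by (rule isCont_tendsto_compose[OF k])
qed

text \<open>Dominated convergence with the square of the bound of k. The jumps allowed at 0 and 1
  are a null set.\<close>

lemma grid_step_set_integral_tendsto:
  assumes k: "bounded_measurable01 k" "\<And>x. x \<in> {0<..<1} \<Longrightarrow> isCont k x"
  shows "(\<lambda>n. LBINT x:{0..1}. grid_step k n x * k x) \<longlonglongrightarrow> (LBINT x:{0..1}. (k x)\<^sup>2)"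
    and "(\<lambda>n. LBINT x:{0..1}. (grid_step k n x)\<^sup>2) \<longlonglongrightarrow> (LBINT x:{0..1}. (k x)\<^sup>2)"
proof -
  obtain B where B: "\<And>x. x \<in> {0..1} \<Longrightarrow> \<bar>k x\<bar> \<le> B"
    using k(1) unfolding bounded_measurable01_def by blast
  have Bg: "\<bar>grid_step k n x\<bar> \<le> B" if "x \<in> {0..1}" for n x
    using B grid_point_range[OF that] unfolding grid_step_def by blast
  note bm = bounded_measurable01_grid_step[OF k(1)]
  have main: "(\<lambda>n. LBINT x:{0..1}. F n x) \<longlonglongrightarrow> (LBINT x:{0..1}. (k x)\<^sup>2)"
    if F: "\<And>n. bounded_measurable01 (F n)" "\<And>n x. x \<in> {0..1} \<Longrightarrow> \<bar>F n x\<bar> \<le> B * B"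
      "\<And>x. x \<in> {0<..<1} \<Longrightarrow> (\<lambda>n. F n x) \<longlonglongrightarrow> (k x)\<^sup>2" for F
    unfolding set_lebesgue_integral_def
  proof (rule integral_dominated_convergence)
    show "(\<lambda>x. indicat_real {0..1} x *\<^sub>R (k x)\<^sup>2) \<in> borel_measurable lborel"
      using bounded_measurable01_power2[OF k(1)]
      by (simp add: bounded_measurable01_def set_borel_measurable_def)
    show "(\<lambda>x. indicat_real {0..1} x *\<^sub>R F n x) \<in> borel_measurable lborel" for n
      using F(1)[of n] by (simp add: bounded_measurable01_def set_borel_measurable_def)
    show "integrable lborel (\<lambda>x. indicat_real {0..1::real} x *\<^sub>R (B * B))" by simp
    show "AE x in lborel. norm (indicat_real {0..1} x *\<^sub>R F n x) \<le> indicat_real {0..1} x *\<^sub>R (B * B)" for n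
      using F(2)[of _ n] by (intro AE_I2) (auto simp: indicator_def)
    show "AE x in lborel. (\<lambda>n. indicat_real {0..1} x *\<^sub>R F n x) \<longlonglongrightarrow> indicat_real {0..1} x *\<^sub>R (k x)\<^sup>2"
      using AE_lborel_singleton[of 0] AE_lborel_singleton[of 1]
    proof eventually_elim
      case (elim x)
      show ?case
      proof (cases "x \<in> {0..1}")
        case True
        then show ?thesis using elim F(3)[of x] by simp
      qed simp
    qed
  qed
  show "(\<lambda>n. LBINT x:{0..1}. grid_step k n x * k x) \<longlonglongrightarrow> (LBINT x:{0..1}. (k x)\<^sup>2)"
  proof (rule main)
    show "bounded_measurable01 (\<lambda>x. grid_step k n x * k x)" for n
      by (intro bounded_measurable01_intros bm k)
    show "\<bar>grid_step k n x * k x\<bar> \<le> B * B" if "x \<in> {0..1}" for n x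
      using Bg[OF that, of n] B[OF that] by (auto simp: abs_mult intro!: mult_mono)
    show "(\<lambda>n. grid_step k n x * k x) \<longlonglongrightarrow> (k x)\<^sup>2" if "x \<in> {0<..<1}" for x
      unfolding power2_eq_square by (intro tendsto_intros grid_step_tendsto k that)
  qed
  show "(\<lambda>n. LBINT x:{0..1}. (grid_step k n x)\<^sup>2) \<longlonglongrightarrow> (LBINT x:{0..1}. (k x)\<^sup>2)"
  proof (rule main)
    show "bounded_measurable01 (\<lambda>x. (grid_step k n x)\<^sup>2)" for n
      by (intro bounded_measurable01_power2 bm)
    show "\<bar>(grid_step k n x)\<^sup>2\<bar> \<le> B * B" if "x \<in> {0..1}" for n x
    proof -
      have "\<bar>grid_step k n x\<bar> * \<bar>grid_step k n x\<bar> \<le> B * B"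
        using Bg[OF that, of n] by (intro mult_mono) auto
      then show ?thesis by (simp add: power2_eq_square)
    qed
    show "(\<lambda>n. (grid_step k n x)\<^sup>2) \<longlonglongrightarrow> (k x)\<^sup>2" if "x \<in> {0<..<1}" for x
      by (intro tendsto_intros grid_step_tendsto k that)
  qed
qed

text \<open>Mean shift and variance of the grid statistic become integrals of the step function.
  Closed cells are opened on the right, since the floor already jumps there.\<close>

lemma grid_step_set_integral_sum:
  assumes k: "bounded_measurable01 k" and n: "n > 0"
  shows "(\<Sum>i<n. k (real i / real n) * (LBINT x:{real i / real n..real (Suc i) / real n}. k x))
      = (LBINT x:{0..1}. grid_step k n x * k x)"
    and "(\<Sum>i<n. (k (real i / real n))\<^sup>2 * (real (Suc i) / real n - real i / real n))
      = (LBINT x:{0..1}. (grid_step k n x)\<^sup>2)"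
proof -
  let ?\<tau> = "\<lambda>i. real i / real n"
  note bm = bounded_measurable01_grid_step[OF k]
  have sum01: "(\<Sum>i<n. LBINT x:{?\<tau> i..?\<tau> (Suc i)}. F x) = (LBINT x:{0..1}. F x)"
    if "bounded_measurable01 F" for F
    using set_integral_interval_sum[OF that, of ?\<tau> n] n by (simp add: divide_right_mono)
  have "k (?\<tau> i) * (LBINT x:{?\<tau> i..?\<tau> (Suc i)}. k x) = (LBINT x:{?\<tau> i..?\<tau> (Suc i)}. grid_step k n x * k x)" for i
    unfolding set_integral_Icc_eq_Ico set_integral_mult_right[symmetric]
    by (intro set_lebesgue_integral_cong) (auto simp: grid_step_eq[OF n])
  then show "(\<Sum>i<n. k (?\<tau> i) * (LBINT x:{?\<tau> i..?\<tau> (Suc i)}. k x))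
      = (LBINT x:{0..1}. grid_step k n x * k x)"
    by (simp only: sum01[OF bounded_measurable01_intros(3)[OF bm k]])
  have "(k (?\<tau> i))\<^sup>2 * (?\<tau> (Suc i) - ?\<tau> i) = (LBINT x:{?\<tau> i..?\<tau> (Suc i)}. (grid_step k n x)\<^sup>2)" for i
  proof -
    have "?\<tau> i \<le> ?\<tau> (Suc i)" by (simp add: divide_right_mono)
    then have "(k (?\<tau> i))\<^sup>2 * (?\<tau> (Suc i) - ?\<tau> i) = (LBINT x:{?\<tau> i..?\<tau> (Suc i)}. (k (?\<tau> i))\<^sup>2)"
      by (simp add: set_lebesgue_integral_def)
    also have "\<dots> = (LBINT x:{?\<tau> i..?\<tau> (Suc i)}. (grid_step k n x)\<^sup>2)"
      unfolding set_integral_Icc_eq_Ico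
      by (intro set_lebesgue_integral_cong) (auto simp: grid_step_eq[OF n])
    finally show ?thesis .
  qed
  then show "(\<Sum>i<n. (k (?\<tau> i))\<^sup>2 * (?\<tau> (Suc i) - ?\<tau> i)) = (LBINT x:{0..1}. (grid_step k n x)\<^sup>2)"
    by (simp only: sum01[OF bounded_measurable01_power2[OF bm]])
qed

lemma convex_class_isCont:
  assumes f: "f \<in> convex_class" and x: "x \<in> {0<..<1}"
  shows "isCont f x"
proof -
  have "convex_on {0<..<1} f"
    using convex_class_convex[OF f] by (rule convex_on_subset) auto
  then have "continuous_on {0<..<1} f"
    by (intro convex_on_continuous) auto
  then show ?thesis using x by (simp add: continuous_on_eq_continuous_at)
qed

lemma L2_norm01_commute: "L2_norm01 (\<lambda>x. f x - g x) = L2_norm01 (\<lambda>x. g x - f x)"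
  by (simp add: L2_norm01_def power2_commute)

text \<open>The ideal statistic would integrate g - f against the observation. With sampled weights
  the shift is U / (\<epsilon> sqrt V), where U and V both tend to \<Delta>^2, so the ideal
  separation \<Delta> / \<epsilon> is reached in the limit.\<close>

lemma (in brownian_motion01) normal_statistics_tendsto:
  assumes f: "f \<in> convex_class" and g: "g \<in> convex_class" and \<epsilon>: "\<epsilon> > 0"
    and \<Delta>: "L2_norm01 (\<lambda>x. f x - g x) > 0"
  obtains S \<delta> where "\<delta> \<longlonglongrightarrow> L2_norm01 (\<lambda>x. f x - g x) / \<epsilon>"
    "eventually (\<lambda>n. has_normal_law (observation_law M W \<epsilon> f) (S n) 0 \<and>
        has_normal_law (observation_law M W \<epsilon> g) (S n) (\<delta> n)) sequentially"
proof -
  define \<Delta> where "\<Delta> = L2_norm01 (\<lambda>x. f x - g x)"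
  define k where "k x = g x - f x" for x
  have bf: "bounded_measurable01 f" and bg: "bounded_measurable01 g"
    using f g by (simp_all add: convex_class_bounded_measurable)
  have bk: "bounded_measurable01 k"
    unfolding k_def[abs_def] by (intro bounded_measurable01_intros bf bg)
  have ck: "isCont k x" if "x \<in> {0<..<1}" for x
    unfolding k_def[abs_def] by (intro continuous_intros convex_class_isCont f g that)
  have int: "(LBINT x:{0..1}. (k x)\<^sup>2) = \<Delta>\<^sup>2"
    unfolding \<Delta>_def L2_norm01_commute[of f] L2_norm01_power2 k_def ..
  have \<Delta>0: "\<Delta> > 0" using \<Delta> by (simp add: \<Delta>_def)
  define U where "U n = (LBINT x:{0..1}. grid_step k n x * k x)" for n
  define V where "V n = (LBINT x:{0..1}. (grid_step k n x)\<^sup>2)" for n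
  have lim: "U \<longlonglongrightarrow> \<Delta>\<^sup>2" "V \<longlonglongrightarrow> \<Delta>\<^sup>2"
    using grid_step_set_integral_tendsto[OF bk ck] unfolding U_def V_def int by auto
  define \<delta> where "\<delta> n = U n / (\<epsilon> * sqrt (V n))" for n
  have "\<delta> \<longlonglongrightarrow> \<Delta>\<^sup>2 / (\<epsilon> * sqrt (\<Delta>\<^sup>2))"
    unfolding \<delta>_def using lim \<epsilon> \<Delta>0 by (intro tendsto_intros) auto
  also have "\<Delta>\<^sup>2 / (\<epsilon> * sqrt (\<Delta>\<^sup>2)) = \<Delta> / \<epsilon>" using \<Delta>0 by (simp add: power2_eq_square)
  finally have lim\<delta>: "\<delta> \<longlonglongrightarrow> \<Delta> / \<epsilon>" .
  let ?\<tau> = "\<lambda>n i. real i / real n"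
  define m where "m h n = (\<Sum>i<n. k (?\<tau> n i) * (LBINT x:{?\<tau> n i..?\<tau> n (Suc i)}. h x))" for h n
  define S where "S n y = ((\<Sum>i<n. k (?\<tau> n i) * (y (?\<tau> n (Suc i)) - y (?\<tau> n i))) - m f n) / (\<epsilon> * sqrt (V n))"
    for n and y :: "real \<Rightarrow> real"
  have law: "has_normal_law (observation_law M W \<epsilon> h) (S n) ((m h n - m f n) / (\<epsilon> * sqrt (V n)))"
    if h: "bounded_measurable01 h" and n: "n > 0" "V n > 0" for h n
    unfolding S_def[abs_def] m_def
    by (rule has_normal_law_weighted_increments[OF h \<epsilon>])
      (use n grid_step_set_integral_sum(2)[OF bk n(1)] in \<open>auto simp: V_def divide_strict_right_mono\<close>)
  have mdiff: "m g n - m f n = U n" if n: "n > 0" for n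
  proof -
    have "m g n - m f n = (\<Sum>i<n. k (?\<tau> n i) * (LBINT x:{?\<tau> n i..?\<tau> n (Suc i)}. k x))"
      unfolding m_def sum_subtractf[symmetric] right_diff_distrib[symmetric] k_def
    proof (intro sum.cong arg_cong2[where f = "(*)"] refl)
      fix i assume i: "i \<in> {..<n}"
      have "?\<tau> n (Suc i) \<le> 1" using i n by simp
      then have sub: "{?\<tau> n i..?\<tau> n (Suc i)} \<subseteq> {0..1}"
        unfolding atLeastatMost_subset_iff by (intro disjI2 conjI) simp
      show "(LBINT x:{?\<tau> n i..?\<tau> n (Suc i)}. g x) - (LBINT x:{?\<tau> n i..?\<tau> n (Suc i)}. f x)
          = (LBINT x:{?\<tau> n i..?\<tau> n (Suc i)}. g x - f x)"
        by (rule set_integral_diff(2)[symmetric]) (intro bounded_measurable01_integrable bf bg sub; simp)+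
    qed
    then show ?thesis using grid_step_set_integral_sum(1)[OF bk n] by (simp add: U_def)
  qed
  \<comment> \<open>For some n the sampled weights may all vanish, so a standardised statistic
    exists only eventually.\<close>
  have "eventually (\<lambda>n. V n > 0) sequentially"
    by (rule order_tendstoD(1)[OF lim(2)]) (use \<Delta>0 in simp)
  then have "eventually (\<lambda>n. has_normal_law (observation_law M W \<epsilon> f) (S n) 0 \<and>
        has_normal_law (observation_law M W \<epsilon> g) (S n) (\<delta> n)) sequentially"
    using eventually_gt_at_top[of 0]
  proof eventually_elim
    case (elim n)
    then show ?case using law[OF bf, of n] law[OF bg, of n] mdiff[of n] by (simp add: \<delta>_def)
  qed
  then show thesis using that lim\<delta> unfolding \<Delta>_def by blast
qed

section \<open>Upper bounds for the benchmarks\<close>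

lemma (in brownian_motion01) estimation_benchmark_le:
  assumes f: "f \<in> convex_class" and T: "T = minimizer \<or> T = min_value" and \<epsilon>: "\<epsilon> > 0"
  shows "estimation_benchmark M W T \<epsilon> f \<le> ennreal 1.5 * local_modulus T \<epsilon> f"
  unfolding estimation_benchmark_def
proof (rule SUP_least)
  fix g assume g: "g \<in> convex_class"
  define \<Delta> where "\<Delta> = L2_norm01 (\<lambda>x. f x - g x)"
  define d where "d = \<bar>T f - T g\<bar>"
  let ?I = "INF T_hat\<in>borel_measurable path_space.
      max (estimation_risk M W T \<epsilon> T_hat f) (estimation_risk M W T \<epsilon> T_hat g)"
  show "?I \<le> ennreal 1.5 * local_modulus T \<epsilon> f"
  proof (cases "\<Delta> \<le> \<epsilon>")
    case True
    \<comment> \<open>Within \<epsilon> the data can be ignored: the constant midpoint errs by d/2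
      under both drifts, and d itself is below the modulus.\<close>
    let ?c = "(T f + T g) / 2"
    have risk: "estimation_risk M W T \<epsilon> (\<lambda>_. ?c) h = ennreal (d / 2)" if "h \<in> {f, g}" for h
    proof -
      interpret P: prob_space "observation_law M W \<epsilon> h" by (rule prob_space_observation_law)
      have "\<bar>?c - T h\<bar> = d / 2" using that by (auto simp: d_def abs_if field_simps)
      then show ?thesis
        unfolding estimation_risk_def by (simp only: nn_integral_const P.emeasure_space_1 mult_1_right)
    qed
    have "?I \<le> ennreal (d / 2)"
      by (rule INF_lower2[of "\<lambda>_. ?c"]) (simp_all add: risk)
    also have "\<dots> \<le> ennreal 1.5 * ennreal d"
      by (subst ennreal_mult'[symmetric]) (auto simp: d_def intro!: ennreal_leI)
    also have "\<dots> \<le> ennreal 1.5 * local_modulus T \<epsilon> f"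
      unfolding d_def by (intro mult_left_mono local_modulus_ge g) (use True in \<open>auto simp: \<Delta>_def\<close>)
    finally show ?thesis .
  next
    case False
    then have \<Delta>: "\<Delta> > 0" "\<epsilon> \<le> \<Delta>" using \<epsilon> by auto
    obtain S \<delta> where \<delta>: "\<delta> \<longlonglongrightarrow> \<Delta> / \<epsilon>"
      "eventually (\<lambda>n. has_normal_law (observation_law M W \<epsilon> f) (S n) 0 \<and>
        has_normal_law (observation_law M W \<epsilon> g) (S n) (\<delta> n)) sequentially"
      using normal_statistics_tendsto[OF f g \<epsilon>] \<Delta>(1) unfolding \<Delta>_def by blast
    have "eventually (\<lambda>n. \<delta> n > 0) sequentially"
      by (rule order_tendstoD(1)[OF \<delta>(1)]) (use \<Delta> \<epsilon> in simp)
    \<comment> \<open>\<open>?I\<close> does not depend on n, so the shifts in these bounds may be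
      replaced by their limit.\<close>
    with \<delta>(2) have "eventually (\<lambda>n. ?I \<le> ennreal (d / (2 * \<delta> n))) sequentially"
      by eventually_elim (auto simp: d_def intro: estimation_benchmark_pair_le)
    moreover have "(\<lambda>n. ennreal (d / (2 * \<delta> n))) \<longlonglongrightarrow> ennreal (d / (2 * (\<Delta> / \<epsilon>)))"
      using \<Delta> \<epsilon> by (intro tendsto_ennrealI tendsto_divide[OF tendsto_const tendsto_mult[OF tendsto_const \<delta>(1)]]) auto
    ultimately have "?I \<le> ennreal (d / (2 * (\<Delta> / \<epsilon>)))"
      by (intro tendsto_lowerbound) auto
    \<comment> \<open>The factor 1.5 is the 1/2 of the two-point bound times the 3 that the scaling
      of the modulus costs.\<close>
    also have "d / (2 * (\<Delta> / \<epsilon>)) = 1.5 * (d * \<epsilon> / (3 * \<Delta>))"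
      using \<Delta> \<epsilon> by (simp add: field_simps)
    also have "ennreal \<dots> = ennreal 1.5 * ennreal (d * \<epsilon> / (3 * \<Delta>))"
      by (rule ennreal_mult') simp
    also have "\<dots> \<le> ennreal 1.5 * local_modulus T \<epsilon> f"
      using local_modulus_scaling[OF f g T \<epsilon>] \<Delta>(2) by (intro mult_left_mono) (auto simp: \<Delta>_def d_def)
    finally show ?thesis .
  qed
qed

lemma (in brownian_motion01) inference_benchmark_le:
  assumes f: "f \<in> convex_class" and T: "T = minimizer \<or> T = min_value" and \<epsilon>: "\<epsilon> > 0"
    and \<alpha>: "0 < \<alpha>" "\<alpha> < 0.3"
  shows "inference_benchmark M W T \<alpha> \<epsilon> f
    \<le> ennreal (3 * (1 - 2 * \<alpha>) * normal_quantile \<alpha>) * local_modulus T \<epsilon> f"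
  unfolding inference_benchmark_def
proof (rule SUP_least)
  fix g assume g: "g \<in> convex_class"
  define \<Delta> where "\<Delta> = L2_norm01 (\<lambda>x. f x - g x)"
  define d where "d = \<bar>T f - T g\<bar>"
  define B where "B = 3 * (1 - 2 * \<alpha>) * normal_quantile \<alpha>"
  have B: "1 - 2 * \<alpha> \<le> B" "0 \<le> B"
  proof -
    have "(1 - 2 * \<alpha>) * 1 \<le> (1 - 2 * \<alpha>) * (3 * normal_quantile \<alpha>)"
      using normal_quantile_ge[OF \<alpha>] \<alpha> by (intro mult_left_mono) auto
    then show "1 - 2 * \<alpha> \<le> B" by (simp add: B_def mult_ac)
    then show "0 \<le> B" using \<alpha> by simp
  qed
  let ?I = "INF (l, u)\<in>confidence_intervals M W T \<alpha> \<epsilon> {f, g}.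
      \<integral>\<^sup>+ y. ennreal (u y - l y) \<partial>observation_law M W \<epsilon> f"
  show "?I \<le> ennreal B * local_modulus T \<epsilon> f"
  proof (cases "\<Delta> \<le> \<epsilon>")
    case True
    \<comment> \<open>Here the length bound d (1 - 2 \<alpha>) is enough; it is independent of the
      shift, and any statistic with nonnegative shift yields it.\<close>
    obtain S \<delta> where "\<delta> \<ge> 0" "has_normal_law (observation_law M W \<epsilon> f) S 0"
      "has_normal_law (observation_law M W \<epsilon> g) S \<delta>"
      using ex_normal_statistic[OF convex_class_bounded_measurable[OF f] convex_class_bounded_measurable[OF g] \<epsilon>]
      by blast
    then have "?I \<le> ennreal (d * (1 - 2 * \<alpha>))"
      unfolding d_def using \<alpha> by (intro inference_benchmark_pair_le(1))
    also have "\<dots> \<le> ennreal (B * d)"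
      using B by (subst mult.commute) (auto simp: d_def intro!: ennreal_leI mult_right_mono)
    also have "\<dots> = ennreal B * ennreal d" using B by (simp add: ennreal_mult')
    also have "\<dots> \<le> ennreal B * local_modulus T \<epsilon> f"
      unfolding d_def by (intro mult_left_mono local_modulus_ge g) (use True in \<open>auto simp: \<Delta>_def\<close>)
    finally show ?thesis .
  next
    case False
    then have \<Delta>: "\<Delta> > 0" "\<epsilon> \<le> \<Delta>" using \<epsilon> by auto
    obtain S \<delta> where \<delta>: "\<delta> \<longlonglongrightarrow> \<Delta> / \<epsilon>"
      "eventually (\<lambda>n. has_normal_law (observation_law M W \<epsilon> f) (S n) 0 \<and>
        has_normal_law (observation_law M W \<epsilon> g) (S n) (\<delta> n)) sequentially"
      using normal_statistics_tendsto[OF f g \<epsilon>] \<Delta>(1) unfolding \<Delta>_def by blast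
    let ?q = "normal_quantile \<alpha> * (1 - 2 * \<alpha>)"
    have "eventually (\<lambda>n. \<delta> n > 0) sequentially"
      by (rule order_tendstoD(1)[OF \<delta>(1)]) (use \<Delta> \<epsilon> in simp)
    with \<delta>(2) have "eventually (\<lambda>n. ?I \<le> ennreal (d * (?q / \<delta> n))) sequentially"
    proof eventually_elim
      case (elim n)
      then show ?case
        using inference_benchmark_pair_le(2)[of \<epsilon> f "S n" g "\<delta> n" \<alpha> T] \<alpha> by (simp add: d_def)
    qed
    moreover have "(\<lambda>n. ennreal (d * (?q / \<delta> n))) \<longlonglongrightarrow> ennreal (d * (?q / (\<Delta> / \<epsilon>)))"
      using \<Delta> \<epsilon> by (intro tendsto_ennrealI tendsto_mult[OF tendsto_const tendsto_divide[OF tendsto_const \<delta>(1)]]) auto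
    ultimately have "?I \<le> ennreal (d * (?q / (\<Delta> / \<epsilon>)))"
      by (intro tendsto_lowerbound) auto
    also have "d * (?q / (\<Delta> / \<epsilon>)) = B * (d * \<epsilon> / (3 * \<Delta>))"
      using \<Delta> \<epsilon> by (simp add: B_def field_simps)
    also have "ennreal \<dots> = ennreal B * ennreal (d * \<epsilon> / (3 * \<Delta>))"
      using B by (intro ennreal_mult')
    also have "\<dots> \<le> ennreal B * local_modulus T \<epsilon> f"
      using local_modulus_scaling[OF f g T \<epsilon>] \<Delta>(2) by (intro mult_left_mono) (auto simp: \<Delta>_def d_def)
    finally show ?thesis .
  qed
qed

section \<open>Error of tests and lower bounds\<close>

text \<open>A product measure is determined by its values on boxes, and there the integral of the
  ratio factorises into one-dimensional integrals in which p cancels.\<close>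

lemma PiM_density_ratio:
  fixes p q :: "'i \<Rightarrow> real \<Rightarrow> real"
  assumes I: "finite I"
    and p: "\<And>i. p i \<in> borel_measurable borel" "\<And>i x. p i x > 0" "\<And>i. prob_space (density lborel (p i))"
    and q: "\<And>i. q i \<in> borel_measurable borel" "\<And>i x. q i x > 0" "\<And>i. prob_space (density lborel (q i))"
  shows "PiM I (\<lambda>i. density lborel (q i))
    = density (PiM I (\<lambda>i. density lborel (p i))) (\<lambda>x. ennreal (\<Prod>i\<in>I. q i (x i) / p i (x i)))"
proof -
  interpret P: product_sigma_finite "\<lambda>i. density lborel (p i)"
    by (intro product_sigma_finite.intro prob_space_imp_sigma_finite p)
  interpret Q: product_sigma_finite "\<lambda>i. density lborel (q i)"
    by (intro product_sigma_finite.intro prob_space_imp_sigma_finite q)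
  note [measurable] = p(1) q(1)
  let ?r = "\<lambda>i x. q i x / p i x"
  have r: "?r i \<in> borel_measurable borel" for i by measurable
  have sets_eq: "sets (PiM I (\<lambda>i. density lborel (p i))) = sets (PiM I (\<lambda>i. density lborel (q i)))"
    by (intro sets_PiM_cong) auto
  have meas: "(\<lambda>x. ennreal (\<Prod>i\<in>I. ?r i (x i))) \<in> borel_measurable (PiM I (\<lambda>i. density lborel (p i)))"
  proof -
    have "(\<lambda>x. ?r i (x i)) \<in> borel_measurable (PiM I (\<lambda>i. density lborel (p i)))" if "i \<in> I" for i
      by (rule measurable_compose[OF measurable_component_singleton[OF that]]) (use r[of i] in simp)
    then show ?thesis by (intro measurable_compose[OF _ measurable_ennreal] borel_measurable_prod)
  qed
  have "density (PiM I (\<lambda>i. density lborel (p i))) (\<lambda>x. ennreal (\<Prod>i\<in>I. ?r i (x i)))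
      = PiM I (\<lambda>i. density lborel (q i))"
  proof (rule Q.PiM_eqI[OF I])
    show "sets (density (PiM I (\<lambda>i. density lborel (p i))) (\<lambda>x. ennreal (\<Prod>i\<in>I. ?r i (x i))))
        = sets (PiM I (\<lambda>i. density lborel (q i)))"
      using sets_eq by simp
    fix A assume "\<And>i. i \<in> I \<Longrightarrow> A i \<in> sets (density lborel (q i))"
    then have A: "A i \<in> sets borel" if "i \<in> I" for i using that by simp
    have PA: "Pi\<^sub>E I A \<in> sets (PiM I (\<lambda>i. density lborel (p i)))"
      using A I by (intro sets_PiM_I_finite) auto
    have "emeasure (density (PiM I (\<lambda>i. density lborel (p i))) (\<lambda>x. ennreal (\<Prod>i\<in>I. ?r i (x i)))) (Pi\<^sub>E I A)
        = (\<integral>\<^sup>+x. ennreal (\<Prod>i\<in>I. ?r i (x i)) * indicator (Pi\<^sub>E I A) x \<partial>PiM I (\<lambda>i. density lborel (p i)))"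
      by (rule emeasure_density[OF meas PA])
    also have "\<dots> = (\<integral>\<^sup>+x. (\<Prod>i\<in>I. ennreal (?r i (x i)) * indicator (A i) (x i)) \<partial>PiM I (\<lambda>i. density lborel (p i)))"
    proof (intro nn_integral_cong)
      fix x assume "x \<in> space (PiM I (\<lambda>i. density lborel (p i)))"
      then have ext: "x \<in> extensional I" by (auto simp: space_PiM PiE_def)
      have "(indicator (Pi\<^sub>E I A) x :: ennreal) = (\<Prod>i\<in>I. indicator (A i) (x i))"
        using I ext by (auto simp: indicator_def PiE_def Pi_iff prod_zero)
      moreover have "ennreal (\<Prod>i\<in>I. ?r i (x i)) = (\<Prod>i\<in>I. ennreal (?r i (x i)))"
        using p(2) q(2) by (subst prod_ennreal) (auto simp: less_imp_le)
      ultimately show "ennreal (\<Prod>i\<in>I. ?r i (x i)) * indicator (Pi\<^sub>E I A) x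
          = (\<Prod>i\<in>I. ennreal (?r i (x i)) * indicator (A i) (x i))"
        by (simp add: prod.distrib)
    qed
    also have "\<dots> = (\<Prod>i\<in>I. \<integral>\<^sup>+x. ennreal (?r i x) * indicator (A i) x \<partial>density lborel (p i))"
    proof (rule P.product_nn_integral_prod[OF I])
      fix i assume "i \<in> I"
      note [measurable] = A[OF this]
      show "(\<lambda>x. ennreal (?r i x) * indicator (A i) x) \<in> borel_measurable (density lborel (\<lambda>x. ennreal (p i x)))"
        by measurable
    qed
    also have "\<dots> = (\<Prod>i\<in>I. emeasure (density lborel (q i)) (A i))"
    proof (intro prod.cong refl)
      fix i assume i: "i \<in> I"
      note [measurable] = A[OF this]
      have "(\<integral>\<^sup>+x. ennreal (?r i x) * indicator (A i) x \<partial>density lborel (p i))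
          = (\<integral>\<^sup>+x. ennreal (p i x) * (ennreal (?r i x) * indicator (A i) x) \<partial>lborel)"
        by (rule nn_integral_density) measurable
      also have "\<dots> = (\<integral>\<^sup>+x. ennreal (q i x) * indicator (A i) x \<partial>lborel)"
      proof (intro nn_integral_cong)
        fix x
        have "ennreal (p i x) * ennreal (?r i x) = ennreal (q i x)"
          using p(2)[of i x] q(2)[of i x] by (simp add: ennreal_mult'[symmetric])
        then show "ennreal (p i x) * (ennreal (?r i x) * indicator (A i) x) = ennreal (q i x) * indicator (A i) x"
          by (simp add: mult.assoc[symmetric])
      qed
      also have "\<dots> = emeasure (density lborel (q i)) (A i)"
        using A[OF i] by (subst emeasure_density) auto
      finally show "(\<integral>\<^sup>+x. ennreal (?r i x) * indicator (A i) x \<partial>density lborel (p i))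
          = emeasure (density lborel (q i)) (A i)" .
    qed
    finally show "emeasure (density (PiM I (\<lambda>i. density lborel (p i))) (\<lambda>x. ennreal (\<Prod>i\<in>I. ?r i (x i)))) (Pi\<^sub>E I A)
        = (\<Prod>i\<in>I. emeasure (density lborel (q i)) (A i))" .
  qed
  then show ?thesis by simp
qed

text \<open>Each error sum is an integral over P of 1 on the event and L off it. The event L \<ge> 1
  makes the integrand min(1, L), pointwise the smallest possible.\<close>

lemma neyman_pearson:
  assumes L [measurable]: "L \<in> borel_measurable P" and B [measurable]: "B \<in> sets P"
  shows "emeasure P {x \<in> space P. 1 \<le> L x} + emeasure (density P L) {x \<in> space P. L x < 1}
    \<le> emeasure P B + emeasure (density P L) (space P - B)"
proof -
  have split: "emeasure P A + emeasure (density P L) (space P - A)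
      = (\<integral>\<^sup>+x. indicator A x + L x * indicator (space P - A) x \<partial>P)" if [measurable]: "A \<in> sets P" for A
    by (subst nn_integral_add) (auto simp: emeasure_density)
  have "emeasure P {x \<in> space P. 1 \<le> L x} + emeasure (density P L) {x \<in> space P. L x < 1}
      = emeasure P {x \<in> space P. 1 \<le> L x} + emeasure (density P L) (space P - {x \<in> space P. 1 \<le> L x})"
    by (intro arg_cong2[where f = "(+)"] arg_cong2[where f = emeasure] refl) auto
  also have "\<dots> = (\<integral>\<^sup>+x. indicator {x \<in> space P. 1 \<le> L x} x
      + L x * indicator (space P - {x \<in> space P. 1 \<le> L x}) x \<partial>P)"
    by (rule split) measurable
  also have "\<dots> \<le> (\<integral>\<^sup>+x. indicator B x + L x * indicator (space P - B) x \<partial>P)"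
    by (intro nn_integral_mono) (auto simp: indicator_def)
  also have "\<dots> = emeasure P B + emeasure (density P L) (space P - B)"
    by (rule split[symmetric]) measurable
  finally show ?thesis .
qed

text \<open>The integral of (k - c)^2 is nonnegative; with c the mean of k over the interval,
  expanding it gives the inequality.\<close>

lemma set_integral_power2_le:
  assumes k: "bounded_measurable01 k" and st: "0 \<le> s" "s < t" "t \<le> 1"
  shows "(LBINT x:{s..t}. k x)\<^sup>2 \<le> (t - s) * (LBINT x:{s..t}. (k x)\<^sup>2)"
proof -
  define a where "a = (LBINT x:{s..t}. k x)"
  define c where "c = a / (t - s)"
  have i: "set_integrable lborel {s..t} h" if "bounded_measurable01 h" for h
    by (rule bounded_measurable01_integrable[OF that]) (use st in auto)
  have c1: "(LBINT x:{s..t}. c') = c' * (t - s)" for c'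
    using st by (simp add: set_lebesgue_integral_def)
  have "0 \<le> (LBINT x:{s..t}. (k x - c)\<^sup>2)"
    unfolding set_lebesgue_integral_def by (intro Bochner_Integration.integral_nonneg) auto
  also have "(LBINT x:{s..t}. (k x - c)\<^sup>2) = (LBINT x:{s..t}. ((k x)\<^sup>2 - (2 * c) * k x) + c\<^sup>2)"
    by (intro arg_cong[where f = "\<lambda>h. LBINT x:{s..t}. h x"])
      (auto simp: power2_eq_square algebra_simps)
  also have "\<dots> = (LBINT x:{s..t}. (k x)\<^sup>2 - (2 * c) * k x) + (LBINT x:{s..t}. c\<^sup>2)"
    by (intro set_integral_add(2) i bounded_measurable01_intros bounded_measurable01_power2
        bounded_measurable01_const k)
  also have "(LBINT x:{s..t}. (k x)\<^sup>2 - (2 * c) * k x)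
      = (LBINT x:{s..t}. (k x)\<^sup>2) - (LBINT x:{s..t}. (2 * c) * k x)"
    by (intro set_integral_diff(2) i bounded_measurable01_intros bounded_measurable01_power2
        bounded_measurable01_const k)
  also have "(LBINT x:{s..t}. (2 * c) * k x) = 2 * c * a"
    by (simp add: a_def)
  also have "(LBINT x:{s..t}. (k x)\<^sup>2) - 2 * c * a + (LBINT x:{s..t}. c\<^sup>2) = (LBINT x:{s..t}. (k x)\<^sup>2) - a\<^sup>2 / (t - s)"
  proof -
    have ct: "c * (t - s) = a" using st by (simp add: c_def)
    have "c\<^sup>2 * (t - s) = c * a" by (simp only: power2_eq_square mult.assoc ct)
    moreover have "a\<^sup>2 / (t - s) = c * a" by (simp add: c_def power2_eq_square)
    ultimately show ?thesis unfolding c1 by simp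
  qed
  finally show ?thesis using st by (simp add: a_def field_simps)
qed

definition path_increments :: "(nat \<Rightarrow> real) \<Rightarrow> nat \<Rightarrow> (real \<Rightarrow> real) \<Rightarrow> nat \<Rightarrow> real" where
  "path_increments \<tau> n y = (\<lambda>i\<in>{..<n}. y (\<tau> (Suc i)) - y (\<tau> i))"

lemma path_increments_measurable:
  assumes "\<And>i. i \<le> n \<Longrightarrow> \<tau> i \<in> {0..1}"
  shows "path_increments \<tau> n \<in> measurable path_space (PiM {..<n} (\<lambda>_. borel))"
  unfolding path_increments_def
  using assms by (intro measurable_restrict borel_measurable_diff measurable_component_singleton) auto

lemma (in brownian_motion01) distr_path_increments:
  assumes h: "bounded_measurable01 h" and \<epsilon>: "\<epsilon> > 0" and n: "n > 0"
    and \<tau>: "\<And>i. i \<le> n \<Longrightarrow> \<tau> i \<in> {0..1}" "\<And>i. i < n \<Longrightarrow> \<tau> i < \<tau> (Suc i)"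
  shows "distr (observation_law M W \<epsilon> h) (PiM {..<n} (\<lambda>_. borel)) (path_increments \<tau> n)
    = PiM {..<n} (\<lambda>i. density lborel
        (normal_density (LBINT x:{\<tau> i..\<tau> (Suc i)}. h x) (\<epsilon> * sqrt (\<tau> (Suc i) - \<tau> i))))"
proof -
  define X where "X i \<omega> = (LBINT x:{\<tau> i..\<tau> (Suc i)}. h x) + \<epsilon> * (W (\<tau> (Suc i)) \<omega> - W (\<tau> i) \<omega>)" for i \<omega>
  have path: "path_increments \<tau> n (observed_path W \<epsilon> h \<omega>) = (\<lambda>i\<in>{..<n}. X i \<omega>)" for \<omega>
  proof (rule ext)
    fix i
    show "path_increments \<tau> n (observed_path W \<epsilon> h \<omega>) i = (\<lambda>i\<in>{..<n}. X i \<omega>) i"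
    proof (cases "i < n")
      case True
      then show ?thesis
        using \<tau>(1)[of i] \<tau>(1)[of "Suc i"] \<tau>(2)[of i] set_integral_interval_diff[OF h, of "\<tau> i" "\<tau> (Suc i)"]
        by (simp add: path_increments_def observed_path_def X_def algebra_simps)
    qed (simp add: path_increments_def)
  qed
  have "indep_vars (\<lambda>_. borel) (\<lambda>i \<omega>. W (\<tau> (Suc i)) \<omega> - W (\<tau> i) \<omega>) {..<n}"
    by (rule indep_increments) (use \<tau>(1)[of 0] \<tau>(1)[of n] \<tau>(2) less_imp_le in auto)
  then have ind: "indep_vars (\<lambda>_. borel) X {..<n}"
    unfolding X_def[abs_def] by (rule indep_vars_compose2) measurable
  have dX: "distributed M lborel (X i)
      (normal_density (LBINT x:{\<tau> i..\<tau> (Suc i)}. h x) (\<epsilon> * sqrt (\<tau> (Suc i) - \<tau> i)))" if "i < n" for i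
  proof -
    have "distributed M lborel (\<lambda>\<omega>. W (\<tau> (Suc i)) \<omega> - W (\<tau> i) \<omega>)
        (normal_density 0 (sqrt (\<tau> (Suc i) - \<tau> i)))"
      using that \<tau>(1)[of i] \<tau>(1)[of "Suc i"] \<tau>(2)[of i] by (intro normal_increments) auto
    from normal_density_affine[OF this, of \<epsilon> "LBINT x:{\<tau> i..\<tau> (Suc i)}. h x"] that \<tau> \<epsilon>
    show ?thesis by (simp add: X_def[abs_def])
  qed
  have "distr (observation_law M W \<epsilon> h) (PiM {..<n} (\<lambda>_. borel)) (path_increments \<tau> n)
      = distr M (PiM {..<n} (\<lambda>_. borel)) (\<lambda>\<omega>. path_increments \<tau> n (observed_path W \<epsilon> h \<omega>))"
    unfolding observation_law_def using path_increments_measurable[OF \<tau>(1)]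
    by (subst distr_distr) (auto simp: comp_def)
  also have "\<dots> = distr M (PiM {..<n} (\<lambda>_. borel)) (\<lambda>\<omega>. \<lambda>i\<in>{..<n}. X i \<omega>)"
    by (simp only: path)
  also have "\<dots> = PiM {..<n} (\<lambda>i. distr M borel (X i))"
    using ind n by (subst indep_vars_iff_distr_eq_PiM'[symmetric]) (auto simp: indep_vars_def)
  also have "\<dots> = PiM {..<n} (\<lambda>i. density lborel
        (normal_density (LBINT x:{\<tau> i..\<tau> (Suc i)}. h x) (\<epsilon> * sqrt (\<tau> (Suc i) - \<tau> i))))"
  proof (intro PiM_cong refl)
    fix i assume "i \<in> {..<n}"
    then have "distr M lborel (X i) = density lborel
        (normal_density (LBINT x:{\<tau> i..\<tau> (Suc i)}. h x) (\<epsilon> * sqrt (\<tau> (Suc i) - \<tau> i)))"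
      using dX[of i] by (intro distributed_distr_eq_density) auto
    moreover have "distr M borel (X i) = distr M lborel (X i)" by (intro distr_cong) auto
    ultimately show "distr M borel (X i) = density lborel
        (normal_density (LBINT x:{\<tau> i..\<tau> (Suc i)}. h x) (\<epsilon> * sqrt (\<tau> (Suc i) - \<tau> i)))" by simp
  qed
  finally show ?thesis .
qed

text \<open>Equal variances cancel the quadratic terms. The log-likelihood ratio is affine, so the
  optimal test is a threshold on a weighted sum of increments.\<close>

lemma ln_normal_density_ratio:
  assumes "\<sigma> > 0"
  shows "ln (normal_density b \<sigma> x / normal_density a \<sigma> x) = (b - a) / \<sigma>\<^sup>2 * (x - (a + b) / 2)"
proof -
  have "normal_density b \<sigma> x / normal_density a \<sigma> x = exp (- (x - b)\<^sup>2 / (2 * \<sigma>\<^sup>2)) / exp (- (x - a)\<^sup>2 / (2 * \<sigma>\<^sup>2))"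
    using assms by (simp add: normal_density_def)
  also have "\<dots> = exp (- (x - b)\<^sup>2 / (2 * \<sigma>\<^sup>2) - - (x - a)\<^sup>2 / (2 * \<sigma>\<^sup>2))"
    by (rule exp_diff[symmetric])
  finally have "ln (normal_density b \<sigma> x / normal_density a \<sigma> x) = - (x - b)\<^sup>2 / (2 * \<sigma>\<^sup>2) - - (x - a)\<^sup>2 / (2 * \<sigma>\<^sup>2)"
    by simp
  also have "\<dots> = (b - a) / \<sigma>\<^sup>2 * (x - (a + b) / 2)"
    using assms by (simp add: power2_eq_square field_simps)
  finally show ?thesis .
qed

text \<open>By Neyman-Pearson it suffices to treat the test L \<ge> 1. For V > 0 its standardised
  statistic has shifts -\<epsilon> sqrt V / 2 and \<epsilon> sqrt V / 2 under the two drifts, so its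
  error sum is exactly 2 \<Phi>(-\<epsilon> sqrt V / 2). Cauchy-Schwarz on each cell gives
  \<epsilon> sqrt V \<le> \<delta>.\<close>

lemma (in brownian_motion01) path_increments_test_error_ge:
  assumes f: "bounded_measurable01 f" and g: "bounded_measurable01 g" and \<epsilon>: "\<epsilon> > 0" and n: "n > 0"
    and \<tau>: "\<And>i. i \<le> n \<Longrightarrow> \<tau> i \<in> {0..1}" "\<And>i. i < n \<Longrightarrow> \<tau> i < \<tau> (Suc i)"
    and B: "B \<in> sets (PiM {..<n} (\<lambda>_. borel))"
    and \<delta>: "L2_norm01 (\<lambda>x. f x - g x) \<le> \<delta> * \<epsilon>"
  shows "2 * std_normal_cdf (- \<delta> / 2)
    \<le> measure (observation_law M W \<epsilon> f) {y \<in> space path_space. path_increments \<tau> n y \<in> B}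
      + measure (observation_law M W \<epsilon> g) {y \<in> space path_space. path_increments \<tau> n y \<notin> B}"
proof -
  let ?P = "\<lambda>h. observation_law M W \<epsilon> h" and ?X = "path_increments \<tau> n" and ?K = "PiM {..<n} (\<lambda>_::nat. borel :: real measure)"
  define s where "s i = \<tau> (Suc i) - \<tau> i" for i
  \<comment> \<open>The dummy value 1 beyond the last cell keeps every member of the family a proper
    normal density, as \<open>PiM_density_ratio\<close> asks of all indices.\<close>
  define \<sigma> where "\<sigma> i = (if i < n then \<epsilon> * sqrt (s i) else 1)" for i
  define m where "m h i = (LBINT x:{\<tau> i..\<tau> (Suc i)}. h x)" for h :: "real \<Rightarrow> real" and i
  have s: "s i > 0" if "i < n" for i using \<tau>(2)[OF that] by (simp add: s_def)
  have \<sigma>: "\<sigma> i > 0" for i using s \<epsilon> by (simp add: \<sigma>_def)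
  have X: "?X \<in> measurable path_space ?K" by (rule path_increments_measurable) (rule \<tau>(1))
  have D: "distr (?P h) ?K ?X = PiM {..<n} (\<lambda>i. density lborel (normal_density (m h i) (\<sigma> i)))"
    if h: "bounded_measurable01 h" for h
  proof -
    have "distr (?P h) ?K ?X = PiM {..<n} (\<lambda>i. density lborel
        (normal_density (LBINT x:{\<tau> i..\<tau> (Suc i)}. h x) (\<epsilon> * sqrt (\<tau> (Suc i) - \<tau> i))))"
      by (rule distr_path_increments[OF h \<epsilon> n]) (use \<tau> in auto)
    also have "\<dots> = PiM {..<n} (\<lambda>i. density lborel (normal_density (m h i) (\<sigma> i)))"
      by (intro PiM_cong) (auto simp: m_def \<sigma>_def s_def)
    finally show ?thesis .
  qed
  define L where "L v = (\<Prod>i<n. normal_density (m g i) (\<sigma> i) (v i) / normal_density (m f i) (\<sigma> i) (v i))"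
    for v :: "nat \<Rightarrow> real"
  have Dg: "distr (?P g) ?K ?X = density (distr (?P f) ?K ?X) L"
    unfolding D[OF f] D[OF g] L_def
    by (rule PiM_density_ratio) (auto simp: \<sigma> normal_density_pos prob_space_normal_density)
  define w where "w i = (m g i - m f i) / (\<sigma> i)\<^sup>2" for i
  \<comment> \<open>The weighted sum evaluated halfway between the two mean vectors; the threshold
    is therefore symmetric and both errors come out equal.\<close>
  define c where "c = (\<Sum>i<n. w i * ((m f i + m g i) / 2))"
  have L1: "1 \<le> L v \<longleftrightarrow> c \<le> (\<Sum>i<n. w i * v i)" for v
  proof -
    have pos: "normal_density (m g i) (\<sigma> i) (v i) / normal_density (m f i) (\<sigma> i) (v i) > 0" for i
      using \<sigma> by (simp add: normal_density_pos)
    then have "L v > 0" unfolding L_def by (intro prod_pos) auto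
    then have "1 \<le> L v \<longleftrightarrow> 0 \<le> ln (L v)" by simp
    also have "ln (L v) = (\<Sum>i<n. ln (normal_density (m g i) (\<sigma> i) (v i) / normal_density (m f i) (\<sigma> i) (v i)))"
      unfolding L_def by (rule ln_prod) (simp_all add: normal_density_pos[OF \<sigma>] less_imp_neq[OF normal_density_pos[OF \<sigma>], symmetric])
    also have "\<dots> = (\<Sum>i<n. w i * v i) - c"
      unfolding c_def sum_subtractf[symmetric] w_def
      by (intro sum.cong refl) (simp only: ln_normal_density_ratio[OF \<sigma>] right_diff_distrib)
    finally show ?thesis by simp
  qed
  have LK: "L \<in> borel_measurable ?K"
    unfolding L_def
    by (intro borel_measurable_prod borel_measurable_divide measurable_compose[OF _ borel_measurable_normal_density]
        measurable_component_singleton) auto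
  have lin: "(\<Sum>i<n. w i * ?X y i) = (\<Sum>i<n. w i * (y (\<tau> (Suc i)) - y (\<tau> i)))" for y
    by (intro sum.cong) (auto simp: path_increments_def)
  let ?A = "{y \<in> space path_space. c \<le> (\<Sum>i<n. w i * (y (\<tau> (Suc i)) - y (\<tau> i)))}"
  let ?A' = "{y \<in> space path_space. (\<Sum>i<n. w i * (y (\<tau> (Suc i)) - y (\<tau> i))) < c}"
  interpret F: prob_space "?P f" by (rule prob_space_observation_law)
  interpret G: prob_space "?P g" by (rule prob_space_observation_law)
  have dist: "emeasure (distr (?P h) ?K ?X) C = emeasure (?P h) {y \<in> space path_space. ?X y \<in> C}"
    if "C \<in> sets ?K" for C h
    using X that by (subst emeasure_distr) (auto simp: vimage_def Int_def conj_commute cong: measurable_cong_sets)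
  have inK: "?X y \<in> space ?K" if "y \<in> space path_space" for y
    using measurable_space[OF X that] .
  have sK: "{v \<in> space ?K. 1 \<le> L v} \<in> sets ?K" "{v \<in> space ?K. L v < 1} \<in> sets ?K" "space ?K - B \<in> sets ?K"
    using LK B by measurable
  have "emeasure (?P f) ?A + emeasure (?P g) ?A'
      = emeasure (distr (?P f) ?K ?X) {v \<in> space ?K. 1 \<le> L v} + emeasure (distr (?P g) ?K ?X) {v \<in> space ?K. L v < 1}"
  proof -
    have "?A = {y \<in> space path_space. ?X y \<in> {v \<in> space ?K. 1 \<le> L v}}"
      using inK by (auto simp: L1 lin)
    moreover have "?A' = {y \<in> space path_space. ?X y \<in> {v \<in> space ?K. L v < 1}}"
      using inK by (auto simp: L1 lin not_le[symmetric])
    ultimately show ?thesis unfolding dist[OF sK(1)] dist[OF sK(2)] by (simp only:)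
  qed
  also have "\<dots> \<le> emeasure (distr (?P f) ?K ?X) B + emeasure (distr (?P g) ?K ?X) (space ?K - B)"
    unfolding Dg using neyman_pearson[of "\<lambda>v. ennreal (L v)" "distr (?P f) ?K ?X" B] LK B
    by (simp add: space_PiM)
  also have "\<dots> = emeasure (?P f) {y \<in> space path_space. ?X y \<in> B} + emeasure (?P g) {y \<in> space path_space. ?X y \<notin> B}"
    unfolding dist[OF B] dist[OF sK(3)]
    by (intro arg_cong2[where f = "(+)"] arg_cong2[where f = emeasure] refl) (use inK in auto)
  finally have NP: "measure (?P f) ?A + measure (?P g) ?A'
      \<le> measure (?P f) {y \<in> space path_space. ?X y \<in> B} + measure (?P g) {y \<in> space path_space. ?X y \<notin> B}"
    unfolding F.emeasure_eq_measure G.emeasure_eq_measure by (simp flip: ennreal_plus)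
  have "2 * std_normal_cdf (- \<delta> / 2) \<le> measure (?P f) ?A + measure (?P g) ?A'"
  proof -
    \<comment> \<open>\<open>\<epsilon> * sqrt V\<close> is the standardised separation: its square
      is the sum over the cells of squared mean differences divided by variances.\<close>
    define V where "V = (\<Sum>i<n. (w i)\<^sup>2 * s i)"
    have V0: "V \<ge> 0" unfolding V_def using s by (intro sum_nonneg) (auto simp: less_imp_le)
    have k: "bounded_measurable01 (\<lambda>x. f x - g x)" by (intro bounded_measurable01_intros f g)
    have mk: "m g i - m f i = - (LBINT x:{\<tau> i..\<tau> (Suc i)}. f x - g x)" if "i < n" for i
    proof -
      have sub: "{\<tau> i..\<tau> (Suc i)} \<subseteq> {0..1}" using \<tau>(1)[of i] \<tau>(1)[of "Suc i"] that by auto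
      have "(LBINT x:{\<tau> i..\<tau> (Suc i)}. f x - g x) = m f i - m g i"
        unfolding m_def by (rule set_integral_diff(2)) (intro bounded_measurable01_integrable f g sub; simp)+
      then show ?thesis by simp
    qed
    have wV: "(\<Sum>i<n. w i * (m g i - m f i)) = \<epsilon>\<^sup>2 * V"
      unfolding V_def sum_distrib_left
    proof (intro sum.cong refl)
      fix i assume "i \<in> {..<n}"
      then have i: "i < n" by simp
      have "(\<sigma> i)\<^sup>2 = \<epsilon>\<^sup>2 * s i" using i s[OF i] by (simp add: \<sigma>_def power_mult_distrib)
      then show "w i * (m g i - m f i) = \<epsilon>\<^sup>2 * ((w i)\<^sup>2 * s i)"
        using \<epsilon> s[OF i] by (simp add: w_def power2_eq_square)
    qed
    have "\<epsilon>\<^sup>2 * (\<epsilon>\<^sup>2 * V) \<le> (\<Sum>i<n. LBINT x:{\<tau> i..\<tau> (Suc i)}. (f x - g x)\<^sup>2)"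
      unfolding wV[symmetric] sum_distrib_left
    proof (intro sum_mono)
      fix i assume "i \<in> {..<n}"
      then have i: "i < n" by simp
      have "(m g i - m f i)\<^sup>2 \<le> s i * (LBINT x:{\<tau> i..\<tau> (Suc i)}. (f x - g x)\<^sup>2)"
        unfolding mk[OF i] power2_minus s_def
        using \<tau>(1)[of i] \<tau>(1)[of "Suc i"] \<tau>(2)[OF i] i by (intro set_integral_power2_le k) auto
      then have "(m g i - m f i)\<^sup>2 / s i \<le> (LBINT x:{\<tau> i..\<tau> (Suc i)}. (f x - g x)\<^sup>2)"
        using s[OF i] by (simp add: field_simps)
      moreover have "(\<sigma> i)\<^sup>2 = \<epsilon>\<^sup>2 * s i" using i s[OF i] by (simp add: \<sigma>_def power_mult_distrib)
      ultimately show "\<epsilon>\<^sup>2 * (w i * (m g i - m f i)) \<le> (LBINT x:{\<tau> i..\<tau> (Suc i)}. (f x - g x)\<^sup>2)"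
        using \<epsilon> by (simp add: w_def power2_eq_square)
    qed
    also have "\<dots> = (LBINT x:{\<tau> 0..\<tau> n}. (f x - g x)\<^sup>2)"
      using \<tau>(1)[of 0] \<tau>(1)[of n] \<tau>(2)
      by (intro set_integral_interval_sum bounded_measurable01_power2 k) (auto simp: less_imp_le)
    also have "\<dots> \<le> (LBINT x:{0..1}. (f x - g x)\<^sup>2)"
    proof -
      have sub: "{\<tau> 0..\<tau> n} \<subseteq> {0..1}" using \<tau>(1)[of 0] \<tau>(1)[of n] by auto
      have "set_integrable lborel {\<tau> 0..\<tau> n} (\<lambda>x. (f x - g x)\<^sup>2)" "set_integrable lborel {0..1} (\<lambda>x. (f x - g x)\<^sup>2)"
        by (rule bounded_measurable01_integrable[OF bounded_measurable01_power2[OF k]]; use sub in simp)+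
      then show ?thesis
        unfolding set_lebesgue_integral_def set_integrable_def
        by (intro integral_mono) (use sub in \<open>auto simp: indicator_def\<close>)
    qed
    also have "\<dots> \<le> (\<delta> * \<epsilon>)\<^sup>2"
      unfolding L2_norm01_power2[symmetric] by (rule power_mono[OF \<delta>]) simp
    finally have "\<epsilon>\<^sup>2 * (\<epsilon>\<^sup>2 * V) \<le> \<epsilon>\<^sup>2 * \<delta>\<^sup>2" by (simp add: power_mult_distrib mult.commute)
    then have "\<epsilon>\<^sup>2 * V \<le> \<delta>\<^sup>2" by (rule mult_left_le_imp_le) (use \<epsilon> in simp)
    then have "(\<epsilon> * sqrt V)\<^sup>2 \<le> \<delta>\<^sup>2" using V0 by (simp add: power_mult_distrib)
    moreover have "\<delta> \<ge> 0"
      using \<delta> \<epsilon> order_trans[OF L2_norm01_nonneg \<delta>] by (simp add: zero_le_mult_iff)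
    ultimately have \<delta>V: "\<epsilon> * sqrt V \<le> \<delta>" by (rule power2_le_imp_le)
    show ?thesis
    proof (cases "V = 0")
      \<comment> \<open>All means agree, so the statistic is degenerate and the test accepts
        \<open>?A\<close> everywhere; the error sum is then at least 1, which exceeds 2
        \<Phi>(-\<delta>/2) or equals it.\<close>
      case True
      then have "\<forall>i\<in>{..<n}. (w i)\<^sup>2 * s i = 0"
        unfolding V_def by (subst (asm) sum_nonneg_eq_0_iff) (auto simp: less_imp_le s)
      then have "w i = 0" if "i < n" for i
        using that s[OF that] by force
      then have "?A = space path_space" by (simp add: c_def)
      then have "measure (?P f) ?A = 1" using F.prob_space by simp
      moreover have "std_normal_cdf (- \<delta> / 2) \<le> 1 / 2"
        using std_normal_cdf_mono[of "- \<delta> / 2" 0] \<open>\<delta> \<ge> 0\<close> by (simp add: std_normal_cdf_0)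
      ultimately show ?thesis using measure_nonneg[of "?P g" ?A'] by linarith
    next
      case False
      then have V: "V > 0" using V0 by simp
      let ?S = "\<lambda>y. ((\<Sum>i<n. w i * (y (\<tau> (Suc i)) - y (\<tau> i))) - c) / (\<epsilon> * sqrt V)"
      have law: "has_normal_law (?P h) ?S (((\<Sum>i<n. w i * m h i) - c) / (\<epsilon> * sqrt V))"
        if "bounded_measurable01 h" for h
        unfolding m_def
        by (rule has_normal_law_weighted_increments[OF that \<epsilon>])
          (use \<tau>(1)[of 0] \<tau>(1)[of n] \<tau>(2) V in \<open>auto simp: V_def s_def\<close>)
      have "(\<Sum>i<n. w i * m f i) - c = - (\<epsilon>\<^sup>2 * V) / 2" "(\<Sum>i<n. w i * m g i) - c = \<epsilon>\<^sup>2 * V / 2"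
        unfolding wV[symmetric] c_def
        by (simp_all add: sum_subtractf[symmetric] sum_divide_distrib sum_negf[symmetric]) 
          (auto intro!: sum.cong simp: field_simps)
      moreover have "\<epsilon>\<^sup>2 * V / 2 / (\<epsilon> * sqrt V) = \<epsilon> * sqrt V / 2"
        using \<epsilon> V by (simp add: power2_eq_square field_simps)
      ultimately have sh: "((\<Sum>i<n. w i * m f i) - c) / (\<epsilon> * sqrt V) = - (\<epsilon> * sqrt V / 2)"
        "((\<Sum>i<n. w i * m g i) - c) / (\<epsilon> * sqrt V) = \<epsilon> * sqrt V / 2"
        by simp_all
      have A: "?A = {y \<in> space (?P f). 0 \<le> ?S y}" "?A' = {y \<in> space (?P g). ?S y < 0}"
      proof -
        have pos: "\<epsilon> * sqrt V > 0" using \<epsilon> V by simp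
        show "?A = {y \<in> space (?P f). 0 \<le> ?S y}" "?A' = {y \<in> space (?P g). ?S y < 0}"
          by (simp_all add: pos_le_divide_eq[OF pos] pos_divide_less_eq[OF pos])
      qed
      have "measure (?P f) ?A = std_normal_cdf (- (\<epsilon> * sqrt V / 2))"
        unfolding A(1) using has_normal_law_tails(4)[OF law[OF f], of 0] unfolding sh by simp
      moreover have "measure (?P g) ?A' = std_normal_cdf (- (\<epsilon> * sqrt V / 2))"
        unfolding A(2) using has_normal_law_tails(2)[OF law[OF g], of 0] unfolding sh by simp
      moreover have "std_normal_cdf (- \<delta> / 2) \<le> std_normal_cdf (- (\<epsilon> * sqrt V / 2))"
        using \<delta>V by (intro std_normal_cdf_mono) simp
      ultimately show ?thesis by simp
    qed
  qed
  with NP show ?thesis by linarith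
qed

section \<open>From finitely many increments to all events\<close>

text \<open>A single \<open>C\<close> must be close under both measures, because an error sum
  evaluates the same test under both laws. Closeness passes to complements, whose symmetric
  difference is unchanged, and to countable unions by cutting at an index good for both measures and
  approximating the finitely many members left.\<close>

lemma approx_by_algebra:
  assumes G: "algebra \<Omega> G" and P: "finite_measure P" "sets P = sigma_sets \<Omega> G"
    and Q: "finite_measure Q" "sets Q = sigma_sets \<Omega> G"
    and A: "A \<in> sigma_sets \<Omega> G" and e: "0 < (e::real)"
  shows "\<exists>C\<in>G. measure P (sym_diff A C) < e \<and> measure Q (sym_diff A C) < e"
  using A e
proof (induction A arbitrary: e rule: sigma_sets.induct)
  case (Basic A)
  then show ?case by (intro bexI[of _ A]) auto
next
  case Empty
  interpret algebra \<Omega> G by fact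
  show ?case using Empty by (intro bexI[of _ "{}"]) auto
next
  case (Compl A)
  interpret algebra \<Omega> G by fact
  obtain C where C: "C \<in> G" "measure P (sym_diff A C) < e" "measure Q (sym_diff A C) < e"
    using Compl.IH[OF Compl.prems] by blast
  have "A \<subseteq> \<Omega>" "C \<subseteq> \<Omega>"
    using Compl.hyps C(1) sigma_sets_into_sp[OF space_closed] sets_into_space by auto
  then have "sym_diff (\<Omega> - A) (\<Omega> - C) = sym_diff A C" by auto
  then show ?case using C by (intro bexI[of _ "\<Omega> - C"]) auto
next
  case (Union A)
  interpret algebra \<Omega> G by fact
  interpret P: finite_measure P by fact
  interpret Q: finite_measure Q by fact
  have tail: "\<exists>N0. \<forall>N\<ge>N0. measure R ((\<Union>i. A i) - (\<Union>i<N. A i)) < e / 2"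
    if R: "finite_measure R" "sets R = sigma_sets \<Omega> G" for R
  proof -
    interpret R: finite_measure R by fact
    have A: "A i \<in> sets R" for i using Union.hyps R by auto
    have "(\<lambda>N. measure R (\<Union>i<N. A i)) \<longlonglongrightarrow> measure R (\<Union>N. \<Union>i<N. A i)"
    proof (rule R.finite_Lim_measure_incseq)
      show "incseq (\<lambda>N. \<Union>i<N. A i)" unfolding incseq_def by (intro allI impI UN_mono) auto
    qed (use A in auto)
    moreover have "(\<Union>N. \<Union>i<N. A i) = (\<Union>i. A i)" by auto
    ultimately have "(\<lambda>N. measure R (\<Union>i. A i) - measure R (\<Union>i<N. A i)) \<longlonglongrightarrow>
        measure R (\<Union>i. A i) - measure R (\<Union>i. A i)"
      by (intro tendsto_diff tendsto_const) simp
    then have "eventually (\<lambda>N. measure R (\<Union>i. A i) - measure R (\<Union>i<N. A i) < e / 2) sequentially"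
      by (rule order_tendstoD(2)) (use Union.prems in simp)
    moreover have "measure R ((\<Union>i. A i) - (\<Union>i<N. A i)) = measure R (\<Union>i. A i) - measure R (\<Union>i<N. A i)" for N
      using A by (intro R.finite_measure_Diff) auto
    ultimately show ?thesis by (simp add: eventually_sequentially)
  qed
  obtain N where N: "measure P ((\<Union>i. A i) - (\<Union>i<N. A i)) < e / 2"
    "measure Q ((\<Union>i. A i) - (\<Union>i<N. A i)) < e / 2"
    using tail[OF P] tail[OF Q] by (meson max.cobounded1 max.cobounded2)
  \<comment> \<open>The N approximations together cost at most N e' \<le> e / 2; the added 1 also
    covers N = 0.\<close>
  define e' where "e' = e / (2 * (real N + 1))"
  have "e' > 0" using Union.prems by (simp add: e'_def)
  then have "\<forall>i. \<exists>C\<in>G. measure P (sym_diff (A i) C) < e' \<and> measure Q (sym_diff (A i) C) < e'"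
    using Union.IH by blast
  then obtain C where C: "\<And>i. C i \<in> G" "\<And>i. measure P (sym_diff (A i) (C i)) < e'"
    "\<And>i. measure Q (sym_diff (A i) (C i)) < e'"
    by metis
  have CG: "(\<Union>i<N. C i) \<in> G" using C(1) by (intro finite_UN) auto
  have bound: "measure R (sym_diff (\<Union>i. A i) (\<Union>i<N. C i)) < e"
    if R: "finite_measure R" "sets R = sigma_sets \<Omega> G"
      and b: "measure R ((\<Union>i. A i) - (\<Union>i<N. A i)) < e / 2" "\<And>i. measure R (sym_diff (A i) (C i)) < e'" for R
  proof -
    interpret R: finite_measure R by fact
    have A: "A i \<in> sets R" for i using Union.hyps R by auto
    have C': "C i \<in> sets R" for i using C(1) R by auto
    have "measure R (sym_diff (\<Union>i. A i) (\<Union>i<N. C i))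
        \<le> measure R (((\<Union>i. A i) - (\<Union>i<N. A i)) \<union> (\<Union>i<N. sym_diff (A i) (C i)))"
      using A C' by (intro R.finite_measure_mono) auto
    also have "\<dots> \<le> measure R ((\<Union>i. A i) - (\<Union>i<N. A i)) + measure R (\<Union>i<N. sym_diff (A i) (C i))"
      using A C' by (intro measure_Un_le) auto
    also have "measure R (\<Union>i<N. sym_diff (A i) (C i)) \<le> (\<Sum>i<N. measure R (sym_diff (A i) (C i)))"
      using A C' by (intro measure_UNION_le) auto
    also have "\<dots> \<le> (\<Sum>i<N. e')" using b(2) by (intro sum_mono less_imp_le)
    also have "\<dots> \<le> e / 2" using Union.prems by (simp add: e'_def field_simps)
    finally show ?thesis using b(1) by linarith
  qed
  show ?case using CG bound[OF P N(1) C(2)] bound[OF Q N(2) C(3)] by blast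
qed

text \<open>Adjoining 0 and 1 guarantees at least one cell and a first node 0, from which
  coordinates are recovered by summing increments.\<close>

lemma ex_strict_grid:
  assumes J: "finite J" "J \<subseteq> {0..1::real}"
  obtains \<tau> n where "n > 0" "\<tau> 0 = 0" "\<And>i. i \<le> n \<Longrightarrow> \<tau> i \<in> {0..1}" "\<And>i. i < n \<Longrightarrow> \<tau> i < \<tau> (Suc i)"
    "\<And>t. t \<in> J \<Longrightarrow> \<exists>i\<le>n. \<tau> i = t"
proof -
  define xs where "xs = sorted_list_of_set (J \<union> {0, 1})"
  have fin: "finite (J \<union> {0, 1})" using J by simp
  have set: "set xs = J \<union> {0, 1}" unfolding xs_def using fin by (rule set_sorted_list_of_set)
  have sorted: "sorted_wrt (<) xs" unfolding xs_def by (rule strict_sorted_list_of_set)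
  have len: "length xs = card (J \<union> {0, 1})" unfolding xs_def by (rule length_sorted_list_of_set)
  have "card {0, 1::real} \<le> length xs" unfolding len using fin by (intro card_mono) auto
  then have len2: "length xs \<ge> 2" by simp
  have less: "xs ! i < xs ! j" if "i < j" "j < length xs" for i j
    using sorted that by (rule sorted_wrt_nth_less)
  have in01: "xs ! i \<in> {0..1}" if "i < length xs" for i
    using nth_mem[OF that] set J(2) by auto
  have idx: "\<exists>i<length xs. xs ! i = t" if "t \<in> J \<union> {0, 1}" for t
    using that set by (metis in_set_conv_nth)
  obtain i0 where i0: "i0 < length xs" "xs ! i0 = 0" using idx[of 0] by auto
  have "xs ! 0 = 0"
  proof (cases "i0 = 0")
    case False
    then have "xs ! 0 < 0" using less[of 0 i0] i0 by auto
    moreover have "0 < length xs" using len2 by linarith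
    then have "xs ! 0 \<in> {0..1}" by (rule in01)
    ultimately show ?thesis by simp
  qed (use i0 in simp)
  show thesis
  proof (rule that[of "length xs - 1" "\<lambda>i. xs ! i"])
    show "\<exists>i\<le>length xs - 1. xs ! i = t" if "t \<in> J" for t
    proof -
      obtain i where i: "i < length xs" "xs ! i = t" using idx[OF UnI1[OF \<open>t \<in> J\<close>]] by blast
      then have "i \<le> length xs - 1" by simp
      with i show ?thesis by blast
    qed
  qed (use len2 \<open>xs ! 0 = 0\<close> in01 less in auto)
qed

text \<open>As $Y(0) = 0$ almost surely, a cylinder set is up to null sets an event about finitely many
  increments; the cylinder sets form an algebra that approximates all measurable sets.\<close>

lemma (in brownian_motion01) test_error_ge:
  assumes f: "bounded_measurable01 f" and g: "bounded_measurable01 g" and \<epsilon>: "\<epsilon> > 0"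
    and A: "A \<in> sets path_space" and \<delta>: "L2_norm01 (\<lambda>x. f x - g x) \<le> \<delta> * \<epsilon>"
  shows "2 * std_normal_cdf (- \<delta> / 2)
    \<le> measure (observation_law M W \<epsilon> f) A + measure (observation_law M W \<epsilon> g) (space path_space - A)"
proof -
  let ?P = "\<lambda>h. observation_law M W \<epsilon> h"
  interpret F: prob_space "?P f" by (rule prob_space_observation_law)
  interpret G: prob_space "?P g" by (rule prob_space_observation_law)
  have start: "AE y in ?P h. y 0 = 0" for h
  proof -
    have "Measurable.pred path_space (\<lambda>y. y 0 = 0)"
      by (intro pred_eq_const1[where N = borel] measurable_component_singleton) auto
    moreover have "AE \<omega> in M. observed_path W \<epsilon> h \<omega> 0 = 0"
      using start_zero
    proof eventually_elim
      case (elim \<omega>)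
      have "(LBINT s:{0..0}. h s) = 0" by (simp add: set_integral_at_point)
      then show ?case using elim by (simp add: observed_path_def)
    qed
    ultimately show ?thesis
      unfolding observation_law_def by (subst AE_distr_iff) (auto simp: pred_def)
  qed
  have cylinder: "2 * std_normal_cdf (- \<delta> / 2)
      \<le> measure (?P f) (prod_emb {0..1} (\<lambda>_. borel) J X) + measure (?P g) (space path_space - prod_emb {0..1} (\<lambda>_. borel) J X)"
    if J: "finite J" "J \<subseteq> {0..1}" and X: "X \<in> sets (PiM J (\<lambda>_. borel))" for J and X :: "(real \<Rightarrow> real) set"
  proof -
    obtain \<tau> n where n: "n > 0" and \<tau>0: "\<tau> 0 = 0" and \<tau>: "\<And>i. i \<le> n \<Longrightarrow> \<tau> i \<in> {0..1::real}"
      "\<And>i. i < n \<Longrightarrow> \<tau> i < \<tau> (Suc i)" and cover: "\<And>t. t \<in> J \<Longrightarrow> \<exists>i\<le>n. \<tau> i = t"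
      using ex_strict_grid[OF J] by metis
    obtain k where k: "\<And>t. t \<in> J \<Longrightarrow> k t \<le> n \<and> \<tau> (k t) = t" using cover by metis
    let ?K = "PiM {..<n} (\<lambda>_::nat. borel :: real measure)"
    \<comment> \<open>Partial sums of the increments rebuild the path on J once it starts at 0; this
      turns a cylinder set into an event about increments.\<close>
    define \<Sigma> where "\<Sigma> v = (\<lambda>t\<in>J. \<Sum>i<k t. v i)" for v :: "nat \<Rightarrow> real"
    have meas: "\<Sigma> \<in> measurable ?K (PiM J (\<lambda>_. borel))"
      unfolding \<Sigma>_def
    proof (intro measurable_restrict borel_measurable_sum)
      fix t i assume "t \<in> J" "i \<in> {..<k t}"
      then have "i \<in> {..<n}" using k[of t] by auto
      then show "(\<lambda>v. v i) \<in> borel_measurable ?K" by (rule measurable_component_singleton)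
    qed
    define B where "B = \<Sigma> -` X \<inter> space ?K"
    have B: "B \<in> sets ?K" unfolding B_def using meas X by (rule measurable_sets)
    have X': "path_increments \<tau> n \<in> measurable path_space ?K"
      by (rule path_increments_measurable) (rule \<tau>(1))
    have rest: "\<Sigma> (path_increments \<tau> n y) = restrict y J" if "y 0 = 0" for y
    proof (rule ext)
      fix t
      show "\<Sigma> (path_increments \<tau> n y) t = restrict y J t"
      proof (cases "t \<in> J")
        case True
        then have "(\<Sum>i<k t. path_increments \<tau> n y i) = (\<Sum>i<k t. y (\<tau> (Suc i)) - y (\<tau> i))"
          using k[OF True] by (intro sum.cong) (auto simp: path_increments_def)
        also have "\<dots> = y (\<tau> (k t)) - y (\<tau> 0)" by (rule sum_lessThan_telescope)
        finally show ?thesis using True k[OF True] \<tau>0 that by (simp add: \<Sigma>_def)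
      qed (simp add: \<Sigma>_def)
    qed
    have iff: "path_increments \<tau> n y \<in> B \<longleftrightarrow> y \<in> prod_emb {0..1} (\<lambda>_. borel) J X"
      if "y 0 = 0" "y \<in> space path_space" for y
      using that measurable_space[OF X' that(2)] rest[of y, OF that(1)]
      by (auto simp: B_def prod_emb_def space_PiM)
    have emb: "prod_emb {0..1} (\<lambda>_. borel) J X \<in> sets path_space"
      using J X by (intro measurable_prod_emb) auto
    have inc: "{y \<in> space path_space. path_increments \<tau> n y \<in> B} \<in> sets path_space"
      "{y \<in> space path_space. path_increments \<tau> n y \<notin> B} \<in> sets path_space"
      using X' B by measurable
    have "measure (?P f) {y \<in> space path_space. path_increments \<tau> n y \<in> B}
        = measure (?P f) (prod_emb {0..1} (\<lambda>_. borel) J X)"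
    proof (rule F.finite_measure_eq_AE)
      show "AE y in ?P f. y \<in> {y \<in> space path_space. path_increments \<tau> n y \<in> B}
          \<longleftrightarrow> y \<in> prod_emb {0..1} (\<lambda>_. borel) J X"
        using start[of f] AE_space by eventually_elim (use iff in auto)
    qed (use inc emb in auto)
    moreover have "measure (?P g) {y \<in> space path_space. path_increments \<tau> n y \<notin> B}
        = measure (?P g) (space path_space - prod_emb {0..1} (\<lambda>_. borel) J X)"
    proof (rule G.finite_measure_eq_AE)
      show "AE y in ?P g. y \<in> {y \<in> space path_space. path_increments \<tau> n y \<notin> B}
          \<longleftrightarrow> y \<in> space path_space - prod_emb {0..1} (\<lambda>_. borel) J X"
        using start[of g] AE_space by eventually_elim (use iff in auto)
    qed (use inc emb in auto)
    ultimately show ?thesis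
      using path_increments_test_error_ge[OF f g \<epsilon> n _ _ B \<delta>, of \<tau>] \<tau> by simp
  qed
  \<comment> \<open>The marginals of one law are trivially consistent; the interpretation supplies
    the algebra of cylinder sets and the fact that it generates the product sigma-algebra.\<close>
  interpret Pr: projective_family "{0..1::real}" "\<lambda>J. distr (?P f) (PiM J (\<lambda>_. borel)) (\<lambda>y. restrict y J)" "\<lambda>_. borel"
  proof (rule projective_family.intro)
    show "prob_space (distr (?P f) (PiM J (\<lambda>_. borel)) (\<lambda>y. restrict y J))" if "J \<subseteq> {0..1}" for J
      using that by (intro F.prob_space_distr) (simp add: measurable_restrict_subset cong: measurable_cong_sets)
    show "distr (?P f) (PiM J (\<lambda>_. borel)) (\<lambda>y. restrict y J)
        = distr (distr (?P f) (PiM H (\<lambda>_. borel)) (\<lambda>y. restrict y H)) (PiM J (\<lambda>_. borel)) (\<lambda>f. restrict f J)"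
      if "J \<subseteq> H" "H \<subseteq> {0..1}" for J H
    proof (subst distr_distr)
      show "(\<lambda>f. restrict f J) \<in> measurable (PiM H (\<lambda>_. borel)) (PiM J (\<lambda>_. borel))"
        using that by (intro measurable_restrict_subset)
      show "(\<lambda>y. restrict y H) \<in> measurable (?P f) (PiM H (\<lambda>_. borel))"
        using that by (simp add: measurable_restrict_subset cong: measurable_cong_sets)
      show "distr (?P f) (PiM J (\<lambda>_. borel)) (\<lambda>y. restrict y J)
          = distr (?P f) (PiM J (\<lambda>_. borel)) ((\<lambda>f. restrict f J) \<circ> (\<lambda>y. restrict y H))"
        using that by (intro distr_cong) (auto simp: comp_def restrict_def fun_eq_iff)
    qed
  qed
  have gen: "sets (?P h) = sigma_sets (space path_space) Pr.generator" for h
    using Pr.sets_PiM_generator by simp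
  have "2 * std_normal_cdf (- \<delta> / 2) \<le> measure (?P f) A + measure (?P g) (space path_space - A) + 2 * e"
    if e: "e > 0" for e
  proof -
    have "A \<in> sigma_sets (space path_space) Pr.generator"
      using A Pr.sets_PiM_generator by simp
    then obtain C where C: "C \<in> Pr.generator" "measure (?P f) (sym_diff A C) < e" "measure (?P g) (sym_diff A C) < e"
      using approx_by_algebra[OF Pr.algebra_generator F.finite_measure_axioms gen G.finite_measure_axioms gen _ e]
      by blast
    have CS: "C \<in> sets path_space" using C(1) Pr.sets_PiM_generator by auto
    have "2 * std_normal_cdf (- \<delta> / 2) \<le> measure (?P f) C + measure (?P g) (space path_space - C)"
      using C(1) by cases (simp only: cylinder)
    also have "measure (?P f) C \<le> measure (?P f) (A \<union> sym_diff A C)"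
      using A CS by (intro F.finite_measure_mono) auto
    also have "\<dots> \<le> measure (?P f) A + measure (?P f) (sym_diff A C)"
      using A CS by (intro measure_Un_le) auto
    also have "measure (?P g) (space path_space - C) \<le> measure (?P g) ((space path_space - A) \<union> sym_diff A C)"
      using A CS by (intro G.finite_measure_mono) auto
    also have "\<dots> \<le> measure (?P g) (space path_space - A) + measure (?P g) (sym_diff A C)"
      using A CS by (intro measure_Un_le) auto
    finally show ?thesis using C(2,3) by linarith
  qed
  then have "2 * std_normal_cdf (- \<delta> / 2) \<le> measure (?P f) A + measure (?P g) (space path_space - A) + e"
    if "e > 0" for e
    using that[THEN half_gt_zero] by fastforce
  then show ?thesis by (rule field_le_epsilon)
qed

section \<open>Lower bounds for the benchmarks\<close>

text \<open>Testing at the single threshold d/2 with Markov's inequality would lose a factor 2.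
  Instead the test bound with \<delta> = 1 is integrated over all thresholds s in [0, d): with U the
  error under f, the events s < U integrate to at most U, and the events U \<le> s to at most the
  error under g. The two risks thus add up to at least 2 \<Phi>(-1/2) d, and the larger is at least
  half of that.\<close>

lemma (in brownian_motion01) estimation_benchmark_ge:
  assumes f: "f \<in> convex_class" and \<epsilon>: "\<epsilon> > 0"
  shows "ennreal (std_normal_cdf (- 0.5)) * local_modulus T \<epsilon> f \<le> estimation_benchmark M W T \<epsilon> f"
proof -
  define c where "c = std_normal_cdf (- 0.5)"
  have c0: "c \<ge> 0" by (simp add: c_def std_normal_cdf_nonneg)
  have main: "ennreal c * ennreal \<bar>T f - T g\<bar> \<le> max (estimation_risk M W T \<epsilon> T_hat f) (estimation_risk M W T \<epsilon> T_hat g)"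
    if g: "g \<in> convex_class" "L2_norm01 (\<lambda>t. f t - g t) \<le> \<epsilon>" and Th: "T_hat \<in> borel_measurable path_space" for g T_hat
  proof -
    define d where "d = \<bar>T f - T g\<bar>"
    define U where "U y = \<bar>T_hat y - T f\<bar>" for y
    let ?P = "observation_law M W \<epsilon> f" and ?Q = "observation_law M W \<epsilon> g"
    interpret F: prob_space ?P by (rule prob_space_observation_law)
    interpret G: prob_space ?Q by (rule prob_space_observation_law)
    have U [measurable]: "U \<in> borel_measurable path_space" unfolding U_def using Th by measurable
    interpret FL: pair_sigma_finite ?P "lborel :: real measure" ..
    interpret GL: pair_sigma_finite ?Q "lborel :: real measure" ..
    have "ennreal (2 * c * d) = (\<integral>\<^sup>+s. ennreal (2 * c) * indicator {0..<d} s \<partial>lborel)"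
      using c0 by (subst nn_integral_cmult_indicator) (auto simp: d_def ennreal_mult'[symmetric])
    also have "\<dots> \<le> (\<integral>\<^sup>+s. (\<integral>\<^sup>+y. indicator {0..<d} s * indicator {s<..} (U y) \<partial>?P)
        + (\<integral>\<^sup>+y. indicator {0..<d} s * indicator {..s} (U y) \<partial>?Q) \<partial>lborel)"
    proof (intro nn_integral_mono)
      fix s :: real
      have S: "{y \<in> space path_space. s < U y} \<in> sets path_space" "{y \<in> space path_space. U y \<le> s} \<in> sets path_space"
        by measurable
      have "2 * std_normal_cdf (- 1 / 2) \<le> measure ?P {y \<in> space path_space. s < U y}
          + measure ?Q (space path_space - {y \<in> space path_space. s < U y})"
        using g f by (intro test_error_ge convex_class_bounded_measurable \<epsilon> S) simp_all
      also have "space path_space - {y \<in> space path_space. s < U y} = {y \<in> space path_space. U y \<le> s}"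
        by auto
      finally have "2 * c \<le> measure ?P {y \<in> space path_space. s < U y} + measure ?Q {y \<in> space path_space. U y \<le> s}"
        by (simp add: c_def)
      then have "ennreal (2 * c) \<le> ennreal (measure ?P {y \<in> space path_space. s < U y} + measure ?Q {y \<in> space path_space. U y \<le> s})"
        by (rule ennreal_leI)
      also have "\<dots> = emeasure ?P {y \<in> space path_space. s < U y} + emeasure ?Q {y \<in> space path_space. U y \<le> s}"
        by (simp add: F.emeasure_eq_measure G.emeasure_eq_measure)
      also have "emeasure ?P {y \<in> space path_space. s < U y} = (\<integral>\<^sup>+y. indicator {s<..} (U y) \<partial>?P)"
        using S by (intro trans[OF nn_integral_indicator[symmetric]] nn_integral_cong) (auto simp: indicator_def)
      also have "emeasure ?Q {y \<in> space path_space. U y \<le> s} = (\<integral>\<^sup>+y. indicator {..s} (U y) \<partial>?Q)"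
        using S by (intro trans[OF nn_integral_indicator[symmetric]] nn_integral_cong) (auto simp: indicator_def)
      finally show "ennreal (2 * c) * indicator {0..<d} s \<le> (\<integral>\<^sup>+y. indicator {0..<d} s * indicator {s<..} (U y) \<partial>?P)
          + (\<integral>\<^sup>+y. indicator {0..<d} s * indicator {..s} (U y) \<partial>?Q)"
        by (cases "s \<in> {0..<d}") auto
    qed
    also have "\<dots> = (\<integral>\<^sup>+s. \<integral>\<^sup>+y. indicator {0..<d} s * indicator {s<..} (U y) \<partial>?P \<partial>lborel)
        + (\<integral>\<^sup>+s. \<integral>\<^sup>+y. indicator {0..<d} s * indicator {..s} (U y) \<partial>?Q \<partial>lborel)"
      by (rule nn_integral_add)
        (simp_all add: indicator_def greaterThan_def atMost_def)
    also have "(\<integral>\<^sup>+s. \<integral>\<^sup>+y. indicator {0..<d} s * indicator {s<..} (U y) \<partial>?P \<partial>lborel)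
        = (\<integral>\<^sup>+y. \<integral>\<^sup>+s. indicator {0..<d} s * indicator {s<..} (U y) \<partial>lborel \<partial>?P)"
      by (rule FL.Fubini') (simp add: indicator_def greaterThan_def)
    also have "\<dots> \<le> (\<integral>\<^sup>+y. ennreal \<bar>T_hat y - T f\<bar> \<partial>?P)"
    proof (intro nn_integral_mono)
      fix y
      have "(\<integral>\<^sup>+s. indicator {0..<d} s * indicator {s<..} (U y) \<partial>lborel) \<le> (\<integral>\<^sup>+s. indicator {0..<U y} s \<partial>lborel)"
        by (intro nn_integral_mono) (auto simp: indicator_def)
      then show "(\<integral>\<^sup>+s. indicator {0..<d} s * indicator {s<..} (U y) \<partial>lborel) \<le> ennreal \<bar>T_hat y - T f\<bar>"
        by (simp add: U_def)
    qed
    also have "(\<integral>\<^sup>+s. \<integral>\<^sup>+y. indicator {0..<d} s * indicator {..s} (U y) \<partial>?Q \<partial>lborel)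
        = (\<integral>\<^sup>+y. \<integral>\<^sup>+s. indicator {0..<d} s * indicator {..s} (U y) \<partial>lborel \<partial>?Q)"
      by (rule GL.Fubini') (simp add: indicator_def atMost_def)
    also have "\<dots> \<le> (\<integral>\<^sup>+y. ennreal \<bar>T_hat y - T g\<bar> \<partial>?Q)"
    proof (intro nn_integral_mono)
      fix y
      have "(\<integral>\<^sup>+s. indicator {0..<d} s * indicator {..s} (U y) \<partial>lborel) \<le> (\<integral>\<^sup>+s. indicator {U y..max d (U y)} s \<partial>lborel)"
        by (intro nn_integral_mono) (auto simp: indicator_def)
      also have "\<dots> = ennreal (max d (U y) - U y)" by simp
      also have "\<dots> \<le> ennreal \<bar>T_hat y - T g\<bar>" by (intro ennreal_leI) (auto simp: U_def d_def)
      finally show "(\<integral>\<^sup>+s. indicator {0..<d} s * indicator {..s} (U y) \<partial>lborel) \<le> ennreal \<bar>T_hat y - T g\<bar>" .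
    qed
    finally have "ennreal (2 * c * d) \<le> estimation_risk M W T \<epsilon> T_hat f + estimation_risk M W T \<epsilon> T_hat g"
      by (simp add: estimation_risk_def)
    also have "\<dots> \<le> 2 * max (estimation_risk M W T \<epsilon> T_hat f) (estimation_risk M W T \<epsilon> T_hat g)"
      unfolding mult_2 by (intro add_mono) auto
    finally have "2 * (ennreal c * ennreal d) \<le> 2 * max (estimation_risk M W T \<epsilon> T_hat f) (estimation_risk M W T \<epsilon> T_hat g)"
      using c0 by (simp add: ennreal_mult' mult.assoc d_def)
    then show ?thesis
      unfolding d_def by (subst (asm) ennreal_mult_le_mult_iff) auto
  qed
  show ?thesis
    unfolding local_modulus_def estimation_benchmark_def c_def[symmetric] SUP_mult_left_ennreal
    by (intro SUP_mono) (auto intro!: INF_greatest main)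
qed

text \<open>Whether the interval covers T g is itself a test. With \<delta> = 1/3 its error sum is
  at least 5/6, so under f the value T g is covered with probability at least 5/6 - \<alpha>, hence
  both values with probability at least 5/6 - 2 \<alpha>; on that event the interval is at least d
  long.\<close>

lemma (in brownian_motion01) inference_benchmark_ge:
  assumes f: "f \<in> convex_class" and \<epsilon>: "\<epsilon> > 0" and \<alpha>: "0 < \<alpha>" "\<alpha> < 0.3"
  shows "ennreal (0.6 - 2 * \<alpha>) * local_modulus T (\<epsilon> / 3) f \<le> inference_benchmark M W T \<alpha> \<epsilon> f"
proof -
  have main: "ennreal (0.6 - 2 * \<alpha>) * ennreal \<bar>T f - T g\<bar> \<le> (\<integral>\<^sup>+ y. ennreal (u y - l y) \<partial>observation_law M W \<epsilon> f)"
    if g: "g \<in> convex_class" "L2_norm01 (\<lambda>t. f t - g t) \<le> \<epsilon> / 3"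
      and CI: "(l, u) \<in> confidence_intervals M W T \<alpha> \<epsilon> {f, g}" for g l u
  proof -
    define d where "d = \<bar>T f - T g\<bar>"
    let ?P = "observation_law M W \<epsilon> f" and ?Q = "observation_law M W \<epsilon> g"
    interpret F: prob_space ?P by (rule prob_space_observation_law)
    interpret G: prob_space ?Q by (rule prob_space_observation_law)
    have meas: "l \<in> borel_measurable path_space" "u \<in> borel_measurable path_space"
      using CI by (auto simp: confidence_intervals_def)
    define A where "A c = {y \<in> space path_space. c \<in> {l y..u y}}" for c
    have "A c = {y \<in> space path_space. l y \<le> c} \<inter> {y \<in> space path_space. c \<le> u y}" for c
      by (auto simp: A_def)
    then have A: "A c \<in> sets path_space" for c
      using meas by (auto intro!: borel_measurable_le)
    have cov: "1 - \<alpha> \<le> measure ?P (A (T f))" "1 - \<alpha> \<le> measure ?Q (A (T g))"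
      using CI by (auto simp: confidence_intervals_def A_def)
    have "5 / 6 \<le> 2 * std_normal_cdf (- (1 / 3) / 2)"
      using std_normal_cdf_diff_le[of "- 1 / 6" 0] by (simp add: std_normal_cdf_0)
    also have "\<dots> \<le> measure ?P (A (T g)) + measure ?Q (space path_space - A (T g))"
      using g f by (intro test_error_ge convex_class_bounded_measurable \<epsilon> A) simp_all
    also have "measure ?Q (space path_space - A (T g)) = 1 - measure ?Q (A (T g))"
      using G.prob_compl[of "A (T g)"] A by simp
    finally have Pg: "5 / 6 - \<alpha> \<le> measure ?P (A (T g))" using cov(2) by linarith
    have "measure ?P (A (T f) \<union> A (T g)) = measure ?P (A (T f)) + measure ?P (A (T g)) - measure ?P (A (T f) \<inter> A (T g))"
      by (rule measure_Un3) (use A in \<open>auto simp: F.fmeasurable_eq_sets\<close>)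
    then have both: "0.6 - 2 * \<alpha> \<le> measure ?P (A (T f) \<inter> A (T g))"
      using F.prob_le_1[of "A (T f) \<union> A (T g)"] cov(1) Pg by simp
    have "ennreal (0.6 - 2 * \<alpha>) * ennreal d \<le> ennreal (measure ?P (A (T f) \<inter> A (T g))) * ennreal d"
      using both by (intro mult_right_mono ennreal_leI) auto
    also have "\<dots> = (\<integral>\<^sup>+y. ennreal d * indicator (A (T f) \<inter> A (T g)) y \<partial>?P)"
      using A by (subst nn_integral_cmult_indicator) (auto simp: F.emeasure_eq_measure mult.commute)
    also have "\<dots> \<le> (\<integral>\<^sup>+ y. ennreal (u y - l y) \<partial>?P)"
      by (intro nn_integral_mono) (auto simp: A_def d_def indicator_def intro!: ennreal_leI)
    finally show ?thesis by (simp add: d_def)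
  qed
  show ?thesis
    unfolding local_modulus_def inference_benchmark_def SUP_mult_left_ennreal
  proof (intro SUP_mono)
    fix g assume g: "g \<in> {g \<in> convex_class. L2_norm01 (\<lambda>t. f t - g t) \<le> \<epsilon> / 3}"
    show "\<exists>m\<in>convex_class. ennreal (0.6 - 2 * \<alpha>) * ennreal \<bar>T f - T g\<bar>
        \<le> (INF (l, u)\<in>confidence_intervals M W T \<alpha> \<epsilon> {f, m}.
              \<integral>\<^sup>+ y. ennreal (u y - l y) \<partial>observation_law M W \<epsilon> f)"
    proof (intro bexI[of _ g] INF_greatest)
      fix lu assume "lu \<in> confidence_intervals M W T \<alpha> \<epsilon> {f, g}"
      then show "ennreal (0.6 - 2 * \<alpha>) * ennreal \<bar>T f - T g\<bar>
          \<le> (case lu of (l, u) \<Rightarrow> \<integral>\<^sup>+ y. ennreal (u y - l y) \<partial>observation_law M W \<epsilon> f)"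
        using g main[of g "fst lu" "snd lu"] by (simp add: case_prod_beta)
    qed (use g in simp)
  qed
qed

theorem theorem2p1:
  fixes M :: "'a measure" and W :: "real \<Rightarrow> 'a \<Rightarrow> real"
    and \<alpha> \<epsilon> :: real and f :: "real \<Rightarrow> real"
  defines "a\<^sub>1 \<equiv> ennreal (std_normal_cdf (- 0.5))"
    and "A\<^sub>1 \<equiv> ennreal 1.5"
    and "b \<equiv> ennreal (0.6 - 2 * \<alpha>)"
    and "B \<equiv> ennreal (3 * (1 - 2 * \<alpha>) * normal_quantile \<alpha>)"
  assumes "brownian_motion01 M W"
    and "0 < \<alpha>" and "\<alpha> < 0.3"
    and "f \<in> convex_class"
    and "0 < \<epsilon>"
  shows
    "a\<^sub>1 * local_modulus minimizer \<epsilon> f \<le> estimation_benchmark M W minimizer \<epsilon> f \<and>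
     estimation_benchmark M W minimizer \<epsilon> f \<le> A\<^sub>1 * local_modulus minimizer \<epsilon> f \<and>
     a\<^sub>1 * local_modulus min_value \<epsilon> f \<le> estimation_benchmark M W min_value \<epsilon> f \<and>
     estimation_benchmark M W min_value \<epsilon> f \<le> A\<^sub>1 * local_modulus min_value \<epsilon> f \<and>
     b * local_modulus minimizer (\<epsilon> / 3) f \<le> inference_benchmark M W minimizer \<alpha> \<epsilon> f \<and>
     inference_benchmark M W minimizer \<alpha> \<epsilon> f \<le> B * local_modulus minimizer \<epsilon> f \<and>
     b * local_modulus min_value (\<epsilon> / 3) f \<le> inference_benchmark M W min_value \<alpha> \<epsilon> f \<and>
     inference_benchmark M W min_value \<alpha> \<epsilon> f \<le> B * local_modulus min_value \<epsilon> f"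
proof -
  interpret brownian_motion01 M W by fact
  show ?thesis
    unfolding a\<^sub>1_def A\<^sub>1_def b_def B_def
    using assms(6-9)
    by (intro conjI estimation_benchmark_ge estimation_benchmark_le inference_benchmark_ge
        inference_benchmark_le) simp_all
qed

end
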